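(* Let $\alpha\in\mathbb{R}$ with $|\alpha|<1$ and let $\{S(t)\}_{t\ge 0}$ be the semigroup on $L^2(I)$, $I=(0,1)$, associated to the linear Kawahara operator $A$. There exists $\omega>0$ such that for each $k\in\{0,1,2,3,4,5\}$ there is a constant $C_k>0$ such that $$\|S(t)u_0\|_{H^k_\alpha(I)}\le C_k e^{-\omega t}\|u_0\|_{H^k_\alpha(I)}$$ for all $t>0$ and all $u_0\in H^k_\alpha(I)$.
   Context: $I=(0,1)$; $L^2(I)$ is the space of square integrable complex-valued functions with inner product $(u,v)=\mathrm{Re}\int_0^1 u\overline v\,dx$ and norm $\|u\|=(u,u)^{1/2}$; $H^s(I)$ are the classical Sobolev spaces of complex-valued functions on $I$ with their usual norms. The linear Kawahara operator is $A:D(A)\subset L^2(I)\to L^2(I)$, $Au=-u_{xxx}+u_{xxxxx}$, with domain $D(A)=\{u\in H^5(I): u(0)=u(1)=u_x(0)=u_x(1)=0,\ u_{xx}(1)=\alpha u_{xx}(0)\}$. It generates a $C_0$-semigroup of contractions $\{S(t)\}_{t\ge0}$ on $L^2(I)$. For an integer $0\le k\le 5$, $H^k_\alpha(I)$ is the set of $u\in H^k(I)$ satisfying those among the conditions $u(0)=u(1)=0$, $u_x(0)=u_x(1)=0$, $u_{xx}(1)=\alpha u_{xx}(0)$ which involve derivatives of order at most $k-1$, with the norm inherited from $H^k(I)$ (so $H^0_\alpha(I)=L^2(I)$ and $H^5_\alpha(I)=D(A)$). *)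

theory Defs
  imports "HOL-Analysis.Analysis"
begin

abbreviation unit_measure :: "real measure" where
  "unit_measure \<equiv> lebesgue_on {0<..<1}"

definition square_integrable :: "(real \<Rightarrow> complex) \<Rightarrow> bool" where
  "square_integrable f \<longleftrightarrow>
     f \<in> borel_measurable unit_measure \<and> integrable unit_measure (\<lambda>x. (cmod (f x))\<^sup>2)"

lemma square_integrable_zero: "square_integrable (\<lambda>x. 0)"
  by (simp add: square_integrable_def)

lemma square_integrable_scale:
  assumes "square_integrable f" shows "square_integrable (\<lambda>x. c * f x)"
  using assms by (auto simp: square_integrable_def norm_mult power_mult_distrib)

lemma square_integrable_add:
  assumes f: "square_integrable f" and g: "square_integrable g"
  shows "square_integrable (\<lambda>x. f x + g x)"
  unfolding square_integrable_def
proof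
  show m: "(\<lambda>x. f x + g x) \<in> borel_measurable unit_measure"
    using f g by (auto simp: square_integrable_def)
  show "integrable unit_measure (\<lambda>x. (cmod (f x + g x))\<^sup>2)"
  proof (rule Bochner_Integration.integrable_bound)
    show "integrable unit_measure (\<lambda>x. 2 * (cmod (f x))\<^sup>2 + 2 * (cmod (g x))\<^sup>2)"
      using f g by (auto simp: square_integrable_def)
    show "(\<lambda>x. (cmod (f x + g x))\<^sup>2) \<in> borel_measurable unit_measure"
      using m by measurable
    have "(cmod (a + b))\<^sup>2 \<le> 2 * (cmod a)\<^sup>2 + 2 * (cmod b)\<^sup>2" for a b
    proof -
      have "(cmod (a + b))\<^sup>2 \<le> (cmod a + cmod b)\<^sup>2"
        by (intro power_mono norm_triangle_ineq) auto
      also have "\<dots> \<le> 2 * (cmod a)\<^sup>2 + 2 * (cmod b)\<^sup>2"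
        using sum_squares_bound[of "cmod a" "cmod b"] by (simp add: power2_sum)
      finally show ?thesis .
    qed
    then show "AE x in unit_measure. norm ((cmod (f x + g x))\<^sup>2)
        \<le> norm (2 * (cmod (f x))\<^sup>2 + 2 * (cmod (g x))\<^sup>2)"
      by auto
  qed
qed

lemma integrable_mult_cnj:
  assumes f: "square_integrable f" and g: "square_integrable g"
  shows "integrable unit_measure (\<lambda>x. f x * cnj (g x))"
proof (rule Bochner_Integration.integrable_bound)
  show "integrable unit_measure (\<lambda>x. (cmod (f x))\<^sup>2 + (cmod (g x))\<^sup>2)"
    using f g by (auto simp: square_integrable_def)
  have cnj: "(\<lambda>x. cnj (g x)) \<in> borel_measurable unit_measure"
    using g by (auto simp: square_integrable_def
        intro: measurable_compose[OF _ borel_measurable_continuous_onI[OF continuous_on_cnj[OF continuous_on_id]]])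
  show "(\<lambda>x. f x * cnj (g x)) \<in> borel_measurable unit_measure"
    using f cnj unfolding square_integrable_def by (intro borel_measurable_times) simp_all
  have "cmod a * cmod b \<le> (cmod a)\<^sup>2 + (cmod b)\<^sup>2" for a b
  proof -
    have "0 \<le> cmod a * cmod b" by simp
    then show ?thesis using sum_squares_bound[of "cmod a" "cmod b"] by linarith
  qed
  then show "AE x in unit_measure. norm (f x * cnj (g x))
      \<le> norm ((cmod (f x))\<^sup>2 + (cmod (g x))\<^sup>2)"
    by (auto simp: norm_mult)
qed

definition l2_rel :: "(real \<Rightarrow> complex) \<Rightarrow> (real \<Rightarrow> complex) \<Rightarrow> bool" where
  "l2_rel f g \<longleftrightarrow> square_integrable f \<and> square_integrable g \<and> (AE x in unit_measure. f x = g x)"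

quotient_type l2 = "real \<Rightarrow> complex" / partial: l2_rel
proof (rule part_equivpI)
  show "\<exists>f. l2_rel f f"
    using square_integrable_zero by (auto simp: l2_rel_def)
  show "symp l2_rel"
    by (rule sympI) (auto simp: l2_rel_def elim: AE_mp)
  show "transp l2_rel"
  proof (rule transpI)
    fix f g h assume 1: "l2_rel f g" and 2: "l2_rel g h"
    then have "AE x in unit_measure. f x = g x" "AE x in unit_measure. g x = h x"
      by (auto simp: l2_rel_def)
    then have "AE x in unit_measure. f x = h x" by eventually_elim simp
    with 1 2 show "l2_rel f h" by (simp add: l2_rel_def)
  qed
qed

text \<open>The space \<open>L\<^sup>2(0,1)\<close> of complex-valued functions is treated as a real inner product space under
  \<open>(u, v) = Re (\<integral> u * cnj v)\<close>.\<close>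

instantiation l2 :: real_inner
begin

lift_definition zero_l2 :: l2 is "\<lambda>x. 0"
  using square_integrable_zero by (auto simp: l2_rel_def)

lift_definition plus_l2 :: "l2 \<Rightarrow> l2 \<Rightarrow> l2" is "\<lambda>f g x. f x + g x"
  by (auto simp: l2_rel_def intro: square_integrable_add elim: eventually_elim2)

lift_definition scaleR_l2 :: "real \<Rightarrow> l2 \<Rightarrow> l2" is "\<lambda>r f x. complex_of_real r * f x"
  by (auto simp: l2_rel_def intro: square_integrable_scale)

definition uminus_l2 :: "l2 \<Rightarrow> l2" where "uminus_l2 u = (-1) *\<^sub>R u"

definition minus_l2 :: "l2 \<Rightarrow> l2 \<Rightarrow> l2" where "minus_l2 u v = u + (- v)"

lift_definition inner_l2 :: "l2 \<Rightarrow> l2 \<Rightarrow> real" is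
  "\<lambda>f g. Re (LINT x|unit_measure. f x * cnj (g x))"
proof -
  fix f f' g g' assume a: "l2_rel f f'" "l2_rel g g'"
  then have "AE x in unit_measure. f x = f' x" "AE x in unit_measure. g x = g' x"
    by (auto simp: l2_rel_def)
  then have "AE x in unit_measure. f x * cnj (g x) = f' x * cnj (g' x)"
    by eventually_elim simp
  then have "(LINT x|unit_measure. f x * cnj (g x)) = (LINT x|unit_measure. f' x * cnj (g' x))"
    using a by (intro integral_cong_AE borel_measurable_integrable integrable_mult_cnj)
      (auto simp: l2_rel_def)
  then show "Re (LINT x|unit_measure. f x * cnj (g x)) = Re (LINT x|unit_measure. f' x * cnj (g' x))"
    by simp
qed

definition norm_l2 :: "l2 \<Rightarrow> real" where "norm_l2 u = sqrt (u \<bullet> u)"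
definition dist_l2 :: "l2 \<Rightarrow> l2 \<Rightarrow> real" where "dist_l2 u v = norm (u - v)"
definition sgn_l2 :: "l2 \<Rightarrow> l2" where "sgn_l2 u = inverse (norm u) *\<^sub>R u"
definition uniformity_l2 :: "(l2 \<times> l2) filter" where
  "uniformity_l2 = (INF e\<in>{0<..}. principal {(x, y). dist x y < e})"
definition open_l2 :: "l2 set \<Rightarrow> bool" where
  "open_l2 U \<longleftrightarrow> (\<forall>x\<in>U. \<forall>\<^sub>F (x', y) in uniformity. x' = x \<longrightarrow> y \<in> U)"

instance
proof
  fix u v w :: l2 and r s :: real
  show "u + v + w = u + (v + w)"
    by transfer (auto simp: l2_rel_def add.assoc intro!: square_integrable_add)
  show "u + v = v + u"
    by transfer (auto simp: l2_rel_def add.commute intro!: square_integrable_add)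
  show "0 + u = u"
    by transfer (auto simp: l2_rel_def)
  show "- u + u = 0"
    unfolding uminus_l2_def
    by transfer (auto simp: l2_rel_def square_integrable_zero)
  show "u - v = u + - v"
    by (simp add: minus_l2_def)
  show "r *\<^sub>R (u + v) = r *\<^sub>R u + r *\<^sub>R v"
    by transfer
      (auto simp: l2_rel_def distrib_left intro!: square_integrable_add square_integrable_scale)
  show "(r + s) *\<^sub>R u = r *\<^sub>R u + s *\<^sub>R u"
    by transfer (simp add: l2_rel_def distrib_right square_integrable_add square_integrable_scale)
  show "r *\<^sub>R s *\<^sub>R u = (r * s) *\<^sub>R u"
    by transfer (auto simp: l2_rel_def mult.assoc intro!: square_integrable_scale)
  show "1 *\<^sub>R u = u"
    by transfer (auto simp: l2_rel_def)
  show "dist u v = norm (u - v)" by (rule dist_l2_def)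
  show "sgn u = inverse (norm u) *\<^sub>R u" by (rule sgn_l2_def)
  show "(uniformity :: (l2 \<times> l2) filter) = (INF e\<in>{0<..}. principal {(x, y). dist x y < e})"
    by (rule uniformity_l2_def)
  show "open U = (\<forall>x\<in>U. \<forall>\<^sub>F (x', y) in uniformity. x' = x \<longrightarrow> y \<in> U)" for U :: "l2 set"
    by (rule open_l2_def)
  show "norm u = sqrt (u \<bullet> u)" by (rule norm_l2_def)
  show "u \<bullet> v = v \<bullet> u"
  proof transfer
    fix f g assume "l2_rel f f" "l2_rel g g"
    have "(LINT x|unit_measure. f x * cnj (g x)) = (LINT x|unit_measure. cnj (g x * cnj (f x)))"
      by (simp add: mult.commute)
    also have "\<dots> = cnj (LINT x|unit_measure. g x * cnj (f x))"
      by (rule Bochner_Integration.integral_cnj)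
    finally show "Re (LINT x|unit_measure. f x * cnj (g x)) = Re (LINT x|unit_measure. g x * cnj (f x))"
      by simp
  qed
  show "(u + v) \<bullet> w = u \<bullet> w + v \<bullet> w"
    by transfer (auto simp: l2_rel_def distrib_right integrable_mult_cnj)
  show "(r *\<^sub>R u) \<bullet> v = r * (u \<bullet> v)"
    by transfer (auto simp: l2_rel_def mult.assoc)
  have *: "Re (LINT x|unit_measure. f x * cnj (f x)) = (LINT x|unit_measure. (cmod (f x))\<^sup>2)" for f
    by (simp only: complex_norm_square[symmetric] integral_complex_of_real Re_complex_of_real)
  show "0 \<le> u \<bullet> u"
    by transfer (simp add: *)
  show "(u \<bullet> u = 0) = (u = 0)"
  proof transfer
    fix f assume "l2_rel f f"
    then have f: "square_integrable f" by (simp add: l2_rel_def)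
    then have "(LINT x|unit_measure. (cmod (f x))\<^sup>2) = 0 \<longleftrightarrow> (AE x in unit_measure. (cmod (f x))\<^sup>2 = 0)"
      by (intro integral_nonneg_eq_0_iff_AE) (auto simp: square_integrable_def)
    then show "(Re (LINT x|unit_measure. f x * cnj (f x)) = 0) = l2_rel f (\<lambda>x. 0)"
      unfolding * using f by (simp add: l2_rel_def square_integrable_zero)
  qed
qed

end

definition test_function :: "(real \<Rightarrow> real) \<Rightarrow> bool" where
  "test_function \<phi> \<longleftrightarrow>
     (\<forall>n x. ((deriv ^^ n) \<phi>) differentiable (at x)) \<and>
     (\<exists>K. compact K \<and> K \<subseteq> {0<..<1} \<and> (\<forall>x. x \<notin> K \<longrightarrow> \<phi> x = 0))"

definition has_weak_deriv :: "nat \<Rightarrow> l2 \<Rightarrow> l2 \<Rightarrow> bool" where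
  "has_weak_deriv j u v \<longleftrightarrow>
     (\<forall>\<phi>. test_function \<phi> \<longrightarrow>
        (LINT x|unit_measure. rep_l2 u x * complex_of_real ((deriv ^^ j) \<phi> x)) =
        (-1) ^ j * (LINT x|unit_measure. rep_l2 v x * complex_of_real (\<phi> x)))"

definition weak_deriv :: "nat \<Rightarrow> l2 \<Rightarrow> l2" where
  "weak_deriv j u = (THE v. has_weak_deriv j u v)"

definition sobolev :: "nat \<Rightarrow> l2 set" where
  "sobolev k = {u. \<forall>j\<le>k. \<exists>v. has_weak_deriv j u v}"

definition sobolev_norm :: "nat \<Rightarrow> l2 \<Rightarrow> real" where
  "sobolev_norm k u = sqrt (\<Sum>j\<le>k. (norm (weak_deriv j u))\<^sup>2)"

text \<open>The value at \<open>x \<in> [0,1]\<close> of the representative of \<open>v\<close> that is continuous on \<open>[0,1]\<close>.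
  It is meaningful for \<open>v \<in> H\<^sup>1(0,1)\<close>, where such a representative exists; its values
  on \<open>[0,1]\<close> are unique.\<close>

definition point_value :: "l2 \<Rightarrow> real \<Rightarrow> complex" where
  "point_value v x = (THE c. \<exists>g. continuous_on {0..1} g \<and>
     (AE y in unit_measure. rep_l2 v y = g y) \<and> g x = c)"

definition sobolev_bc :: "real \<Rightarrow> nat \<Rightarrow> l2 set" where
  "sobolev_bc \<alpha> k = {u \<in> sobolev k.
     (1 \<le> k \<longrightarrow> point_value u 0 = 0 \<and> point_value u 1 = 0) \<and>
     (2 \<le> k \<longrightarrow> point_value (weak_deriv 1 u) 0 = 0 \<and> point_value (weak_deriv 1 u) 1 = 0) \<and>
     (3 \<le> k \<longrightarrow> point_value (weak_deriv 2 u) 1 =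
                complex_of_real \<alpha> * point_value (weak_deriv 2 u) 0)}"

definition kawahara_domain :: "real \<Rightarrow> l2 set" where
  "kawahara_domain \<alpha> = {u \<in> sobolev 5.
     point_value u 0 = 0 \<and> point_value u 1 = 0 \<and>
     point_value (weak_deriv 1 u) 0 = 0 \<and> point_value (weak_deriv 1 u) 1 = 0 \<and>
     point_value (weak_deriv 2 u) 1 = complex_of_real \<alpha> * point_value (weak_deriv 2 u) 0}"

definition kawahara_op :: "l2 \<Rightarrow> l2" where
  "kawahara_op u = - weak_deriv 3 u + weak_deriv 5 u"

lemma sobolev_bc_5: "sobolev_bc \<alpha> 5 = kawahara_domain \<alpha>"
  by (auto simp: sobolev_bc_def kawahara_domain_def)

definition C0_semigroup :: "(real \<Rightarrow> 'a::real_normed_vector \<Rightarrow> 'a) \<Rightarrow> bool" where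
  "C0_semigroup S \<longleftrightarrow>
     (\<forall>t\<ge>0. bounded_linear (S t)) \<and>
     S 0 = id \<and>
     (\<forall>s\<ge>0. \<forall>t\<ge>0. S (s + t) = S s \<circ> S t) \<and>
     (\<forall>u. ((\<lambda>t. S t u) \<longlongrightarrow> u) (at_right 0))"

text \<open>\<open>A\<close> with domain \<open>D\<close> is the infinitesimal generator of \<open>S\<close>; in particular
  \<open>D\<close> is exactly the set of vectors at which the difference quotient converges.\<close>

definition is_generator ::
  "(real \<Rightarrow> 'a::real_normed_vector \<Rightarrow> 'a) \<Rightarrow> 'a set \<Rightarrow> ('a \<Rightarrow> 'a) \<Rightarrow> bool" where
  "is_generator S D A \<longleftrightarrow>
     D = {u. \<exists>v. ((\<lambda>h. (S h u - u) /\<^sub>R h) \<longlongrightarrow> v) (at_right 0)} \<and>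
     (\<forall>u\<in>D. ((\<lambda>h. (S h u - u) /\<^sub>R h) \<longlongrightarrow> A u) (at_right 0))"

end

theory Submission
  imports Defs
begin

text \<open>Multiplying the equation by \<open>(M + x) u\<close> with \<open>M = 1 / (1 - \<alpha>\<^sup>2)\<close> gives a Lyapunov functional
  equivalent to the \<open>L\<^sup>2\<close> norm, hence exponential decay on \<open>L\<^sup>2\<close>. Since \<open>S(t)\<close> commutes with \<open>A\<close> and
  \<open>\<parallel>u\<parallel>\<^bsub>H\<^sup>5\<^esub> \<le> C (\<parallel>A u\<parallel> + \<parallel>u\<parallel>)\<close>, the same rate holds on \<open>D(A)\<close>.

  The spaces \<open>H\<^sup>k\<^sub>\<alpha>\<close> with \<open>1 \<le> k \<le> 4\<close> are reached by real interpolation: \<open>u\<close> belongs to \<open>H\<^sup>k\<^sub>\<alpha>\<close> iff there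
  are \<open>y j \<in> D(A)\<close> with \<open>\<parallel>u - y j\<parallel> \<le> s\<^sup>k \<epsilon> j\<close> and \<open>\<parallel>y j\<parallel>\<^bsub>H\<^sup>5\<^esub> \<le> s\<^sup>k\<^sup>-\<^sup>5 \<epsilon> j\<close>, \<open>s = 4\<^sup>-\<^sup>j\<close>, \<open>\<epsilon>\<close> square summable;
  this property is invariant under \<open>S(t)\<close>. That it implies \<open>u \<in> H\<^sup>k\<^sub>\<alpha>\<close> follows because the increments of \<open>y\<close>
  are almost orthogonal in \<open>H\<^sup>k\<close>. Conversely, after subtracting polynomials in \<open>D(A)\<close> one may assume that
  all traces of \<open>u\<close> vanish; a polynomial partition of unity separates the two end points, and near \<open>0\<close> the
  approximants are built from the resolvents \<open>R\<^sub>s = (1 + s \<partial>)\<^sup>-\<^sup>1\<close> with zero data at \<open>0\<close>. The square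
  summability comes from \<open>\<parallel>R\<^bsub>s/4\<^esub> w\<parallel>\<^sup>2 - \<parallel>R\<^sub>s w\<parallel>\<^sup>2 \<ge> 15 \<parallel>(1 - R\<^bsub>s/4\<^esub>) R\<^sub>s w\<parallel>\<^sup>2\<close>, valid for every accretive operator.\<close>

section \<open>Absolutely continuous functions\<close>

text \<open>For 1 \<le> k \<le> 4 the spaces are not domains of integer powers of the generator, so
  commutation of \<open>S\<close> with \<open>kawahara_op\<close> gives no bound there;
  interpolation remains, and since one factor bounds \<open>S t\<close> at both end points of the
  scale, the exponential comes out with the same \<omega> for every k. The obstacle is the domain:
  \<open>S t\<close> is controlled in H^5 only on functions satisfying the boundary conditions, so
  the approximants must satisfy them exactly while reproducing, in the limit, all traces of order
  below k. Among these the second traces are free up to the coupling by \<alpha>, and for k = 4 both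
  third traces are free; each such direction is removed by one fixed polynomial. The resolvents take
  data at 0 only and respect nothing at 1, whence the separation of the end points by the factors (1
  - x)^5 and x^5. The companion polynomial 1 + 5 x + ... + 70 x^4 is the truncation of (1 - x)^(-5);
  evaluated at operators, the same polynomial gives a smoothing whose error carries five factors 1 -
  R.\<close>

lemma square_integrable_rep: "square_integrable (rep_l2 u)"
  using Quotient_rep_reflp[OF Quotient_l2, of u] by (simp add: l2_rel_def)

lemma abs_rep_l2: "abs_l2 (rep_l2 u) = u"
  using Quotient_abs_rep[OF Quotient_l2] .

lemma abs_l2_eq_iff:
  assumes "square_integrable f" "square_integrable g"
  shows "abs_l2 f = abs_l2 g \<longleftrightarrow> (AE x in unit_measure. f x = g x)"
  using Quotient_rel[OF Quotient_l2, of f g] assms by (auto simp: l2_rel_def)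

lemma rep_abs_l2:
  assumes "square_integrable f"
  shows "AE x in unit_measure. rep_l2 (abs_l2 f) x = f x"
  using abs_l2_eq_iff[OF square_integrable_rep assms] abs_rep_l2 by metis

lemma abs_l2_add:
  assumes "square_integrable f" "square_integrable g"
  shows "abs_l2 (\<lambda>x. f x + g x) = abs_l2 f + abs_l2 g"
  using assms by (simp add: plus_l2.abs_eq l2_rel_def)

lemma abs_l2_scaleR:
  assumes "square_integrable f"
  shows "abs_l2 (\<lambda>x. complex_of_real r * f x) = r *\<^sub>R abs_l2 f"
  using assms by (simp add: scaleR_l2.abs_eq l2_rel_def)

lemma abs_l2_zero: "abs_l2 (\<lambda>x. 0) = 0"
  by (simp add: zero_l2_def)

lemma abs_l2_minus:
  assumes "square_integrable f"
  shows "abs_l2 (\<lambda>x. - f x) = - abs_l2 f"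
  using abs_l2_scaleR[OF assms, of "-1"] by simp

lemma square_integrable_minus: "square_integrable f \<Longrightarrow> square_integrable (\<lambda>x. - f x)"
  using square_integrable_scale[of f "-1"] by simp

lemma square_integrable_diff:
  assumes "square_integrable f" "square_integrable g"
  shows "square_integrable (\<lambda>x. f x - g x)"
  using square_integrable_add[OF assms(1) square_integrable_minus[OF assms(2)]] by simp

lemma abs_l2_diff:
  assumes "square_integrable f" "square_integrable g"
  shows "abs_l2 (\<lambda>x. f x - g x) = abs_l2 f - abs_l2 g"
  using abs_l2_add[OF assms(1) square_integrable_minus[OF assms(2)]] abs_l2_minus[OF assms(2)]
  by simp

lemma inner_abs_l2:
  assumes "square_integrable f" "square_integrable g"
  shows "abs_l2 f \<bullet> abs_l2 g = Re (LINT x|unit_measure. f x * cnj (g x))"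
  using assms by (simp add: inner_l2.abs_eq l2_rel_def)

lemma norm_abs_l2:
  assumes "square_integrable f"
  shows "(norm (abs_l2 f))\<^sup>2 = (LINT x|unit_measure. (cmod (f x))\<^sup>2)"
proof -
  have "(norm (abs_l2 f))\<^sup>2 = Re (LINT x|unit_measure. f x * cnj (f x))"
    using inner_abs_l2[OF assms assms] by (simp add: power2_norm_eq_inner)
  then show ?thesis
    by (simp only: complex_norm_square[symmetric] integral_complex_of_real Re_complex_of_real)
qed

lemma finite_measure_unit: "finite_measure unit_measure"
  by (intro finite_measureI) (simp add: emeasure_restrict_space)

lemma square_integrable_const: "square_integrable (\<lambda>x. c)"
  using finite_measure.integrable_const[OF finite_measure_unit]
  by (simp add: square_integrable_def)

lemma square_integrable_imp_integrable:
  assumes "square_integrable f"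
  shows "integrable unit_measure f"
  using integrable_mult_cnj[OF assms square_integrable_const[of 1]] by simp

text \<open>The end points form a null set. This lets every estimate pass from the Bochner integral
  over the open interval, in which \<open>l2\<close> is defined, to the gauge integral over the
  closed one, in which primitives are handled.\<close>

lemma integrable_unit_iff:
  fixes f :: "real \<Rightarrow> 'a::euclidean_space"
  shows "integrable unit_measure f \<longleftrightarrow> f absolutely_integrable_on {0..1}"
proof -
  have "integrable unit_measure f \<longleftrightarrow> f absolutely_integrable_on {0<..<1}"
    by (simp add: integrable_restrict_space set_integrable_def)
  also have "\<dots> \<longleftrightarrow> f absolutely_integrable_on {0..1}"
  proof (rule absolutely_integrable_spike_set_eq)
    show "negligible {x \<in> {0<..<1} - {0..1::real}. f x \<noteq> 0}" by (rule negligible_subset[of "{}"]) auto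
    show "negligible {x \<in> {0..1} - {0<..<1::real}. f x \<noteq> 0}"
      by (rule negligible_subset[of "{0,1}"]) auto
  qed
  finally show ?thesis .
qed

lemma integral_unit_eq:
  fixes f :: "real \<Rightarrow> 'a::euclidean_space"
  assumes "integrable unit_measure f"
  shows "(LINT x|unit_measure. f x) = integral {0..1} f"
  using lebesgue_integral_eq_integral[OF assms]
  by (simp add: integral_open_interval_real)

lemma square_integrable_absolutely_integrable:
  "square_integrable f \<Longrightarrow> f absolutely_integrable_on {0..1}"
  using square_integrable_imp_integrable integrable_unit_iff by blast

lemma AE_unit_negligible:
  assumes "AE x in unit_measure. f x = g x"
  shows "\<exists>N. negligible N \<and> (\<forall>x\<in>{0..1} - N. f x = g x)"
proof -
  have "AE x in lebesgue. x \<in> {0<..<1} \<longrightarrow> f x = g x"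
    using assms by (subst (asm) AE_restrict_space_iff) auto
  then obtain N where N: "N \<in> null_sets lebesgue" "{x. \<not> (x \<in> {0<..<1} \<longrightarrow> f x = g x)} \<subseteq> N"
    unfolding eventually_ae_filter by auto
  have "negligible (N \<union> {0,1})"
    using N(1) negligible_iff_null_sets by (intro negligible_Un) auto
  moreover have "\<forall>x\<in>{0..1} - (N \<union> {0,1}). f x = g x"
  proof
    fix x assume "x \<in> {0..1} - (N \<union> {0,1})"
    then have "x \<in> {0<..<1}" "x \<notin> N" by auto
    then show "f x = g x" using N(2) by blast
  qed
  ultimately show ?thesis by blast
qed

lemma integral_prefix_AE_cong:
  assumes "AE x in unit_measure. f x = g x" "x \<in> {0..1}"
  shows "integral {0..x} f = integral {0..x} g"
proof -
  obtain N where N: "negligible N" "\<forall>x\<in>{0..1} - N. f x = g x"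
    using AE_unit_negligible[OF assms(1)] by blast
  show ?thesis
    by (rule integral_spike[OF N(1)]) (use N(2) assms(2) in force)
qed

lemma AE_unitI:
  assumes "\<And>x. x \<in> {0<..<1} \<Longrightarrow> P x"
  shows "AE x in unit_measure. P x"
  by (rule AE_I2) (use assms in auto)

lemma square_integrable_cong:
  assumes "\<And>x. x \<in> {0..1} \<Longrightarrow> f x = g x"
  shows "square_integrable f \<longleftrightarrow> square_integrable g"
proof -
  have "f \<in> borel_measurable unit_measure \<longleftrightarrow> g \<in> borel_measurable unit_measure"
    by (rule measurable_cong) (use assms in auto)
  moreover have "integrable unit_measure (\<lambda>x. (cmod (f x))\<^sup>2) \<longleftrightarrow> integrable unit_measure (\<lambda>x. (cmod (g x))\<^sup>2)"
    by (rule Bochner_Integration.integrable_cong) (use assms in auto)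
  ultimately show ?thesis by (simp add: square_integrable_def)
qed

lemma measurable_unit_continuous:
  assumes "continuous_on {0..1} (f :: real \<Rightarrow> complex)"
  shows "f \<in> borel_measurable unit_measure"
  by (rule continuous_imp_measurable_on_sets_lebesgue)
    (use assms continuous_on_subset in \<open>auto intro: continuous_on_subset\<close>)

lemma square_integrable_mult_continuous:
  assumes "continuous_on {0..1} f" "square_integrable g"
  shows "square_integrable (\<lambda>x. f x * g x)"
proof -
  obtain B where B: "\<And>x. x \<in> {0..1} \<Longrightarrow> cmod (f x) \<le> B"
    using compact_imp_bounded[OF compact_continuous_image[OF assms(1)]]
    unfolding bounded_iff by blast
  have m: "(\<lambda>x. f x * g x) \<in> borel_measurable unit_measure"
    using measurable_unit_continuous[OF assms(1)] assms(2)
    by (intro borel_measurable_times) (auto simp: square_integrable_def)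
  have "integrable unit_measure (\<lambda>x. (cmod (f x * g x))\<^sup>2)"
  proof (rule Bochner_Integration.integrable_bound)
    show "integrable unit_measure (\<lambda>x. B\<^sup>2 * (cmod (g x))\<^sup>2)"
      using assms(2) by (auto simp: square_integrable_def)
    show "(\<lambda>x. (cmod (f x * g x))\<^sup>2) \<in> borel_measurable unit_measure" using m by measurable
    show "AE x in unit_measure. norm ((cmod (f x * g x))\<^sup>2) \<le> norm (B\<^sup>2 * (cmod (g x))\<^sup>2)"
      by (rule AE_unitI)
        (use B in \<open>auto simp: norm_mult power_mult_distrib intro!: mult_right_mono power_mono\<close>)
  qed
  with m show ?thesis by (simp add: square_integrable_def)
qed

lemma square_integrable_continuous:
  "continuous_on {0..1} f \<Longrightarrow> square_integrable f"
  using square_integrable_mult_continuous[OF _ square_integrable_const[of 1]] by simp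

text \<open>H^1(0,1) as the set of indefinite integrals. The identity is pointwise on the closed
  interval, so \<open>f\<close> is the continuous representative and its end point values are the
  traces, while \<open>g\<close> is any representative of the derivative; differentiability almost
  everywhere never enters.\<close>

definition ac :: "(real \<Rightarrow> complex) \<Rightarrow> (real \<Rightarrow> complex) \<Rightarrow> bool" where
  "ac f g \<longleftrightarrow> square_integrable g \<and> (\<forall>x\<in>{0..1}. f x - f 0 = integral {0..x} g)"

lemma ac_sqD: "ac f g \<Longrightarrow> square_integrable g"
  by (simp add: ac_def)

lemma ac_value: "ac f g \<Longrightarrow> x \<in> {0..1} \<Longrightarrow> f x = f 0 + integral {0..x} g"
  unfolding ac_def by (metis add.commute diff_add_cancel)

lemma acI:
  assumes "square_integrable g" "\<And>x. x \<in> {0..1} \<Longrightarrow> f x = f 0 + integral {0..x} g"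
  shows "ac f g"
  unfolding ac_def
proof (intro conjI ballI)
  fix x :: real assume "x \<in> {0..1}"
  from assms(2)[OF this] show "f x - f 0 = integral {0..x} g" by (metis add_diff_cancel_left')
qed (rule assms(1))

lemma square_integrable_integrable_on:
  assumes "square_integrable f" "0 \<le> a" "b \<le> 1"
  shows "f integrable_on {a..b}"
  by (rule integrable_subinterval_real[of f 0 1])
    (use assms square_integrable_absolutely_integrable in \<open>auto simp: absolutely_integrable_on_def\<close>)

lemma square_integrable_norm_integrable_on:
  assumes "square_integrable f" "0 \<le> a" "b \<le> 1"
  shows "(\<lambda>x. cmod (f x)) integrable_on {a..b}"
  by (rule integrable_subinterval_real[of _ 0 1])
    (use assms square_integrable_absolutely_integrable in \<open>auto simp: absolutely_integrable_on_def\<close>)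

lemma ac_integral:
  assumes "ac f g" "0 \<le> a" "a \<le> b" "b \<le> 1"
  shows "integral {a..b} g = f b - f a"
proof -
  have "integral {0..a} g + integral {a..b} g = integral {0..b} g"
    by (rule Henstock_Kurzweil_Integration.integral_combine)
      (use assms square_integrable_integrable_on[OF ac_sqD] in auto)
  moreover have "f a - f 0 = integral {0..a} g" "f b - f 0 = integral {0..b} g"
    using assms by (auto simp: ac_def)
  ultimately show ?thesis by (simp add: algebra_simps)
qed

lemma ac_continuous:
  assumes "ac f g" shows "continuous_on {0..1} f"
proof -
  have "continuous_on {0..1} (\<lambda>x. f 0 + integral {0..x} g)"
    by (intro continuous_intros indefinite_integral_continuous_1)
      (use square_integrable_integrable_on[OF ac_sqD[OF assms], of 0 1] in auto)
  then show ?thesis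
    by (rule continuous_on_eq) (rule ac_value[OF assms, symmetric])
qed

lemma ac_sq: "ac f g \<Longrightarrow> square_integrable f"
  by (simp add: ac_continuous square_integrable_continuous)

lemma ac_antiderivative:
  "square_integrable g \<Longrightarrow> ac (\<lambda>x. c + integral {0..x} g) g"
  by (simp add: ac_def)

lemma ac_cong:
  assumes "ac f g" "\<And>x. x \<in> {0..1} \<Longrightarrow> f x = f' x" "\<And>x. x \<in> {0..1} \<Longrightarrow> g x = g' x"
  shows "ac f' g'"
proof -
  have "square_integrable g'" using square_integrable_cong[of g g'] assms by (auto simp: ac_def)
  moreover have "integral {0..x} g = integral {0..x} g'" if "x \<in> {0..1}" for x
    by (rule Henstock_Kurzweil_Integration.integral_cong) (use assms that in auto)
  ultimately show ?thesis using assms by (auto simp: ac_def)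
qed

lemma ac_AE_cong:
  assumes "ac f g" "square_integrable g'" "AE x in unit_measure. g x = g' x"
  shows "ac f g'"
  using assms integral_prefix_AE_cong[OF assms(3)] by (auto simp: ac_def)

lemma ac_add:
  assumes "ac f f'" "ac g g'"
  shows "ac (\<lambda>x. f x + g x) (\<lambda>x. f' x + g' x)"
proof -
  have "integral {0..x} (\<lambda>x. f' x + g' x) = integral {0..x} f' + integral {0..x} g'" if "x \<in> {0..1}" for x
    by (rule Henstock_Kurzweil_Integration.integral_add)
     (use assms that square_integrable_integrable_on[OF ac_sqD] in auto)
  moreover have "square_integrable (\<lambda>x. f' x + g' x)"
    using assms by (simp add: ac_def square_integrable_add)
  ultimately show ?thesis using assms unfolding ac_def by (simp add: add_diff_add)
qed

lemma ac_scale: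
  assumes "ac f f'"
  shows "ac (\<lambda>x. c * f x) (\<lambda>x. c * f' x)"
  using assms by (auto simp: ac_def square_integrable_scale simp flip: right_diff_distrib)

lemma ac_diff:
  assumes "ac f f'" "ac g g'"
  shows "ac (\<lambda>x. f x - g x) (\<lambda>x. f' x - g' x)"
  using ac_add[OF assms(1) ac_scale[OF assms(2), of "-1"]] by simp

lemma square_integrable_cnj:
  assumes "square_integrable f" shows "square_integrable (\<lambda>x. cnj (f x))"
  using assms by (auto simp: square_integrable_def
        intro: measurable_compose[OF _ borel_measurable_continuous_onI[OF continuous_on_cnj[OF continuous_on_id]]])

lemma ac_cnj:
  assumes "ac f g"
  shows "ac (\<lambda>x. cnj (f x)) (\<lambda>x. cnj (g x))"
  using assms by (auto simp: ac_def square_integrable_cnj simp flip: integral_cnj complex_cnj_diff)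

lemma ac_C1:
  assumes "\<And>x. x \<in> {0..1} \<Longrightarrow> (f has_vector_derivative g x) (at x within {0..1})" "continuous_on {0..1} g"
  shows "ac f g"
  unfolding ac_def
proof (intro conjI ballI)
  fix x :: real assume x: "x \<in> {0..1}"
  have "(g has_integral (f x - f 0)) {0..x}"
    by (rule fundamental_theorem_of_calculus)
     (use assms(1) x in \<open>auto intro!: has_vector_derivative_within_subset[of f _ _ "{0..1}" "{0..x}"]\<close>)
  then show "f x - f 0 = integral {0..x} g" by (simp add: integral_unique)
qed (rule square_integrable_continuous[OF assms(2)])

lemma ac_const: "ac (\<lambda>x. c) (\<lambda>x. 0)"
  by (simp add: ac_def square_integrable_zero)

lemma ac_affine: "ac (\<lambda>x. complex_of_real (a + b * x)) (\<lambda>x. complex_of_real b)"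
  by (rule ac_C1) (auto intro!: derivative_eq_intros continuous_intros)

text \<open>Telescoping along an equidistant partition of [0, x] with mesh below \<delta>. With
  \<epsilon> tending to 0 it shows that a function is constant if its short increments are
  arbitrarily small against those of a fixed \<mu>.\<close>

lemma increment_bound_global:
  fixes F :: "real \<Rightarrow> complex" and \<mu> :: "real \<Rightarrow> real"
  assumes "0 < \<delta>"
    and step: "\<And>x y. 0 \<le> x \<Longrightarrow> x \<le> y \<Longrightarrow> y \<le> 1 \<Longrightarrow> y - x < \<delta> \<Longrightarrow> cmod (F y - F x) \<le> \<epsilon> * (\<mu> y - \<mu> x)"
    and x: "x \<in> {0..1}"
  shows "cmod (F x - F 0) \<le> \<epsilon> * (\<mu> x - \<mu> 0)"
proof -
  obtain n where n: "1 / real (Suc n) < \<delta>"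
    using reals_Archimedean[OF \<open>0 < \<delta>\<close>] by (auto simp: inverse_eq_divide)
  define p where "p i = real i * x / real (Suc n)" for i
  have "cmod (F (p i) - F 0) \<le> \<epsilon> * (\<mu> (p i) - \<mu> 0)" if "i \<le> Suc n" for i
    using that
  proof (induction i)
    case 0 then show ?case by (simp add: p_def)
  next
    case (Suc i)
    have le: "p (Suc i) \<le> x" "p i \<le> p (Suc i)" "0 \<le> p i"
      using x Suc.prems by (auto simp: p_def field_simps mult_left_mono intro!: mult_right_mono)
    have "p (Suc i) - p i = x / real (Suc n)" by (simp add: p_def diff_divide_distrib[symmetric] algebra_simps)
    also have "\<dots> \<le> 1 / real (Suc n)" using x by (intro divide_right_mono) auto
    finally have "p (Suc i) - p i < \<delta>" using n by linarith
    then have "cmod (F (p (Suc i)) - F (p i)) \<le> \<epsilon> * (\<mu> (p (Suc i)) - \<mu> (p i))"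
      using le x by (intro step) auto
    moreover have "cmod (F (p (Suc i)) - F 0) \<le> cmod (F (p (Suc i)) - F (p i)) + cmod (F (p i) - F 0)"
      using norm_triangle_ineq[of "F (p (Suc i)) - F (p i)" "F (p i) - F 0"] by simp
    ultimately show ?case using Suc by (simp add: algebra_simps)
  qed
  moreover have "p (Suc n) = x" by (simp add: p_def del: of_nat_Suc)
  ultimately show ?thesis by (metis order_refl)
qed

text \<open>The increment of f g minus the integral of f' g + f g' over a short interval is, by
  uniform continuity, an arbitrarily small multiple of the integral of |f'| + |g'| there; hence that
  difference is constant.\<close>

lemma ac_mult:
  assumes f: "ac f f'" and g: "ac g g'"
  shows "ac (\<lambda>x. f x * g x) (\<lambda>x. f' x * g x + f x * g' x)" (is "ac _ ?h")
proof -
  have sf: "square_integrable f'" and sg: "square_integrable g'" using f g by (auto simp: ac_def)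
  have cf: "continuous_on {0..1} f" and cg: "continuous_on {0..1} g" using f g ac_continuous by auto
  have sh: "square_integrable ?h"
    using square_integrable_mult_continuous[OF cg sf] square_integrable_mult_continuous[OF cf sg]
    by (intro square_integrable_add) (auto simp: mult.commute)
  define F where "F x = f x * g x - integral {0..x} ?h" for x
  define \<mu> where "\<mu> x = integral {0..x} (\<lambda>t. cmod (f' t) + cmod (g' t))" for x
  have m_int: "(\<lambda>t. cmod (f' t) + cmod (g' t)) integrable_on {a..b}" if "0 \<le> a" "b \<le> 1" for a b
    using square_integrable_norm_integrable_on[OF sf that] square_integrable_norm_integrable_on[OF sg that]
    by (rule Henstock_Kurzweil_Integration.integrable_add)
  have m_diff: "\<mu> y - \<mu> x = integral {x..y} (\<lambda>t. cmod (f' t) + cmod (g' t))"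
    if "0 \<le> x" "x \<le> y" "y \<le> 1" for x y
    unfolding \<mu>_def
    using Henstock_Kurzweil_Integration.integral_combine[of 0 x y, OF _ _ m_int] that by (simp add: algebra_simps)
  \<comment> \<open>This is f(y) g(y) - f(x) g(x) = (f(y) - f(x)) g(x) + f(y) (g(y) - g(x)), with
    the increments written as integrals and compared with the integral of f' g + f g'.\<close>
  have F_diff: "F y - F x = integral {x..y} (\<lambda>t. f' t * (g x - g t) + (f y - f t) * g' t)"
    if "0 \<le> x" "x \<le> y" "y \<le> 1" for x y
  proof -
    have I: "f' integrable_on {x..y}" "g' integrable_on {x..y}" "?h integrable_on {x..y}"
      using square_integrable_integrable_on that sf sg sh by auto
    have "integral {x..y} (\<lambda>t. f' t * (g x - g t) + (f y - f t) * g' t)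
        = integral {x..y} (\<lambda>t. (f' t * g x + f y * g' t) - ?h t)"
      by (rule arg_cong[where f = "integral _"]) (auto simp: fun_eq_iff algebra_simps)
    also have "\<dots> = integral {x..y} f' * g x + f y * integral {x..y} g' - integral {x..y} ?h"
      using I by (simp add: Henstock_Kurzweil_Integration.integral_diff
          Henstock_Kurzweil_Integration.integral_add integrable_on_mult_left integrable_on_mult_right
          Henstock_Kurzweil_Integration.integrable_add)
    also have "integral {x..y} f' = f y - f x" by (rule ac_integral[OF f that])
    also have "integral {x..y} g' = g y - g x" by (rule ac_integral[OF g that])
    also have "integral {x..y} ?h = integral {0..y} ?h - integral {0..x} ?h"
      using Henstock_Kurzweil_Integration.integral_combine[of 0 x y ?h] that
        square_integrable_integrable_on[OF sh, of 0 y] by (simp add: algebra_simps)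
    finally show ?thesis by (simp add: F_def algebra_simps)
  qed
  have F_const: "F x = F 0" if x: "x \<in> {0..1}" for x
  proof -
    have "cmod (F x - F 0) \<le> \<epsilon>" if e: "0 < \<epsilon>" for \<epsilon>
    proof -
      \<comment> \<open>The summand 1 keeps the quotient meaningful when \<mu> has no increment on
        [0, x].\<close>
      define \<eta> where "\<eta> = \<epsilon> / (\<mu> x - \<mu> 0 + 1)"
      have mpos: "0 \<le> \<mu> x - \<mu> 0"
        using m_diff[of 0 x] x by (auto intro!: Henstock_Kurzweil_Integration.integral_nonneg m_int)
      then have eta: "0 < \<eta>" using e by (simp add: \<eta>_def)
      have "uniformly_continuous_on {0..1} f" "uniformly_continuous_on {0..1} g"
        using cf cg by (auto intro: compact_uniformly_continuous)
      then have "\<exists>d>0. \<forall>s\<in>{0..1}. \<forall>t\<in>{0..1}. dist t s < d \<longrightarrow> dist (f t) (f s) < \<eta>"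
        "\<exists>d>0. \<forall>s\<in>{0..1}. \<forall>t\<in>{0..1}. dist t s < d \<longrightarrow> dist (g t) (g s) < \<eta>"
        using eta by (simp_all only: uniformly_continuous_on_def)
      then obtain d1 d2 where d: "0 < d1" "0 < d2"
        "\<And>s t. s \<in> {0..1} \<Longrightarrow> t \<in> {0..1} \<Longrightarrow> dist t s < d1 \<Longrightarrow> dist (f t) (f s) < \<eta>"
        "\<And>s t. s \<in> {0..1} \<Longrightarrow> t \<in> {0..1} \<Longrightarrow> dist t s < d2 \<Longrightarrow> dist (g t) (g s) < \<eta>"
        by blast
      have "cmod (F x - F 0) \<le> \<eta> * (\<mu> x - \<mu> 0)"
      proof (rule increment_bound_global[where \<delta> = "min d1 d2"])
        show "0 < min d1 d2" using d by simp
        fix a b :: real assume ab: "0 \<le> a" "a \<le> b" "b \<le> 1" "b - a < min d1 d2"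
        have "cmod (integral {a..b} (\<lambda>t. f' t * (g a - g t) + (f b - f t) * g' t))
            \<le> integral {a..b} (\<lambda>t. \<eta> * (cmod (f' t) + cmod (g' t)))"
        proof (rule integral_norm_bound_integral)
          show "(\<lambda>t. \<eta> * (cmod (f' t) + cmod (g' t))) integrable_on {a..b}"
            using integrable_on_cmult_left[OF m_int[of a b], of \<eta>] ab by simp
          have "(\<lambda>t. (g a - g t) * f' t) = (\<lambda>t. g a * f' t - g t * f' t)"
            "(\<lambda>t. (f b - f t) * g' t) = (\<lambda>t. f b * g' t - f t * g' t)" by (auto simp: algebra_simps)
          then have "square_integrable (\<lambda>t. (g a - g t) * f' t)" "square_integrable (\<lambda>t. (f b - f t) * g' t)"
            using square_integrable_mult_continuous cf cg sf sg square_integrable_scale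
            by (auto intro!: square_integrable_diff)
          then have "square_integrable (\<lambda>t. f' t * (g a - g t) + (f b - f t) * g' t)"
            by (intro square_integrable_add) (auto simp: mult.commute)
          then show "(\<lambda>t. f' t * (g a - g t) + (f b - f t) * g' t) integrable_on {a..b}"
            using square_integrable_integrable_on ab by blast
          fix t assume t: "t \<in> {a..b}"
          have "cmod (g a - g t) \<le> \<eta>" "cmod (f b - f t) \<le> \<eta>"
            using d(3)[of t b] d(4)[of t a] ab t by (auto simp: dist_norm norm_minus_commute less_imp_le)
          then have "cmod (f' t) * cmod (g a - g t) \<le> cmod (f' t) * \<eta>"
            "cmod (f b - f t) * cmod (g' t) \<le> \<eta> * cmod (g' t)"
            by (auto intro: mult_left_mono mult_right_mono)
          then show "cmod (f' t * (g a - g t) + (f b - f t) * g' t) \<le> \<eta> * (cmod (f' t) + cmod (g' t))"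
            using norm_triangle_ineq[of "f' t * (g a - g t)" "(f b - f t) * g' t"]
            by (simp add: norm_mult distrib_left mult.commute[of _ \<eta>] mult.commute[of "cmod (g' t)"] del: norm_triangle_ineq)
        qed
        then show "cmod (F b - F a) \<le> \<eta> * (\<mu> b - \<mu> a)"
          using F_diff[of a b] m_diff[of a b] ab by simp
      qed (use x in auto)
      also have "\<dots> \<le> \<epsilon>" using mpos e by (simp add: \<eta>_def divide_simps)
      finally show ?thesis .
    qed
    then have "cmod (F x - F 0) \<le> 0" by (rule field_le_epsilon[of _ 0, simplified])
    then show ?thesis by simp
  qed
  have eq: "f x * g x = f 0 * g 0 + integral {0..x} ?h" if "x \<in> {0..1}" for x
    using F_const[OF that] by (simp add: F_def diff_eq_eq)
  show ?thesis by (rule acI[OF sh]) (rule eq)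
qed

section \<open>Norm, trace and interpolation inequalities\<close>

lemma inner_abs_l2_integral:
  assumes "square_integrable f" "square_integrable g"
  shows "abs_l2 f \<bullet> abs_l2 g = Re (integral {0..1} (\<lambda>x. f x * cnj (g x)))"
  using inner_abs_l2[OF assms] integral_unit_eq[OF integrable_mult_cnj[OF assms]] by simp

lemma norm_abs_l2_integral:
  assumes "square_integrable f"
  shows "(norm (abs_l2 f))\<^sup>2 = integral {0..1} (\<lambda>x. (cmod (f x))\<^sup>2)"
  using norm_abs_l2[OF assms] integral_unit_eq[of "\<lambda>x. (cmod (f x))\<^sup>2"] assms
  by (simp add: square_integrable_def)

lemma norm_power2_integrable_on:
  assumes "square_integrable f" shows "(\<lambda>x. (cmod (f x))\<^sup>2) integrable_on {0..1}"
  using assms integrable_unit_iff[of "\<lambda>x. (cmod (f x))\<^sup>2"]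
  by (simp add: square_integrable_def absolutely_integrable_on_def)

lemma square_integrable_cmod:
  assumes "square_integrable f"
  shows "square_integrable (\<lambda>x. complex_of_real (cmod (f x)))"
  using assms
  by (auto simp: square_integrable_def intro!: measurable_compose[OF borel_measurable_norm
        borel_measurable_continuous_onI[OF continuous_on_of_real[OF continuous_on_id]]])

lemma norm_mult_integrable_on:
  assumes "square_integrable f" "square_integrable g"
  shows "(\<lambda>x. cmod (f x) * cmod (g x)) integrable_on {0..1}"
proof -
  have "integrable unit_measure (\<lambda>x. f x * cnj (g x))" by (rule integrable_mult_cnj[OF assms])
  then have "(\<lambda>x. cmod (f x * cnj (g x))) integrable_on {0..1}"
    by (simp add: integrable_unit_iff absolutely_integrable_on_def)
  then show ?thesis by (simp add: norm_mult)
qed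

text \<open>Cauchy-Schwarz for the moduli \<open>f'\<close> and \<open>g'\<close>, whose norms agree
  with those of \<open>f\<close> and \<open>g\<close>. The inner product of \<open>f\<close> and
  \<open>g\<close> themselves is only a real part and does not control the integral of |f|
  |g|.\<close>

lemma integral_norm_mult_le:
  assumes "square_integrable f" "square_integrable g"
  shows "integral {0..1} (\<lambda>x. cmod (f x) * cmod (g x)) \<le> norm (abs_l2 f) * norm (abs_l2 g)"
proof -
  define f' g' where "f' x = complex_of_real (cmod (f x))" and "g' x = complex_of_real (cmod (g x))" for x
  have sq: "square_integrable f'" "square_integrable g'"
    unfolding f'_def g'_def using assms square_integrable_cmod by auto
  have "abs_l2 f' \<bullet> abs_l2 g' = Re (integral {0..1} (\<lambda>x. complex_of_real (cmod (f x) * cmod (g x))))"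
    using inner_abs_l2_integral[OF sq] by (simp add: f'_def g'_def)
  also have "\<dots> = integral {0..1} (\<lambda>x. cmod (f x) * cmod (g x))"
    using integral_linear[OF norm_mult_integrable_on[OF assms] bounded_linear_of_real[where 'a = complex]]
    by (simp add: o_def)
  finally have 1: "integral {0..1} (\<lambda>x. cmod (f x) * cmod (g x)) = abs_l2 f' \<bullet> abs_l2 g'" by simp
  have "(norm (abs_l2 f'))\<^sup>2 = (norm (abs_l2 f))\<^sup>2" "(norm (abs_l2 g'))\<^sup>2 = (norm (abs_l2 g))\<^sup>2"
    using norm_abs_l2_integral sq assms by (simp_all add: f'_def g'_def)
  then have "norm (abs_l2 f') = norm (abs_l2 f)" "norm (abs_l2 g') = norm (abs_l2 g)"
    by (simp_all add: power2_eq_iff_nonneg)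
  then show ?thesis using norm_cauchy_schwarz[of "abs_l2 f'" "abs_l2 g'"] 1 by simp
qed

lemma norm_abs_l2_mono:
  assumes "square_integrable f" "square_integrable g" "0 \<le> B" "\<And>x. x \<in> {0..1} \<Longrightarrow> cmod (f x) \<le> B * cmod (g x)"
  shows "norm (abs_l2 f) \<le> B * norm (abs_l2 g)"
proof -
  have "(norm (abs_l2 f))\<^sup>2 \<le> integral {0..1} (\<lambda>x. B\<^sup>2 * (cmod (g x))\<^sup>2)"
    unfolding norm_abs_l2_integral[OF assms(1)]
  proof (rule integral_le)
    show "(\<lambda>x. B\<^sup>2 * (cmod (g x))\<^sup>2) integrable_on {0..1}"
      using integrable_on_cmult_left[OF norm_power2_integrable_on[OF assms(2)], of "B\<^sup>2"] by simp
    show "(cmod (f x))\<^sup>2 \<le> B\<^sup>2 * (cmod (g x))\<^sup>2" if "x \<in> {0..1}" for x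
      using power_mono[OF assms(4)[OF that], of 2] by (simp add: power_mult_distrib)
  qed (rule norm_power2_integrable_on[OF assms(1)])
  also have "\<dots> = (B * norm (abs_l2 g))\<^sup>2"
    using norm_abs_l2_integral[OF assms(2)] by (simp add: power_mult_distrib)
  finally show ?thesis by (rule power2_le_imp_le) (use assms(3) in simp)
qed

lemma norm_abs_l2_scale:
  assumes "square_integrable f"
  shows "norm (abs_l2 (\<lambda>x. c * f x)) = cmod c * norm (abs_l2 f)"
proof -
  have "(norm (abs_l2 (\<lambda>x. c * f x)))\<^sup>2 = (cmod c * norm (abs_l2 f))\<^sup>2"
    using norm_abs_l2_integral[OF assms] norm_abs_l2_integral[OF square_integrable_scale[OF assms]]
    by (simp add: power_mult_distrib norm_mult)
  then show ?thesis by (simp add: power2_eq_iff_nonneg)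
qed

lemma norm_abs_l2_const: "norm (abs_l2 (\<lambda>x. c)) = cmod c"
proof -
  have "(norm (abs_l2 (\<lambda>x. c)))\<^sup>2 = (cmod c)\<^sup>2"
    using norm_abs_l2_integral[OF square_integrable_const] by simp
  then show ?thesis by (simp add: power2_eq_iff_nonneg)
qed

lemma norm_integral_le:
  assumes "square_integrable f" "x \<in> {0..1}"
  shows "cmod (integral {0..x} f) \<le> norm (abs_l2 f)"
proof -
  have "cmod (integral {0..x} f) \<le> integral {0..x} (\<lambda>x. cmod (f x))"
    by (rule integral_norm_bound_integral)
      (use assms square_integrable_integrable_on square_integrable_norm_integrable_on in auto)
  also have "\<dots> \<le> integral {0..1} (\<lambda>x. cmod (f x))"
    by (rule integral_subset_le) (use assms square_integrable_norm_integrable_on in auto)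
  also have "\<dots> \<le> norm (abs_l2 f)"
    using integral_norm_mult_le[OF assms(1) square_integrable_const[of 1]] by (simp add: norm_abs_l2_const)
  finally show ?thesis .
qed

lemma ac_sup_bound:
  assumes "ac f g" "f 0 = 0" "x \<in> {0..1}"
  shows "cmod (f x) \<le> norm (abs_l2 g)"
  using norm_integral_le[OF ac_sqD[OF assms(1)] assms(3)] ac_value[OF assms(1,3)] assms(2) by simp

lemma ac_poincare:
  assumes "ac f g" "f 0 = 0"
  shows "norm (abs_l2 f) \<le> norm (abs_l2 g)"
proof -
  have "norm (abs_l2 f) \<le> norm (abs_l2 g) * norm (abs_l2 (\<lambda>x. 1))"
    by (rule norm_abs_l2_mono) (use ac_sup_bound[OF assms] ac_sq[OF assms(1)] square_integrable_const in auto)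
  then show ?thesis by (simp add: norm_abs_l2_const)
qed

text \<open>Integration of the derivative of (a + b x) |f|^2. The weights 1 - x and x each isolate
  one end point and give the multiplicative trace inequality \<open>ac_trace\<close>.\<close>

lemma ac_trace_weighted:
  assumes f: "ac f f'" and w: "\<And>x. x \<in> {0..1} \<Longrightarrow> \<bar>a + b * x\<bar> \<le> 1" "\<bar>b\<bar> \<le> 1"
  shows "\<bar>(a + b) * (cmod (f 1))\<^sup>2 - a * (cmod (f 0))\<^sup>2\<bar>
    \<le> (norm (abs_l2 f))\<^sup>2 + 2 * norm (abs_l2 f) * norm (abs_l2 f')"
proof -
  define h where "h x = complex_of_real (a + b * x) * (f x * cnj (f x))" for x
  define h' where "h' x = complex_of_real b * (f x * cnj (f x))
      + complex_of_real (a + b * x) * (f' x * cnj (f x) + f x * cnj (f' x))" for x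
  have h: "ac h h'"
    unfolding h_def h'_def by (rule ac_mult[OF ac_affine ac_mult[OF f ac_cnj[OF f]]])
  have sf: "square_integrable f" "square_integrable f'" using f ac_sq ac_sqD by auto
  have "h 1 - h 0 = complex_of_real ((a + b) * (cmod (f 1))\<^sup>2 - a * (cmod (f 0))\<^sup>2)"
    by (simp add: h_def complex_norm_square[symmetric] del: of_real_power)
  then have "\<bar>(a + b) * (cmod (f 1))\<^sup>2 - a * (cmod (f 0))\<^sup>2\<bar> = cmod (integral {0..1} h')"
    using ac_integral[OF h, of 0 1] by (metis norm_of_real order_refl zero_le_one)
  also have "\<dots> \<le> integral {0..1} (\<lambda>x. (cmod (f x))\<^sup>2 + 2 * (cmod (f x) * cmod (f' x)))"
  proof (rule integral_norm_bound_integral)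
    show "h' integrable_on {0..1}" using square_integrable_integrable_on[OF ac_sqD[OF h], of 0 1] by simp
    show "(\<lambda>x. (cmod (f x))\<^sup>2 + 2 * (cmod (f x) * cmod (f' x))) integrable_on {0..1}"
      using norm_power2_integrable_on[OF sf(1)] integrable_on_cmult_left[OF norm_mult_integrable_on[OF sf], of 2]
      by (intro Henstock_Kurzweil_Integration.integrable_add) auto
    fix x :: real assume x: "x \<in> {0..1}"
    have "cmod (h' x) \<le> \<bar>b\<bar> * (cmod (f x))\<^sup>2 + \<bar>a + b * x\<bar> * (cmod (f' x) * cmod (f x) + cmod (f x) * cmod (f' x))"
      unfolding h'_def
      by (intro order_trans[OF norm_triangle_ineq] add_mono)
        (auto simp: norm_mult power2_eq_square simp del: of_real_add of_real_mult
          intro!: mult_left_mono order_trans[OF norm_triangle_ineq])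
    also have "\<dots> \<le> 1 * (cmod (f x))\<^sup>2 + 1 * (cmod (f' x) * cmod (f x) + cmod (f x) * cmod (f' x))"
      using w(1)[OF x] w(2) by (intro add_mono mult_right_mono) auto
    finally show "cmod (h' x) \<le> (cmod (f x))\<^sup>2 + 2 * (cmod (f x) * cmod (f' x))" by (simp add: algebra_simps)
  qed
  also have "\<dots> = (norm (abs_l2 f))\<^sup>2 + 2 * integral {0..1} (\<lambda>x. cmod (f x) * cmod (f' x))"
    using norm_power2_integrable_on[OF sf(1)] integrable_on_cmult_left[OF norm_mult_integrable_on[OF sf], of 2]
    by (simp add: Henstock_Kurzweil_Integration.integral_add norm_abs_l2_integral[OF sf(1)])
  finally show ?thesis using integral_norm_mult_le[OF sf] by simp
qed

lemma ac_trace: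
  assumes f: "ac f f'" and "c = 0 \<or> c = 1"
  shows "(cmod (f c))\<^sup>2 \<le> (norm (abs_l2 f))\<^sup>2 + 2 * norm (abs_l2 f) * norm (abs_l2 f')"
  using ac_trace_weighted[OF f, of 1 "-1"] ac_trace_weighted[OF f, of 0 1] assms(2) by auto

lemma ac_parts:
  assumes f: "ac f f'" and g: "ac g g'"
  shows "abs_l2 f' \<bullet> abs_l2 g + abs_l2 f \<bullet> abs_l2 g' = Re (f 1 * cnj (g 1)) - Re (f 0 * cnj (g 0))"
proof -
  have sq: "square_integrable f" "square_integrable f'" "square_integrable g" "square_integrable g'"
    using f g ac_sq ac_sqD by auto
  have I: "(\<lambda>x. f' x * cnj (g x)) integrable_on {0..1}" "(\<lambda>x. f x * cnj (g' x)) integrable_on {0..1}"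
    using integrable_mult_cnj[OF sq(2,3)] integrable_mult_cnj[OF sq(1,4)]
    by (auto simp: integrable_unit_iff absolutely_integrable_on_def)
  have "integral {0..1} (\<lambda>x. f' x * cnj (g x) + f x * cnj (g' x)) = f 1 * cnj (g 1) - f 0 * cnj (g 0)"
    using ac_integral[OF ac_mult[OF f ac_cnj[OF g]], of 0 1] by simp
  then have "integral {0..1} (\<lambda>x. f' x * cnj (g x)) + integral {0..1} (\<lambda>x. f x * cnj (g' x))
      = f 1 * cnj (g 1) - f 0 * cnj (g 0)"
    by (simp add: Henstock_Kurzweil_Integration.integral_add[OF I])
  then show ?thesis
    unfolding inner_abs_l2_integral[OF sq(2,3)] inner_abs_l2_integral[OF sq(1,4)]
    by (metis minus_complex.simps(1) plus_complex.simps(1))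
qed

text \<open>\<open>X\<close>, \<open>Y\<close>, \<open>Z\<close> will be scaled norms of f, f', f''
  and \<open>P\<close> a bound for boundary terms. If \<open>Y\<close> exceeded 36 (X + Z), the
  right side of the first inequality would be at most (1/36^2 + 1/2) Y^2.\<close>

lemma quadratic_bound:
  fixes X Y Z P :: real
  assumes "0 \<le> X" "0 \<le> Y" "0 \<le> Z" "0 \<le> P"
    and 1: "Y\<^sup>2 \<le> X * Z + 2 * P" and 2: "P\<^sup>2 \<le> (X\<^sup>2 + 2 * X * Y) * (Y\<^sup>2 + 2 * Y * Z)"
  shows "Y \<le> 36 * (X + Z)"
proof (rule ccontr)
  assume "\<not> ?thesis"
  then have "36 * X + 36 * Z < Y" by simp
  then have Y: "36 * X \<le> Y" "36 * Z \<le> Y" "0 < Y" using assms(1,3) by auto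
  have a: "36 * (X * Y) \<le> Y\<^sup>2" "36 * (Y * Z) \<le> Y\<^sup>2"
    using mult_right_mono[OF Y(1), of Y] mult_right_mono[OF Y(2), of Y] assms(2)
    by (auto simp: power2_eq_square mult_ac)
  have "36 * (X * X) \<le> X * Y" using mult_left_mono[OF Y(1), of X] assms by simp
  then have b: "36 * 36 * X\<^sup>2 \<le> Y\<^sup>2" using a by (simp add: power2_eq_square)
  have "36 * (X * Z) \<le> Y * Z" using mult_right_mono[OF Y(1), of Z] assms by simp
  then have c: "36 * 36 * (X * Z) \<le> Y\<^sup>2" using a by simp
  \<comment> \<open>1/36^2 + 2/36 < 0.057 and 1 + 2/36 < 1.056, and the product of the two bounds is
    below 1/16.\<close>
  have "P\<^sup>2 \<le> (57 / 1000 * Y\<^sup>2) * (1056 / 1000 * Y\<^sup>2)"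
  proof (rule order_trans[OF 2], rule mult_mono)
    have "2 * X * Y = 2 * (X * Y)" by simp
    then show "X\<^sup>2 + 2 * X * Y \<le> 57 / 1000 * Y\<^sup>2" using a b zero_le_power2[of Y] by linarith
    have "2 * Y * Z = 2 * (Y * Z)" by simp
    then show "Y\<^sup>2 + 2 * Y * Z \<le> 1056 / 1000 * Y\<^sup>2" using a zero_le_power2[of Y] by linarith
  qed (use assms in auto)
  also have "\<dots> \<le> (1 / 4 * Y\<^sup>2)\<^sup>2"
    using assms(2) by (simp add: power2_eq_square) 
  finally have "P \<le> 1 / 4 * Y\<^sup>2" by (rule power2_le_imp_le) simp
  with 1 c have "Y\<^sup>2 \<le> 0" by linarith
  then show False using Y(3) by simp
qed

lemma ac_interpolation:
  assumes f: "ac f f'" and f': "ac f' f''" and s: "0 < s" "s \<le> 1"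
  shows "norm (abs_l2 f') \<le> 36 * (norm (abs_l2 f) / s + s * norm (abs_l2 f''))"
proof -
  define X Y Z where "X = norm (abs_l2 f) / s" and "Y = norm (abs_l2 f')" and "Z = s * norm (abs_l2 f'')"
  have nn: "0 \<le> X" "0 \<le> Y" "0 \<le> Z" using s by (auto simp: X_def Y_def Z_def)
  have N: "norm (abs_l2 f) = s * X" "norm (abs_l2 f'') = Z / s" using s by (auto simp: X_def Z_def)
  define Q where "Q = (X\<^sup>2 + 2 * X * Y) * (Y\<^sup>2 + 2 * Y * Z)"
  have Qnn: "0 \<le> Q" unfolding Q_def using nn by (intro mult_nonneg_nonneg add_nonneg_nonneg) auto
  \<comment> \<open>The scale cancels: in terms of \<open>X\<close>, \<open>Y\<close>,
    \<open>Z\<close>, |f(c)|^2 is of size s and |f'(c)|^2 of size 1/s, so \<open>Q\<close> contains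
    no \<open>s\<close>.\<close>
  have tr: "cmod (f c) * cmod (f' c) \<le> sqrt Q" if c: "c = 0 \<or> c = 1" for c
  proof (rule real_le_rsqrt)
    have 1: "(cmod (f c))\<^sup>2 \<le> s * (X\<^sup>2 + 2 * X * Y)"
    proof -
      have "(s * X)\<^sup>2 \<le> s * X\<^sup>2"
        using mult_right_mono[of "s\<^sup>2" s "X\<^sup>2"] s
        by (simp add: power_mult_distrib power2_eq_square mult_left_le mult_ac)
      then show ?thesis using ac_trace[OF f c] unfolding N Y_def[symmetric] by (simp add: algebra_simps)
    qed
    have 2: "(cmod (f' c))\<^sup>2 \<le> (Y\<^sup>2 + 2 * Y * Z) / s"
    proof -
      have "Y\<^sup>2 \<le> Y\<^sup>2 / s" using s by (simp add: le_divide_eq mult_left_le)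
      then show ?thesis using ac_trace[OF f' c] unfolding N Y_def[symmetric] by (simp add: add_divide_distrib)
    qed
    have "(cmod (f c) * cmod (f' c))\<^sup>2 \<le> (s * (X\<^sup>2 + 2 * X * Y)) * ((Y\<^sup>2 + 2 * Y * Z) / s)"
      unfolding power_mult_distrib using 1 2 nn s by (intro mult_mono) auto
    then show "(cmod (f c) * cmod (f' c))\<^sup>2 \<le> Q" using s by (simp add: Q_def)
  qed
  have "abs_l2 f' \<bullet> abs_l2 f' + abs_l2 f \<bullet> abs_l2 f'' = Re (f 1 * cnj (f' 1)) - Re (f 0 * cnj (f' 0))"
    by (rule ac_parts[OF f f'])
  moreover have "\<bar>Re (f c * cnj (f' c))\<bar> \<le> cmod (f c) * cmod (f' c)" for c
    using abs_Re_le_cmod[of "f c * cnj (f' c)"] by (simp add: norm_mult)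
  moreover have "\<bar>abs_l2 f \<bullet> abs_l2 f''\<bar> \<le> X * Z"
    using Cauchy_Schwarz_ineq2[of "abs_l2 f" "abs_l2 f''"] s unfolding N by simp
  ultimately have "Y\<^sup>2 \<le> X * Z + 2 * sqrt Q"
    using tr[of 0] tr[of 1] unfolding Y_def power2_norm_eq_inner by (smt (verit))
  then have "Y \<le> 36 * (X + Z)"
    using nn Qnn by (intro quadratic_bound[where P = "sqrt Q"]) (auto simp: Q_def)
  then show ?thesis by (simp add: X_def Y_def Z_def)
qed

lemma continuous_AE_eq:
  fixes f g :: "real \<Rightarrow> complex"
  assumes "continuous_on {0..1} f" "continuous_on {0..1} g"
    "AE x in unit_measure. f x = g x" "x \<in> {0..1}"
  shows "f x = g x"
proof -
  obtain N where N: "negligible N" "\<forall>x\<in>{0..1} - N. f x = g x"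
    using AE_unit_negligible[OF assms(3)] by blast
  have "((\<lambda>x. cmod (f x - g x)) has_integral 0) {0..1}"
    by (rule has_integral_spike[OF N(1), of _ _ "\<lambda>x. 0"]) (use N(2) in auto)
  then have "cmod (f x - g x) = 0"
    by (intro has_integral_0_cbox_imp_0[of 0 1 "\<lambda>x. cmod (f x - g x)"])
      (use assms in \<open>auto intro!: continuous_intros\<close>)
  then show ?thesis by simp
qed

text \<open>\<open>F m\<close> is the \<open>m\<close>-th derivative of \<open>F 0 \<in> H\<^sup>k(0,1)\<close>, and for \<open>m < k\<close> its continuous representative.\<close>

definition chain :: "nat \<Rightarrow> (nat \<Rightarrow> real \<Rightarrow> complex) \<Rightarrow> bool" where
  "chain k F \<longleftrightarrow> (\<forall>m<k. ac (F m) (F (Suc m))) \<and> square_integrable (F k)"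

lemma chain_ac: "chain k F \<Longrightarrow> m < k \<Longrightarrow> ac (F m) (F (Suc m))"
  by (simp add: chain_def)

lemma chain_sq: "chain k F \<Longrightarrow> m \<le> k \<Longrightarrow> square_integrable (F m)"
  using ac_sq[of "F m" "F (Suc m)"] by (cases "m = k") (auto simp: chain_def)

lemma chain_le: "chain k F \<Longrightarrow> l \<le> k \<Longrightarrow> chain l F"
  using chain_sq[of k F l] by (auto simp: chain_def)

lemma chain_add:
  "chain k F \<Longrightarrow> chain k G \<Longrightarrow> chain k (\<lambda>m x. F m x + G m x)"
  by (simp add: chain_def ac_add square_integrable_add)

lemma chain_scale: "chain k F \<Longrightarrow> chain k (\<lambda>m x. c * F m x)"
  by (simp add: chain_def ac_scale square_integrable_scale)

lemma chain_diff:
  "chain k F \<Longrightarrow> chain k G \<Longrightarrow> chain k (\<lambda>m x. F m x - G m x)"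
  by (simp add: chain_def ac_diff square_integrable_diff)

definition zero_trace :: "real \<Rightarrow> nat \<Rightarrow> (nat \<Rightarrow> real \<Rightarrow> complex) \<Rightarrow> bool" where
  "zero_trace c k F \<longleftrightarrow> (\<forall>m<k. F m c = 0)"

text \<open>The derivatives of \<open>(a + b x) F\<close>, by Leibniz' rule; for \<open>m = 0\<close> the truncated index
  \<open>m - 1\<close> is harmless because of the factor \<open>m\<close>.\<close>

definition mul_affine :: "real \<Rightarrow> real \<Rightarrow> (nat \<Rightarrow> real \<Rightarrow> complex) \<Rightarrow> nat \<Rightarrow> real \<Rightarrow> complex" where
  "mul_affine a b F m x = complex_of_real (a + b * x) * F m x + of_nat m * complex_of_real b * F (m - 1) x"

lemma chain_mul_affine:
  assumes "chain k F" shows "chain k (mul_affine a b F)"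
  unfolding chain_def
proof (intro conjI allI impI)
  fix m assume m: "m < k"
  have 1: "ac (\<lambda>x. complex_of_real (a + b * x) * F m x)
      (\<lambda>x. complex_of_real b * F m x + complex_of_real (a + b * x) * F (Suc m) x)"
    by (rule ac_mult[OF ac_affine chain_ac[OF assms m]])
  show "ac (mul_affine a b F m) (mul_affine a b F (Suc m))"
  proof (cases m)
    case 0
    then show ?thesis by (intro ac_cong[OF 1]) (auto simp: mul_affine_def)
  next
    case (Suc n)
    have "ac (F n) (F m)" using chain_ac[OF assms, of n] m Suc by simp
    from ac_add[OF 1 ac_scale[OF this, of "of_nat m * complex_of_real b"]]
    show ?thesis by (rule ac_cong) (auto simp: mul_affine_def Suc algebra_simps)
  qed
next
  have "square_integrable (\<lambda>x. complex_of_real (a + b * x) * F k x)"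
    by (rule square_integrable_mult_continuous[OF ac_continuous[OF ac_affine]]) (rule chain_sq[OF assms order_refl])
  moreover have "square_integrable (F (k - 1))" using chain_sq[OF assms, of "k - 1"] by simp
  ultimately show "square_integrable (mul_affine a b F k)"
    unfolding mul_affine_def by (intro square_integrable_add square_integrable_scale)
qed

lemma zero_trace_mul_affine: "zero_trace c k F \<Longrightarrow> zero_trace c k (mul_affine a b F)"
  by (auto simp: zero_trace_def mul_affine_def)

text \<open>A factor that vanishes at \<open>c\<close> raises the order of vanishing by one: in
  Leibniz' rule the only derivative of F not known to vanish is multiplied by a + b c.\<close>

lemma zero_trace_mul_affine_Suc:
  "zero_trace c k F \<Longrightarrow> a + b * c = 0 \<Longrightarrow> zero_trace c (Suc k) (mul_affine a b F)"
  unfolding zero_trace_def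
proof (intro allI impI)
  fix m assume F: "\<forall>m<k. F m c = 0" and ab: "a + b * c = 0" and m: "m < Suc k"
  have "of_nat m * F (m - 1) c = 0" using F m by (cases m) auto
  moreover have "complex_of_real (a + b * c) = 0" using ab by (metis of_real_0)
  ultimately show "mul_affine a b F m c = 0" unfolding mul_affine_def by (metis add.right_neutral mult.assoc mult.commute mult_zero_left mult_zero_right)
qed

text \<open>A sum in place of the Euclidean combination in \<open>sobolev_norm\<close>, so that
  termwise bounds and the triangle inequality suffice; the equivalence
  \<open>sobolev_norm_chain\<close> enters only in the final theorem.\<close>

definition chain_norm :: "nat \<Rightarrow> (nat \<Rightarrow> real \<Rightarrow> complex) \<Rightarrow> real" where
  "chain_norm k F = (\<Sum>m\<le>k. norm (abs_l2 (F m)))"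

lemma norm_le_chain_norm: "m \<le> k \<Longrightarrow> norm (abs_l2 (F m)) \<le> chain_norm k F"
  unfolding chain_norm_def by (rule member_le_sum) auto

lemma chain_norm_nonneg: "0 \<le> chain_norm k F"
  unfolding chain_norm_def by (rule sum_nonneg) simp

lemma norm_abs_l2_add_le:
  assumes "square_integrable f" "square_integrable g"
  shows "norm (abs_l2 (\<lambda>x. f x + g x)) \<le> norm (abs_l2 f) + norm (abs_l2 g)"
  unfolding abs_l2_add[OF assms] by (rule norm_triangle_ineq)

lemma chain_norm_add:
  assumes "chain k F" "chain k G"
  shows "chain_norm k (\<lambda>m x. F m x + G m x) \<le> chain_norm k F + chain_norm k G"
  unfolding chain_norm_def sum.distrib[symmetric]
  by (rule sum_mono) (use assms chain_sq in \<open>auto intro!: norm_abs_l2_add_le\<close>)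

lemma chain_norm_scale:
  assumes "chain k F"
  shows "chain_norm k (\<lambda>m x. c * F m x) = cmod c * chain_norm k F"
  unfolding chain_norm_def sum_distrib_left
  by (rule sum.cong) (use assms chain_sq in \<open>auto intro!: norm_abs_l2_scale\<close>)

lemma chain_norm_mul_affine:
  assumes F: "chain k F" and w: "\<And>x. x \<in> {0..1} \<Longrightarrow> \<bar>a + b * x\<bar> \<le> 1" "\<bar>b\<bar> \<le> 1"
  shows "chain_norm k (mul_affine a b F) \<le> (real k + 1) * (real k + 1) * chain_norm k F"
proof -
  have "norm (abs_l2 (mul_affine a b F m)) \<le> (real k + 1) * chain_norm k F" if m: "m \<le> k" for m
  proof -
    have sq: "square_integrable (F m)" "square_integrable (F (m - 1))" using chain_sq[OF F] m by auto
    have sq': "square_integrable (\<lambda>x. complex_of_real (a + b * x) * F m x)"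
      by (rule square_integrable_mult_continuous[OF ac_continuous[OF ac_affine] sq(1)])
    have "norm (abs_l2 (mul_affine a b F m)) \<le> norm (abs_l2 (\<lambda>x. complex_of_real (a + b * x) * F m x))
        + norm (abs_l2 (\<lambda>x. (of_nat m * complex_of_real b) * F (m - 1) x))"
      unfolding mul_affine_def by (rule norm_abs_l2_add_le[OF sq' square_integrable_scale[OF sq(2)]])
    also have "norm (abs_l2 (\<lambda>x. complex_of_real (a + b * x) * F m x)) \<le> 1 * norm (abs_l2 (F m))"
      by (rule norm_abs_l2_mono[OF sq' sq(1)])
        (use w(1) in \<open>auto simp: norm_mult simp del: of_real_add of_real_mult intro!: mult_left_le_one_le\<close>)
    also have "norm (abs_l2 (\<lambda>x. (of_nat m * complex_of_real b) * F (m - 1) x)) \<le> real k * chain_norm k F"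
    proof -
      have "real m * \<bar>b\<bar> \<le> real k * 1" using m w(2) by (intro mult_mono) auto
      then have "cmod (of_nat m * complex_of_real b) \<le> real k" by (simp add: norm_mult)
      moreover have "norm (abs_l2 (F (m - 1))) \<le> chain_norm k F" using m by (intro norm_le_chain_norm) simp
      ultimately show ?thesis unfolding norm_abs_l2_scale[OF sq(2)] by (intro mult_mono) auto
    qed
    also have "1 * norm (abs_l2 (F m)) \<le> chain_norm k F" using norm_le_chain_norm[OF m] by simp
    finally show ?thesis by (simp add: algebra_simps)
  qed
  then have "chain_norm k (mul_affine a b F) \<le> (\<Sum>m\<le>k. (real k + 1) * chain_norm k F)"
    unfolding chain_norm_def[of k "mul_affine a b F"] by (intro sum_mono) auto
  then show ?thesis by (simp add: algebra_simps)
qed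

section \<open>Square functions of accretive resolvents\<close>

lemma funpow_commute:
  assumes "\<And>x. f (g x) = g (f x)"
  shows "(f ^^ n) (g x) = g ((f ^^ n) x)"
  by (induction n) (simp_all add: assms)

lemma linear_funpow: "linear (f :: 'a::real_vector \<Rightarrow> 'a) \<Longrightarrow> linear (f ^^ n)"
proof (induction n)
  case 0
  show ?case by (simp add: linear_iff)
next
  case (Suc n)
  then show ?case using linear_compose[of "f ^^ n" f] by (simp add: o_def)
qed

lemma norm_funpow_le:
  fixes f :: "'a::real_normed_vector \<Rightarrow> 'a"
  assumes "\<And>x. norm (f x) \<le> norm x"
  shows "norm ((f ^^ n) x) \<le> norm x"
proof (induction n)
  case (Suc n)
  then show ?case using assms[of "(f ^^ n) x"] by simp
qed simp

text \<open>The polynomial \<open>p x = 1 + 5 x + 15 x\<^sup>2 + 35 x ^ 3 + 70 x ^ 4\<close>, evaluated at an operator, is the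
  solution of degree 4 of \<open>x ^ 5 * p (1 - x) + (1 - x) ^ 5 * p x = 1\<close>.\<close>

definition bezout_op :: "('a::real_vector \<Rightarrow> 'a) \<Rightarrow> 'a \<Rightarrow> 'a" where
  "bezout_op X u = u + 5 *\<^sub>R X u + 15 *\<^sub>R X (X u) + 35 *\<^sub>R X (X (X u)) + 70 *\<^sub>R X (X (X (X u)))"

lemma bezout_op_commute:
  assumes "linear f" "\<And>x. f (X x) = X (f x)"
  shows "f (bezout_op X u) = bezout_op X (f u)"
  using assms(1) by (simp add: bezout_op_def linear_add linear_scale assms(2))

lemma norm_bezout_op_le:
  assumes "\<And>x. norm (X x) \<le> norm x"
  shows "norm (bezout_op X (u :: 'a::real_normed_vector)) \<le> 126 * norm u"
proof -
  have a: "norm (X u) \<le> norm u" "norm (X (X u)) \<le> norm u" "norm (X (X (X u))) \<le> norm u" "norm (X (X (X (X u)))) \<le> norm u"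
    using assms order_trans by meson+
  have "norm (bezout_op X u) \<le> norm u + norm (5 *\<^sub>R X u) + norm (15 *\<^sub>R X (X u)) + norm (35 *\<^sub>R X (X (X u))) + norm (70 *\<^sub>R X (X (X (X u))))"
    unfolding bezout_op_def by (intro norm_triangle_le add_mono order_refl)
  then show ?thesis using a by simp
qed

text \<open>The scalar identity x^5 p(1 - x) + (1 - x)^5 p(x) = 1 at the operator \<open>R\<close>.
  The approximation R^5 p(D) of the identity takes values in the range of R^5, which means five
  derivatives when \<open>R\<close> is a resolvent of d/dx, and its error carries five factors
  \<open>D\<close>.\<close>

lemma bezout_op_identity:
  fixes R :: "'a::real_inner \<Rightarrow> 'a"
  assumes "linear R"
  defines "D \<equiv> \<lambda>u. u - R u"
  shows "u - (R ^^ 5) (bezout_op D u) = (D ^^ 5) (bezout_op R u)"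
proof -
  note lin = linear_add[OF assms(1)] linear_diff[OF assms(1)] linear_scale[OF assms(1)]
  \<comment> \<open>Testing against an arbitrary vector turns each operator identity into real
    linear arithmetic.\<close>
  have D5: "(D ^^ 5) x = x - 5 *\<^sub>R R x + 10 *\<^sub>R R (R x) - 10 *\<^sub>R R (R (R x)) + 5 *\<^sub>R R (R (R (R x))) - R (R (R (R (R x))))" for x
    by (subst vector_eq_ldot[symmetric]) (simp add: D_def eval_nat_numeral lin inner_add inner_diff)
  have D1: "D x = x - R x" for x by (simp add: D_def)
  have D2: "D (D x) = x - 2 *\<^sub>R R x + R (R x)" for x
    by (subst vector_eq_ldot[symmetric]) (simp add: D1 lin inner_add inner_diff)
  have D3: "D (D (D x)) = x - 3 *\<^sub>R R x + 3 *\<^sub>R R (R x) - R (R (R x))" for x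
    by (subst vector_eq_ldot[symmetric]) (simp add: D2[of "D x"] D1 lin inner_add inner_diff)
  have D4: "D (D (D (D x))) = x - 4 *\<^sub>R R x + 6 *\<^sub>R R (R x) - 4 *\<^sub>R R (R (R x)) + R (R (R (R x)))" for x
    by (subst vector_eq_ldot[symmetric]) (simp add: D3[of "D x"] D1 lin inner_add inner_diff)
  have R5: "(R ^^ 5) x = R (R (R (R (R x))))" for x by (simp add: eval_nat_numeral)
  show ?thesis
    unfolding D5 R5 bezout_op_def D4 D3 D2 D1
    by (subst vector_eq_ldot[symmetric]) (simp add: lin inner_add inner_diff)
qed

text \<open>\<open>V\<close> plays the role of integration \<open>\<partial>\<^sup>-\<^sup>1\<close> and \<open>R s\<close> that of the resolvent \<open>(1 + s \<partial>)\<^sup>-\<^sup>1\<close>.\<close>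

locale accretive_inverse =
  fixes V :: "'a::real_inner \<Rightarrow> 'a" and R :: "real \<Rightarrow> 'a \<Rightarrow> 'a"
  assumes linear_V: "linear V"
    and accretive: "0 \<le> V x \<bullet> x"
    and resolvent: "0 < s \<Longrightarrow> s *\<^sub>R R s u + V (R s u) = V u"
begin

text \<open>Accretivity makes s + V injective. Since \<open>R s\<close> is known only through its
  equation, linearity, commutation and the resolvent identity are all obtained by exhibiting another
  solution of that equation.\<close>

lemma resolvent_unique:
  assumes "0 < s" "s *\<^sub>R x + V x = V u"
  shows "x = R s u"
proof -
  define y where "y = x - R s u"
  have "s *\<^sub>R y + V y = (s *\<^sub>R x + V x) - (s *\<^sub>R R s u + V (R s u))"
    by (simp add: y_def linear_diff[OF linear_V] scaleR_diff_right)
  then have "s *\<^sub>R y + V y = 0" by (simp add: assms(2) resolvent[OF assms(1)])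
  then have "s * (y \<bullet> y) + V y \<bullet> y = 0" by (metis inner_add_left inner_scaleR_left inner_zero_left)
  with accretive[of y] have "s * (y \<bullet> y) \<le> 0" by linarith
  then have "y \<bullet> y \<le> 0" using assms(1) by (simp add: mult_le_0_iff)
  then have "y = 0" by (metis inner_ge_zero inner_eq_zero_iff order_antisym)
  then show ?thesis by (simp add: y_def)
qed

lemma linear_R: assumes "0 < s" shows "linear (R s)"
proof (rule linearI)
  note V = linear_add[OF linear_V] linear_scale[OF linear_V]
  fix u v :: 'a and c :: real
  have "s *\<^sub>R (R s u + R s v) + V (R s u + R s v) = (s *\<^sub>R R s u + V (R s u)) + (s *\<^sub>R R s v + V (R s v))"
    by (simp add: V scaleR_add_right add_ac)
  also have "\<dots> = V (u + v)" by (simp only: resolvent[OF assms] V)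
  finally show "R s (u + v) = R s u + R s v"
    by (rule resolvent_unique[OF assms, symmetric])
  have "s *\<^sub>R (c *\<^sub>R R s u) + V (c *\<^sub>R R s u) = c *\<^sub>R (s *\<^sub>R R s u + V (R s u))"
    by (simp add: V scaleR_add_right)
  also have "\<dots> = V (c *\<^sub>R u)" by (simp only: resolvent[OF assms] V)
  finally show "R s (c *\<^sub>R u) = c *\<^sub>R R s u"
    by (rule resolvent_unique[OF assms, symmetric])
qed

lemma V_R: assumes "0 < s" shows "V (R s u) = R s (V u)"
proof (rule resolvent_unique[OF assms])
  have "s *\<^sub>R V (R s u) + V (V (R s u)) = V (s *\<^sub>R R s u + V (R s u))"
    by (simp add: linear_add[OF linear_V] linear_scale[OF linear_V])
  then show "s *\<^sub>R V (R s u) + V (V (R s u)) = V (V u)" by (simp only: resolvent[OF assms])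
qed

lemma R_commute: assumes "0 < s" "0 < t" shows "R s (R t u) = R t (R s u)"
proof (rule resolvent_unique[OF assms(2)])
  have "t *\<^sub>R R s (R t u) + V (R s (R t u)) = R s (t *\<^sub>R R t u + V (R t u))"
    by (simp add: linear_add[OF linear_R[OF assms(1)]] linear_scale[OF linear_R[OF assms(1)]] V_R[OF assms(1)])
  then show "t *\<^sub>R R s (R t u) + V (R s (R t u)) = V (R s u)"
    by (simp add: resolvent[OF assms(2)] V_R[OF assms(1)])
qed

lemma V_diff_R: "0 < s \<Longrightarrow> V (u - R s u) = s *\<^sub>R R s u"
  using resolvent[of s u] by (simp add: linear_diff[OF linear_V] algebra_simps)

text \<open>Accretivity of \<open>V\<close> applied to u - R u, because V (u - R u) = s R u.\<close>

lemma R_accretive: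
  assumes "0 < s" shows "0 \<le> (u - R s u) \<bullet> R s u"
proof -
  have "0 \<le> s * ((u - R s u) \<bullet> R s u)"
    using accretive[of "u - R s u"] V_diff_R[OF assms, of u] by (simp add: inner_commute)
  then show ?thesis using assms by (simp add: zero_le_mult_iff)
qed

lemma R_contraction:
  assumes "0 < s"
  shows "norm (R s u) \<le> norm u" "norm (u - R s u) \<le> norm u"
proof -
  have "(norm u)\<^sup>2 = (norm (R s u))\<^sup>2 + 2 * ((u - R s u) \<bullet> R s u) + (norm (u - R s u))\<^sup>2"
    by (simp add: power2_norm_eq_inner inner_diff inner_commute)
  with R_accretive[OF assms, of u] have "(norm (R s u))\<^sup>2 \<le> (norm u)\<^sup>2" "(norm (u - R s u))\<^sup>2 \<le> (norm u)\<^sup>2"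
    by (smt (verit) zero_le_power2)+
  then show "norm (R s u) \<le> norm u" "norm (u - R s u) \<le> norm u"
    by (auto intro: power2_le_imp_le)
qed

text \<open>The first resolvent identity for the parameters s and s / 4.\<close>

lemma resolvent_quarter:
  assumes "0 < s" shows "R (s / 4) u = 4 *\<^sub>R R s u - 3 *\<^sub>R R (s / 4) (R s u)"
proof (rule resolvent_unique[symmetric])
  define b c where "b = R s u" and "c = R (s / 4) b"
  have b: "s *\<^sub>R b + V b = V u" and c: "(s / 4) *\<^sub>R c + V c = V b"
    using resolvent assms by (auto simp: b_def c_def)
  have "(s / 4) *\<^sub>R (4 *\<^sub>R b - 3 *\<^sub>R c) + V (4 *\<^sub>R b - 3 *\<^sub>R c) = s *\<^sub>R b + 4 *\<^sub>R V b - 3 *\<^sub>R ((s / 4) *\<^sub>R c + V c)"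
    by (simp add: linear_diff[OF linear_V] linear_scale[OF linear_V] algebra_simps)
  also have "\<dots> = s *\<^sub>R b + V b"
    unfolding c by (subst vector_eq_ldot[symmetric]) (simp add: inner_add inner_diff)
  finally show "(s / 4) *\<^sub>R (4 *\<^sub>R b - 3 *\<^sub>R c) + V (4 *\<^sub>R b - 3 *\<^sub>R c) = V u" using b by simp
qed (use assms in simp)

text \<open>Passing from \<open>s\<close> to \<open>s / 4\<close> increases \<open>\<parallel>R s u\<parallel>\<^sup>2\<close> by a definite amount, so that these
  increments telescope to a square function estimate.\<close>

lemma resolvent_increment:
  assumes s: "0 < s"
  shows "(norm (R s (u - R s u)))\<^sup>2 \<le> 2 * ((norm (R (s / 4) u))\<^sup>2 - (norm (R s u))\<^sup>2)"
proof -
  have s4: "0 < s / 4" using s by simp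
  note L = linear_R[OF s] note L4 = linear_R[OF s4]
  define b c where "b = R s u" and "c = R (s / 4) b"
  have a: "R (s / 4) u = b + 3 *\<^sub>R (b - c)"
    unfolding resolvent_quarter[OF s, of u] b_def c_def
    by (subst vector_eq_ldot[symmetric]) (simp add: inner_add inner_diff)
  \<comment> \<open>The vector on the left is c + 4 (b - c) and b is c + (b - c): subtracting the
    squared norm of b leaves the coefficients 8 - 2 = 6 and 16 - 1 = 15. The cross term is
    nonnegative by accretivity.\<close>
  have "(norm (b + 3 *\<^sub>R (b - c)))\<^sup>2 = (norm b)\<^sup>2 + 6 * ((b - c) \<bullet> c) + 15 * (norm (b - c))\<^sup>2"
    by (simp add: power2_norm_eq_inner inner_add inner_diff inner_commute)
  with a R_accretive[OF s4, of b] have 1: "15 * (norm (b - c))\<^sup>2 \<le> (norm (R (s / 4) u))\<^sup>2 - (norm b)\<^sup>2"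
    by (simp add: c_def)
  \<comment> \<open>This returns from b - c, which involves the finer resolvent, to b - R_s b: the
    two differ by 3 R_s (b - c), by the resolvent identity for \<open>b\<close>.\<close>
  have c: "c = 4 *\<^sub>R R s b - 3 *\<^sub>R R s c"
    using resolvent_quarter[OF s, of b] R_commute[OF s4 s, of b] by (simp add: c_def)
  have "v \<bullet> c = 4 * (v \<bullet> R s b) - 3 * (v \<bullet> R s c)" for v
    by (subst c) (simp add: inner_diff)
  then have "b - R s b = (b - c) + 3 *\<^sub>R R s (b - c)"
    by (subst vector_eq_ldot[symmetric])
      (simp add: linear_diff[OF L] inner_add inner_diff algebra_simps)
  then have "norm (b - R s b) \<le> norm (b - c) + 3 * norm (R s (b - c))"
    by (metis norm_triangle_ineq norm_scaleR abs_numeral)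
  then have "norm (b - R s b) \<le> 4 * norm (b - c)"
    using R_contraction(1)[OF s, of "b - c"] by linarith
  then have "(norm (b - R s b))\<^sup>2 \<le> 16 * (norm (b - c))\<^sup>2"
    using power_mono[of "norm (b - R s b)" "4 * norm (b - c)" 2] by (simp add: power_mult_distrib)
  then have "(norm (b - R s b))\<^sup>2 \<le> 2 * ((norm (R (s / 4) u))\<^sup>2 - (norm b)\<^sup>2)"
  proof -
    have "x \<le> 2 * p" if "x \<le> 16 * y" "15 * y \<le> p" "0 \<le> y" for x y p :: real
      using that by linarith
    from this[OF _ 1] show ?thesis using \<open>_ \<le> 16 * (norm (b - c))\<^sup>2\<close> by simp
  qed
  then show ?thesis by (simp add: b_def linear_diff[OF L])
qed

lemma square_function:
  "(\<Sum>j<n. (norm (R ((1/4) ^ j) (u - R ((1/4) ^ j) u)))\<^sup>2) \<le> 2 * (norm u)\<^sup>2"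
proof -
  have "(\<Sum>j<n. (norm (R ((1/4) ^ j) (u - R ((1/4) ^ j) u)))\<^sup>2)
      \<le> (\<Sum>j<n. 2 * (norm (R ((1/4) ^ Suc j) u))\<^sup>2 - 2 * (norm (R ((1/4) ^ j) u))\<^sup>2)"
  proof (rule sum_mono)
    fix j
    show "(norm (R ((1/4) ^ j) (u - R ((1/4) ^ j) u)))\<^sup>2
        \<le> 2 * (norm (R ((1/4) ^ Suc j) u))\<^sup>2 - 2 * (norm (R ((1/4) ^ j) u))\<^sup>2"
      using resolvent_increment[of "(1/4) ^ j" u] by (simp add: mult.commute)
  qed
  also have "\<dots> = 2 * (norm (R ((1/4) ^ n) u))\<^sup>2 - 2 * (norm (R 1 u))\<^sup>2"
    by (subst sum_lessThan_telescope) simp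
  also have "\<dots> \<le> 2 * (norm u)\<^sup>2"
  proof -
    have "(norm (R ((1/4) ^ n) u))\<^sup>2 \<le> (norm u)\<^sup>2"
      by (intro power_mono R_contraction) auto
    then show ?thesis using zero_le_power2[of "norm (R 1 u)"] by linarith
  qed
  finally show ?thesis .
qed

text \<open>\<open>z\<close> is chosen so that V^5 z = R^5 p(D) V^k w; by the Bezout identity the
  error is then D^5 p(R) V^k w. Since V D = s R, the factor V^k uses up k of the five
  \<open>D\<close> and becomes s^k R^k. For 1 \<le> k \<le> 4 at least one \<open>R\<close> and one
  \<open>D\<close> are left on \<open>w\<close>, and they form the quantity \<open>e\<close> whose
  squares are summable over the scales. The constant is p(1) = 126.\<close>

lemma smooth_approximant:
  fixes w :: 'a
  assumes s: "0 < s" and k: "1 \<le> k" "k \<le> 4"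
  defines "e \<equiv> norm (R s (w - R s w))"
  shows "\<exists>z. norm ((V ^^ k) w - (V ^^ 5) z) \<le> 126 * s ^ k * e \<and> norm z \<le> 126 * (1 / s) ^ (5 - k) * e"
proof -
  define D where "D u = u - R s u" for u
  note LR = linear_R[OF s]
  have LD: "linear D" unfolding D_def by (intro linear_compose_sub LR linear_ident)
  have DR: "D (R s u) = R s (D u)" for u by (simp add: D_def linear_diff[OF LR])
  have VD: "V (D u) = s *\<^sub>R R s u" for u by (simp add: D_def V_diff_R[OF s])
  have VR: "V (R s u) = R s (V u)" for u by (rule V_R[OF s])
  have VD': "V (D u) = D (V u)" for u by (simp add: D_def linear_diff[OF linear_V] VR)
  have contr: "norm (R s u) \<le> norm u" "norm (D u) \<le> norm u" for u
    using R_contraction[OF s] by (auto simp: D_def)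
  have VDn: "(V ^^ n) ((D ^^ n) u) = s ^ n *\<^sub>R (R s ^^ n) u" for n u
  proof (induction n arbitrary: u)
    case (Suc n)
    have "(V ^^ Suc n) ((D ^^ Suc n) u) = V ((V ^^ n) ((D ^^ n) (D u)))" by (simp add: funpow_swap1)
    also have "\<dots> = s ^ n *\<^sub>R V ((R s ^^ n) (D u))" by (simp add: Suc linear_scale[OF linear_V])
    also have "V ((R s ^^ n) (D u)) = (R s ^^ n) (V (D u))" by (rule funpow_commute[symmetric]) (rule VR[symmetric])
    also have "\<dots> = s *\<^sub>R (R s ^^ n) (R s u)" by (simp add: VD linear_scale[OF linear_funpow[OF LR]])
    finally show ?case by (simp add: funpow_swap1)
  qed simp
  define y where "y = bezout_op D w"
  \<comment> \<open>Since V^(5-k) D^(5-k) = s^(5-k) R^(5-k), each missing derivative costs one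
    factor 1 / s.\<close>
  define z where "z = (1 / s) ^ (5 - k) *\<^sub>R (D ^^ (5 - k)) ((R s ^^ k) y)"
  have LV: "linear (V ^^ n)" "linear (D ^^ n)" "linear (R s ^^ n)" for n
    by (intro linear_funpow linear_V LD LR)+
  have cVR: "(V ^^ i) ((R s ^^ j) u) = (R s ^^ j) ((V ^^ i) u)" for i j u
    by (rule funpow_commute) (rule funpow_commute[symmetric], rule VR[symmetric])
  have cVD: "(V ^^ i) ((D ^^ j) u) = (D ^^ j) ((V ^^ i) u)" for i j u
    by (rule funpow_commute) (rule funpow_commute[symmetric], rule VD'[symmetric])
  have "(V ^^ 5) z = (V ^^ k) ((V ^^ (5 - k)) z)"
    using k funpow_add[of k "5 - k" V] by simp
  also have "(V ^^ (5 - k)) z = (1 / s) ^ (5 - k) *\<^sub>R (s ^ (5 - k) *\<^sub>R (R s ^^ (5 - k)) ((R s ^^ k) y))"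
    by (simp add: z_def linear_scale[OF LV(1)] VDn)
  also have "\<dots> = (R s ^^ 5) y"
    using k s funpow_add[of "5 - k" k "R s"] by (simp add: power_one_over)
  also have "(V ^^ k) ((R s ^^ 5) y) = (R s ^^ 5) ((V ^^ k) y)" by (rule cVR)
  also have "(V ^^ k) y = bezout_op D ((V ^^ k) w)"
    unfolding y_def by (rule bezout_op_commute[OF LV(1)]) (rule funpow_commute, rule VD')
  finally have "(V ^^ k) w - (V ^^ 5) z = (D ^^ 5) (bezout_op (R s) ((V ^^ k) w))"
    using bezout_op_identity[OF LR, of "(V ^^ k) w"] by (simp add: D_def[abs_def])
  also have "\<dots> = (D ^^ (5 - k)) ((D ^^ k) (bezout_op (R s) ((V ^^ k) w)))"
    using k funpow_add[of "5 - k" k D] by simp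
  also have "(D ^^ k) (bezout_op (R s) ((V ^^ k) w)) = bezout_op (R s) ((D ^^ k) ((V ^^ k) w))"
    by (rule bezout_op_commute[OF LV(2)]) (rule funpow_commute, rule DR)
  also have "(D ^^ k) ((V ^^ k) w) = s ^ k *\<^sub>R (R s ^^ k) w" using VDn cVD by metis
  also have "bezout_op (R s) \<dots> = s ^ k *\<^sub>R bezout_op (R s) ((R s ^^ k) w)"
    using bezout_op_commute[of "\<lambda>x. s ^ k *\<^sub>R x" "R s"] linear_scale_self[of "s ^ k"]
    by (simp add: linear_scale[OF LR])
  also have "bezout_op (R s) ((R s ^^ k) w) = (R s ^^ k) (bezout_op (R s) w)"
    by (rule bezout_op_commute[symmetric, OF LV(3)]) (rule funpow_commute, rule refl)
  finally have err: "(V ^^ k) w - (V ^^ 5) z = s ^ k *\<^sub>R (D ^^ (5 - k)) ((R s ^^ k) (bezout_op (R s) w))"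
    by (simp add: linear_scale[OF LV(2)])
  have bound: "norm ((D ^^ (5 - k)) ((R s ^^ k) (bezout_op X w))) \<le> 126 * e"
    if X: "\<And>u. norm (X u) \<le> norm u" "\<And>u. R s (X u) = X (R s u)" "\<And>u. D (X u) = X (D u)" for X
  proof -
    \<comment> \<open>The bounds on \<open>k\<close> enter here: both exponents are positive, so one
      \<open>D\<close> and one \<open>R\<close> can be split off.\<close>
    obtain i j where ij: "5 - k = Suc i" "k = Suc j"
    proof
      show "5 - k = Suc (4 - k)" "k = Suc (k - 1)" using k by auto
    qed
    have "(D ^^ (5 - k)) ((R s ^^ k) (bezout_op X w)) = (D ^^ i) (D ((R s ^^ j) (R s (bezout_op X w))))"
      by (subst ij(1), subst ij(2)) (simp only: funpow_Suc_right o_apply)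
    also have "D ((R s ^^ j) (R s (bezout_op X w))) = (R s ^^ j) (D (R s (bezout_op X w)))"
      by (rule funpow_commute[symmetric]) (rule DR[symmetric])
    also have "D (R s (bezout_op X w)) = bezout_op X (R s (D w))"
      using bezout_op_commute[of "R s" X, OF LR X(2)] bezout_op_commute[of D X, OF LD X(3)] by (simp add: DR)
    finally have "norm ((D ^^ (5 - k)) ((R s ^^ k) (bezout_op X w))) \<le> norm (bezout_op X (R s (D w)))"
      by (metis norm_funpow_le[OF contr(1)] norm_funpow_le[OF contr(2)] order_trans)
    then show ?thesis using norm_bezout_op_le[OF X(1), of "R s (D w)"] by (simp add: e_def D_def)
  qed
  have "norm z \<le> (1 / s) ^ (5 - k) * (126 * e)"
    unfolding z_def y_def using s by (simp del: power_one_over) (intro mult_left_mono bound contr; simp add: DR)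
  moreover have "norm ((V ^^ k) w - (V ^^ 5) z) \<le> s ^ k * (126 * e)"
    unfolding err using s by simp (intro mult_left_mono bound contr; simp add: DR)
  ultimately show ?thesis by (intro exI[of _ z]) (simp add: mult_ac)
qed

end

section \<open>Integration from 0 and its resolvents\<close>

definition volterra :: "l2 \<Rightarrow> l2" where
  "volterra u = abs_l2 (\<lambda>x. integral {0..x} (rep_l2 u))"

lemma ac_prim: "square_integrable f \<Longrightarrow> ac (\<lambda>x. integral {0..x} f) f"
  using ac_antiderivative[of f 0] by simp

lemma volterra_ac:
  assumes "ac f g" "f 0 = 0"
  shows "volterra (abs_l2 g) = abs_l2 f"
proof -
  have g: "square_integrable g" using assms(1) by (rule ac_sqD)
  have "integral {0..x} (rep_l2 (abs_l2 g)) = f x" if "x \<in> {0..1}" for x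
    using integral_prefix_AE_cong[OF rep_abs_l2[OF g] that] ac_value[OF assms(1) that] assms(2) by simp
  then have "AE x in unit_measure. integral {0..x} (rep_l2 (abs_l2 g)) = f x"
    by (intro AE_unitI) auto
  then show ?thesis
    unfolding volterra_def
    by (subst abs_l2_eq_iff) (use assms ac_sq ac_prim[OF square_integrable_rep] in auto)
qed

lemma volterra_abs:
  "square_integrable f \<Longrightarrow> volterra (abs_l2 f) = abs_l2 (\<lambda>x. integral {0..x} f)"
  by (rule volterra_ac) (auto intro: ac_prim)

text \<open>The solution of s v' + v = u with v(0) = 0, found with the integrating factor exp(x /
  s).\<close>

definition volterra_resolvent :: "real \<Rightarrow> l2 \<Rightarrow> l2" where
  "volterra_resolvent s u = abs_l2 (\<lambda>x. complex_of_real (exp (- x / s) / s) *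
     integral {0..x} (\<lambda>y. complex_of_real (exp (y / s)) * rep_l2 u y))"

lemma linear_volterra: "linear volterra"
proof (rule linearI)
  fix u v :: l2 and c :: real
  define f g where "f = rep_l2 u" and "g = rep_l2 v"
  have sq: "square_integrable f" "square_integrable g" by (simp_all add: f_def g_def square_integrable_rep)
  have uv: "u = abs_l2 f" "v = abs_l2 g" by (simp_all add: f_def g_def abs_rep_l2)
  note p = ac_prim[OF sq(1)] ac_prim[OF sq(2)]
  show "volterra (u + v) = volterra u + volterra v"
    unfolding uv abs_l2_add[OF sq, symmetric] volterra_ac[OF ac_add[OF p], simplified] volterra_abs[OF sq(1)] volterra_abs[OF sq(2)]
    by (rule abs_l2_add) (use p ac_sq in auto)
  show "volterra (c *\<^sub>R u) = c *\<^sub>R volterra u"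
    unfolding uv abs_l2_scaleR[OF sq(1), symmetric] volterra_ac[OF ac_scale[OF p(1)], simplified] volterra_abs[OF sq(1)]
    by (rule abs_l2_scaleR) (use p ac_sq in auto)
qed

text \<open>With U the primitive of u, integration by parts gives 2 (U, u) = |U(1)|^2, because U(0)
  = 0.\<close>

lemma volterra_accretive: "0 \<le> volterra u \<bullet> u"
proof -
  define f where "f = rep_l2 u"
  have sq: "square_integrable f" and u: "u = abs_l2 f" by (simp_all add: f_def square_integrable_rep abs_rep_l2)
  have "2 * (abs_l2 (\<lambda>x. integral {0..x} f) \<bullet> abs_l2 f) = (cmod (integral {0..1} f))\<^sup>2"
    using ac_parts[OF ac_prim[OF sq] ac_prim[OF sq]]
    by (simp add: inner_commute complex_norm_square[symmetric] del: of_real_power)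
  then show ?thesis unfolding u volterra_abs[OF sq] by (metis zero_le_power2 zero_le_mult_iff zero_less_numeral not_less)
qed

lemma volterra_resolvent_eq:
  assumes s: "0 < s"
  shows "s *\<^sub>R volterra_resolvent s u + volterra (volterra_resolvent s u) = volterra u"
proof -
  define f where "f = rep_l2 u"
  have sq: "square_integrable f" and u: "u = abs_l2 f" by (simp_all add: f_def square_integrable_rep abs_rep_l2)
  define v where "v x = complex_of_real (exp (- x / s) / s) * integral {0..x} (\<lambda>y. complex_of_real (exp (y / s)) * f y)" for x
  have 1: "ac (\<lambda>x. complex_of_real (exp (- x / s) / s)) (\<lambda>x. complex_of_real (- exp (- x / s) / s / s))"
    by (rule ac_C1) (use s in \<open>auto intro!: derivative_eq_intros has_vector_derivative_of_real continuous_intros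
        simp: has_real_derivative_iff_has_vector_derivative[symmetric]\<close>)
  have 2: "square_integrable (\<lambda>y. complex_of_real (exp (y / s)) * f y)"
    by (rule square_integrable_mult_continuous[OF _ sq]) (use s in \<open>auto intro!: continuous_intros\<close>)
  have "ac v (\<lambda>x. (1 / complex_of_real s) * (f x - v x))"
    unfolding v_def
  proof (rule ac_cong[OF ac_mult[OF 1 ac_prim[OF 2]]])
    fix x :: real
    have "complex_of_real (exp (- x / s)) * complex_of_real (exp (x / s)) = 1"
      by (simp flip: of_real_mult exp_add)
    then have c: "complex_of_real (exp (- x / s) / s) * (complex_of_real (exp (x / s)) * f x) = f x / complex_of_real s"
      by (simp add: field_simps)
    show "complex_of_real (- exp (- x / s) / s / s) * integral {0..x} (\<lambda>y. complex_of_real (exp (y / s)) * f y)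
      + complex_of_real (exp (- x / s) / s) * (complex_of_real (exp (x / s)) * f x)
      = 1 / complex_of_real s * (f x - complex_of_real (exp (- x / s) / s) *
        integral {0..x} (\<lambda>y. complex_of_real (exp (y / s)) * f y))"
      unfolding c by (simp add: diff_divide_distrib)
  qed auto
  from ac_scale[OF this, of "complex_of_real s"]
  have 3: "ac (\<lambda>x. complex_of_real s * v x) (\<lambda>x. f x - v x)" by (rule ac_cong) (use s in auto)
  have sv: "square_integrable v" using \<open>ac v _\<close> by (rule ac_sq)
  have "volterra (abs_l2 f) = volterra (abs_l2 (\<lambda>x. f x - v x)) + volterra (abs_l2 v)"
    by (simp add: abs_l2_diff[OF sq sv] linear_diff[OF linear_volterra])
  also have "volterra (abs_l2 (\<lambda>x. f x - v x)) = s *\<^sub>R abs_l2 v"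
  proof -
    have "complex_of_real s * v 0 = 0" by (simp add: v_def)
    from volterra_ac[OF 3 this] show ?thesis by (simp only: abs_l2_scaleR[OF sv])
  qed
  finally have "volterra u = s *\<^sub>R abs_l2 v + volterra (abs_l2 v)" by (simp only: u)
  moreover have "volterra_resolvent s u = abs_l2 v"
    unfolding volterra_resolvent_def f_def[symmetric] v_def[abs_def] ..
  ultimately show ?thesis by simp
qed

interpretation volterra: accretive_inverse volterra volterra_resolvent
  by (simp add: accretive_inverse_def linear_volterra volterra_accretive volterra_resolvent_eq)

text \<open>Together with \<open>volterra_chain\<close> this identifies the range of V^k with the
  H^k functions whose k traces at 0 all vanish.\<close>

lemma chain_volterra:
  assumes "chain k F" "zero_trace 0 k F"
  shows "(volterra ^^ k) (abs_l2 (F k)) = abs_l2 (F 0)"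
  using assms
proof (induction k)
  case (Suc k)
  have "volterra (abs_l2 (F (Suc k))) = abs_l2 (F k)"
    by (rule volterra_ac) (use Suc.prems chain_ac in \<open>auto simp: zero_trace_def\<close>)
  then show ?case
    using Suc chain_le[of "Suc k" F k] by (simp add: funpow_swap1 zero_trace_def)
qed simp

lemma volterra_chain:
  "\<exists>Z. chain k Z \<and> zero_trace 0 k Z \<and> abs_l2 (Z k) = z \<and> abs_l2 (Z 0) = (volterra ^^ k) z"
proof (induction k)
  case 0
  show ?case
    by (rule exI[of _ "\<lambda>_. rep_l2 z"]) (simp add: chain_def zero_trace_def abs_rep_l2 square_integrable_rep)
next
  case (Suc k)
  then obtain Z where Z: "chain k Z" "zero_trace 0 k Z" "abs_l2 (Z k) = z" "abs_l2 (Z 0) = (volterra ^^ k) z" by blast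
  define Y where "Y m = (case m of 0 \<Rightarrow> \<lambda>x. integral {0..x} (Z 0) | Suc n \<Rightarrow> Z n)" for m
  have "square_integrable (Z 0)" using chain_sq[OF Z(1)] by simp
  then have "chain (Suc k) Y"
    using Z(1) by (auto simp: chain_def Y_def ac_prim split: nat.split)
  moreover have "zero_trace 0 (Suc k) Y"
    using Z(2) by (auto simp: zero_trace_def Y_def split: nat.split)
  moreover have "abs_l2 (Y 0) = (volterra ^^ Suc k) z"
    using Z(4) volterra_abs[OF \<open>square_integrable (Z 0)\<close>] by (simp add: Y_def)
  moreover have "Y (Suc k) = Z k" by (simp add: Y_def)
  ultimately show ?case using Z(3) by metis
qed

section \<open>Interpolation between \<open>L\<^sup>2\<close> and \<open>H\<^sup>5\<close>\<close>

text \<open>Membership in the real interpolation space of exponent \<open>k / 5\<close> between \<open>L\<^sup>2\<close> and the subspace of \<open>H\<^sup>5\<close>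
  cut out by \<open>P\<close>, with norm at most \<open>E\<close> up to a constant.\<close>

definition approx :: "((nat \<Rightarrow> real \<Rightarrow> complex) \<Rightarrow> bool) \<Rightarrow> nat \<Rightarrow> real \<Rightarrow> l2 \<Rightarrow> bool" where
  "approx P k E u \<longleftrightarrow> (\<exists>Y \<epsilon>. (\<forall>j. chain 5 (Y j) \<and> P (Y j) \<and>
      norm (u - abs_l2 (Y j 0)) \<le> ((1/4) ^ j) ^ k * \<epsilon> j \<and>
      ((1/4) ^ j) ^ (5 - k) * chain_norm 5 (Y j) \<le> \<epsilon> j) \<and>
    (\<forall>n. (\<Sum>j<n. (\<epsilon> j)\<^sup>2) \<le> E\<^sup>2))"

lemma approxE:
  assumes "approx P k E u"
  obtains Y \<epsilon> where "\<And>j. chain 5 (Y j)" "\<And>j. P (Y j)"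
    "\<And>j. norm (u - abs_l2 (Y j 0)) \<le> ((1/4) ^ j) ^ k * \<epsilon> j"
    "\<And>j. ((1/4) ^ j) ^ (5 - k) * chain_norm 5 (Y j) \<le> \<epsilon> j"
    "\<And>n. (\<Sum>j<n. (\<epsilon> j)\<^sup>2) \<le> E\<^sup>2" "\<And>j. 0 \<le> \<epsilon> j"
proof -
  obtain Y \<epsilon> where *: "\<And>j. chain 5 (Y j) \<and> P (Y j) \<and>
      norm (u - abs_l2 (Y j 0)) \<le> ((1/4) ^ j) ^ k * \<epsilon> j \<and>
      ((1/4) ^ j) ^ (5 - k) * chain_norm 5 (Y j) \<le> \<epsilon> j" "\<And>n. (\<Sum>j<n. (\<epsilon> j)\<^sup>2) \<le> E\<^sup>2"
    using assms unfolding approx_def by blast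
  have "0 \<le> \<epsilon> j" for j
  proof -
    have "0 \<le> ((1/4) ^ j) ^ (5 - k) * chain_norm 5 (Y j)"
      using chain_norm_nonneg by simp
    then show ?thesis using * order_trans by blast
  qed
  with * that show thesis by blast
qed

lemma approxI:
  assumes "\<And>j. chain 5 (Y j)" "\<And>j. P (Y j)"
    "\<And>j. norm (u - abs_l2 (Y j 0)) \<le> ((1/4) ^ j) ^ k * \<epsilon> j"
    "\<And>j. ((1/4) ^ j) ^ (5 - k) * chain_norm 5 (Y j) \<le> \<epsilon> j"
    "\<And>n. (\<Sum>j<n. (\<epsilon> j)\<^sup>2) \<le> E\<^sup>2"
  shows "approx P k E u"
  unfolding approx_def using assms by blast

lemma approx_mono:
  assumes "approx P k E u" "\<And>Y. P Y \<Longrightarrow> P' Y" "0 \<le> E" "E \<le> E'"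
  shows "approx P' k E' u"
proof -
  have "E\<^sup>2 \<le> E'\<^sup>2" using assms(3,4) by (intro power_mono) auto
  then show ?thesis
    using assms(1,2) unfolding approx_def by (blast intro: order_trans)
qed

text \<open>Interpolation of operators in this encoding: the images of the approximants approximate
  the image. A single constant \<open>C\<close> serves both bounds, so a decay factor common to both
  end points survives unchanged. It is used for the reflection of the interval and for
  \<open>S t\<close>.\<close>

lemma approx_transform:
  assumes u: "approx P k E u" and T: "\<And>x y. T (x - y) = T x - T y" "\<And>x. norm (T x) \<le> C * norm x" and "0 \<le> C"
    and YY: "\<And>Y. chain 5 Y \<Longrightarrow> P Y \<Longrightarrow>
      \<exists>Z. chain 5 Z \<and> P' Z \<and> abs_l2 (Z 0) = T (abs_l2 (Y 0)) \<and> chain_norm 5 Z \<le> C * chain_norm 5 Y"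
  shows "approx P' k (C * E) (T u)"
proof -
  obtain Y \<epsilon> where Y: "\<And>j. chain 5 (Y j)" "\<And>j. P (Y j)"
    "\<And>j. norm (u - abs_l2 (Y j 0)) \<le> ((1/4) ^ j) ^ k * \<epsilon> j"
    "\<And>j. ((1/4) ^ j) ^ (5 - k) * chain_norm 5 (Y j) \<le> \<epsilon> j"
    "\<And>n. (\<Sum>j<n. (\<epsilon> j)\<^sup>2) \<le> E\<^sup>2" "\<And>j. 0 \<le> \<epsilon> j"
    by (rule approxE[OF u], rule that)
  have "\<forall>j. \<exists>Z. chain 5 Z \<and> P' Z \<and> abs_l2 (Z 0) = T (abs_l2 (Y j 0)) \<and> chain_norm 5 Z \<le> C * chain_norm 5 (Y j)"
    using YY Y by blast
  then obtain Z where Z: "\<And>j. chain 5 (Z j)" "\<And>j. P' (Z j)" "\<And>j. abs_l2 (Z j 0) = T (abs_l2 (Y j 0))"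
    "\<And>j. chain_norm 5 (Z j) \<le> C * chain_norm 5 (Y j)" by metis
  show ?thesis
  proof (rule approxI[where Y = Z and \<epsilon> = "\<lambda>j. C * \<epsilon> j"])
    fix j n
    have "norm (T u - abs_l2 (Z j 0)) \<le> C * norm (u - abs_l2 (Y j 0))"
      using T(2)[of "u - abs_l2 (Y j 0)"] by (simp add: Z(3) T(1))
    also have "\<dots> \<le> C * (((1/4) ^ j) ^ k * \<epsilon> j)" using Y(3) \<open>0 \<le> C\<close> by (intro mult_left_mono)
    finally show "norm (T u - abs_l2 (Z j 0)) \<le> ((1/4) ^ j) ^ k * (C * \<epsilon> j)" by (simp add: mult_ac)
    have "((1/4) ^ j) ^ (5 - k) * chain_norm 5 (Z j) \<le> ((1/4) ^ j) ^ (5 - k) * (C * chain_norm 5 (Y j))"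
      by (intro mult_left_mono Z(4)) auto
    also have "\<dots> = C * (((1/4) ^ j) ^ (5 - k) * chain_norm 5 (Y j))" by simp
    also have "\<dots> \<le> C * \<epsilon> j" by (intro mult_left_mono Y(4) \<open>0 \<le> C\<close>)
    finally show "((1/4) ^ j) ^ (5 - k) * chain_norm 5 (Z j) \<le> C * \<epsilon> j" .
    show "(\<Sum>j<n. (C * \<epsilon> j)\<^sup>2) \<le> (C * E)\<^sup>2"
      using mult_left_mono[OF Y(5)[of n], of "C\<^sup>2"] by (simp add: power_mult_distrib sum_distrib_left)
  qed (use Z in auto)
qed

lemma approx_add:
  assumes u: "approx P k E u" and v: "approx P k F v" and "0 \<le> E" "0 \<le> F"
    and P: "\<And>Y Z. P Y \<Longrightarrow> P Z \<Longrightarrow> P (\<lambda>m x. Y m x + Z m x)"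
  shows "approx P k (2 * (E + F)) (u + v)"
proof -
  obtain Y \<epsilon> where Y: "\<And>j. chain 5 (Y j)" "\<And>j. P (Y j)"
    "\<And>j. norm (u - abs_l2 (Y j 0)) \<le> ((1/4) ^ j) ^ k * \<epsilon> j"
    "\<And>j. ((1/4) ^ j) ^ (5 - k) * chain_norm 5 (Y j) \<le> \<epsilon> j"
    "\<And>n. (\<Sum>j<n. (\<epsilon> j)\<^sup>2) \<le> E\<^sup>2" "\<And>j. 0 \<le> \<epsilon> j"
    by (rule approxE[OF u], rule that)
  obtain Z \<delta> where Z: "\<And>j. chain 5 (Z j)" "\<And>j. P (Z j)"
    "\<And>j. norm (v - abs_l2 (Z j 0)) \<le> ((1/4) ^ j) ^ k * \<delta> j"
    "\<And>j. ((1/4) ^ j) ^ (5 - k) * chain_norm 5 (Z j) \<le> \<delta> j"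
    "\<And>n. (\<Sum>j<n. (\<delta> j)\<^sup>2) \<le> F\<^sup>2" "\<And>j. 0 \<le> \<delta> j"
    by (rule approxE[OF v], rule that)
  show ?thesis
  proof (rule approxI[where Y = "\<lambda>j m x. Y j m x + Z j m x" and \<epsilon> = "\<lambda>j. \<epsilon> j + \<delta> j"])
    fix j n
    have sq: "square_integrable (Y j 0)" "square_integrable (Z j 0)" by (rule chain_sq[OF Y(1)], simp) (rule chain_sq[OF Z(1)], simp)
    have "norm (u + v - abs_l2 (\<lambda>x. Y j 0 x + Z j 0 x)) \<le> norm (u - abs_l2 (Y j 0)) + norm (v - abs_l2 (Z j 0))"
      using norm_triangle_ineq[of "u - abs_l2 (Y j 0)" "v - abs_l2 (Z j 0)"]
      by (simp add: abs_l2_add[OF sq] algebra_simps)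
    then show "norm (u + v - abs_l2 (\<lambda>x. Y j 0 x + Z j 0 x)) \<le> ((1/4) ^ j) ^ k * (\<epsilon> j + \<delta> j)"
      using Y(3)[of j] Z(3)[of j] unfolding distrib_left by linarith
    have "((1/4) ^ j) ^ (5 - k) * chain_norm 5 (\<lambda>m x. Y j m x + Z j m x)
        \<le> ((1/4) ^ j) ^ (5 - k) * (chain_norm 5 (Y j) + chain_norm 5 (Z j))"
      by (intro mult_left_mono chain_norm_add Y Z) auto
    then show "((1/4) ^ j) ^ (5 - k) * chain_norm 5 (\<lambda>m x. Y j m x + Z j m x) \<le> \<epsilon> j + \<delta> j"
      using Y(4)[of j] Z(4)[of j] unfolding distrib_left by linarith
    have "(\<Sum>j<n. (\<epsilon> j + \<delta> j)\<^sup>2) \<le> (\<Sum>j<n. 2 * (\<epsilon> j)\<^sup>2 + 2 * (\<delta> j)\<^sup>2)"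
    proof (rule sum_mono)
      show "(\<epsilon> j + \<delta> j)\<^sup>2 \<le> 2 * (\<epsilon> j)\<^sup>2 + 2 * (\<delta> j)\<^sup>2" for j
        using sum_squares_bound[of "\<epsilon> j" "\<delta> j"] by (simp add: power2_sum)
    qed
    also have "\<dots> \<le> 2 * E\<^sup>2 + 2 * F\<^sup>2"
      using Y(5)[of n] Z(5)[of n] by (simp add: sum.distrib flip: sum_distrib_left)
    also have "\<dots> \<le> (2 * (E + F))\<^sup>2"
      using mult_nonneg_nonneg[OF assms(3,4)] zero_le_power2[of E] zero_le_power2[of F]
      by (simp add: power_mult_distrib power2_sum)
    finally show "(\<Sum>j<n. (\<epsilon> j + \<delta> j)\<^sup>2) \<le> (2 * (E + F))\<^sup>2" .
  qed (use Y Z P chain_add in auto)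
qed

text \<open>The constant sequence has error 0, and k \<le> 4 leaves at least one factor (1/4)^j,
  which makes the weighted norms square summable.\<close>

lemma approx_single:
  assumes Y: "chain 5 Y" "P Y" and k: "k \<le> 4"
  shows "approx P k (2 * chain_norm 5 Y) (abs_l2 (Y 0))"
proof (rule approxI[where Y = "\<lambda>j. Y" and \<epsilon> = "\<lambda>j. ((1/4) ^ j) ^ (5 - k) * chain_norm 5 Y"])
  fix n
  have "(\<Sum>j<n. (((1/4) ^ j) ^ (5 - k) * chain_norm 5 Y)\<^sup>2) \<le> (\<Sum>j<n. (1/4) ^ j * (chain_norm 5 Y)\<^sup>2)"
  proof (rule sum_mono)
    fix j
    have "(((1/4::real) ^ j) ^ (5 - k))\<^sup>2 = (1/4) ^ (j * ((5 - k) * 2))" by (simp add: mult.assoc flip: power_mult)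
    also have "\<dots> \<le> (1/4) ^ j" using k by (intro power_decreasing) auto
    finally show "(((1/4) ^ j) ^ (5 - k) * chain_norm 5 Y)\<^sup>2 \<le> (1/4) ^ j * (chain_norm 5 Y)\<^sup>2"
      unfolding power_mult_distrib by (intro mult_right_mono) auto
  qed
  also have "\<dots> = (\<Sum>j<n. (1/4) ^ j) * (chain_norm 5 Y)\<^sup>2" by (simp add: sum_distrib_right)
  also have "(\<Sum>j<n. (1/4::real) ^ j) \<le> 4"
  proof -
    have "(\<Sum>j<n. (1/4::real) ^ j) = (1 - (1/4) ^ n) * (4 / 3)" by (simp add: sum_gp_strict)
    also have "\<dots> \<le> 1 * (4 / 3)" by (intro mult_right_mono) auto
    finally show ?thesis by simp
  qed
  finally show "(\<Sum>j<n. (((1/4) ^ j) ^ (5 - k) * chain_norm 5 Y)\<^sup>2) \<le> (2 * chain_norm 5 Y)\<^sup>2"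
    by (simp add: power_mult_distrib mult_right_mono)
qed (use Y chain_norm_nonneg in auto)

section \<open>The reflection of the interval\<close>

lemma integrable_unit_reflect:
  fixes f :: "real \<Rightarrow> 'a::euclidean_space"
  assumes "integrable unit_measure f"
  shows "integrable unit_measure (\<lambda>x. f (1 - x))"
proof -
  have "integrable lebesgue (\<lambda>x. indicator {0<..<1} x *\<^sub>R f x)"
    using assms by (simp add: integrable_restrict_space)
  then have "integrable lebesgue (\<lambda>x. indicator {0<..<1} (1 + (-1) * x) *\<^sub>R f (1 + (-1) * x))"
    by (subst lebesgue_integrable_real_affine_iff) auto
  also have "(\<lambda>x. indicator {0<..<1} (1 + (-1) * x) *\<^sub>R f (1 + (-1) * x)) = (\<lambda>x. indicator {0<..<1} x *\<^sub>R f (1 - x))"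
    by (auto simp: fun_eq_iff indicator_def)
  finally show ?thesis by (simp add: integrable_restrict_space)
qed

lemma square_integrable_reflect:
  assumes "square_integrable f" shows "square_integrable (\<lambda>x. f (1 - x))"
  unfolding square_integrable_def
proof
  show "(\<lambda>x. f (1 - x)) \<in> borel_measurable unit_measure"
    using integrable_unit_reflect[OF square_integrable_imp_integrable[OF assms]] by (rule borel_measurable_integrable)
  show "integrable unit_measure (\<lambda>x. (cmod (f (1 - x)))\<^sup>2)"
    using integrable_unit_reflect[of "\<lambda>x. (cmod (f x))\<^sup>2"] assms by (simp add: square_integrable_def)
qed

lemma integral_reflect_unit:
  fixes f :: "real \<Rightarrow> 'a::euclidean_space"
  assumes "f integrable_on {a..b}"
  shows "integral {1 - b..1 - a} (\<lambda>x. f (1 - x)) = integral {a..b} f"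
proof -
  have "((\<lambda>x. f ((-1) *\<^sub>R x + 1)) has_integral (1 / (\<bar>-1::real\<bar> ^ DIM(real))) *\<^sub>R integral {a..b} f)
      ((\<lambda>x. (1 / (-1)) *\<^sub>R x + - ((1 / (-1)) *\<^sub>R 1)) ` cbox a b)"
    using assms by (intro has_integral_affinity) (auto simp: integrable_integral)
  moreover have "(\<lambda>x. (1 / (-1)) *\<^sub>R x + - ((1 / (-1)) *\<^sub>R 1)) ` cbox a b = {1 - b..1 - a}"
    by (auto simp: image_iff intro!: bexI[of _ "1 - _"])
  ultimately show ?thesis by (simp add: integral_unique)
qed

lemma norm_abs_l2_reflect:
  assumes "square_integrable f"
  shows "norm (abs_l2 (\<lambda>x. f (1 - x))) = norm (abs_l2 f)"
proof -
  have "(norm (abs_l2 (\<lambda>x. f (1 - x))))\<^sup>2 = (norm (abs_l2 f))\<^sup>2"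
    using integral_reflect_unit[OF norm_power2_integrable_on[OF assms]] norm_abs_l2_integral[OF assms]
      norm_abs_l2_integral[OF square_integrable_reflect[OF assms]] by simp
  then show ?thesis by (simp add: power2_eq_iff_nonneg)
qed

lemma ac_reflect:
  assumes "ac f g" shows "ac (\<lambda>x. f (1 - x)) (\<lambda>x. - g (1 - x))"
proof (rule acI)
  have sq: "square_integrable g" using assms by (rule ac_sqD)
  show "square_integrable (\<lambda>x. - g (1 - x))" by (intro square_integrable_minus square_integrable_reflect sq)
  fix x :: real assume x: "x \<in> {0..1}"
  have "integral {1 - 1..1 - (1 - x)} (\<lambda>x. g (1 - x)) = integral {1 - x..1} g"
    using x by (intro integral_reflect_unit square_integrable_integrable_on[OF sq]) auto
  also have "\<dots> = f 1 - f (1 - x)" using x by (intro ac_integral[OF assms]) auto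
  finally show "f (1 - x) = f (1 - 0) + integral {0..x} (\<lambda>x. - g (1 - x))" by simp
qed

definition reflect_chain :: "(nat \<Rightarrow> real \<Rightarrow> complex) \<Rightarrow> nat \<Rightarrow> real \<Rightarrow> complex" where
  "reflect_chain F m x = (-1) ^ m * F m (1 - x)"

lemma chain_reflect:
  assumes "chain k F" shows "chain k (reflect_chain F)"
  unfolding chain_def reflect_chain_def
proof (intro conjI allI impI)
  fix m assume "m < k"
  from ac_scale[OF ac_reflect[OF chain_ac[OF assms this]], of "(-1) ^ m"]
  show "ac (\<lambda>x. (- 1) ^ m * F m (1 - x)) (\<lambda>x. (- 1) ^ Suc m * F (Suc m) (1 - x))"
    by (rule ac_cong) auto
qed (intro square_integrable_scale square_integrable_reflect chain_sq[OF assms order_refl])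

lemma chain_norm_reflect:
  assumes "chain k F" shows "chain_norm k (reflect_chain F) = chain_norm k F"
  unfolding chain_norm_def
proof (rule sum.cong[OF refl])
  fix m assume "m \<in> {..k}"
  then have sq: "square_integrable (F m)" using chain_sq[OF assms] by simp
  have "reflect_chain F m = (\<lambda>x. (-1) ^ m * F m (1 - x))" by (auto simp: reflect_chain_def)
  then show "norm (abs_l2 (reflect_chain F m)) = norm (abs_l2 (F m))"
    using norm_abs_l2_scale[OF square_integrable_reflect[OF sq], of "(-1) ^ m"] norm_abs_l2_reflect[OF sq]
    by (simp add: norm_power)
qed

lemma zero_trace_reflect: "zero_trace (1 - c) k F \<Longrightarrow> zero_trace c k (reflect_chain F)"
  by (simp add: zero_trace_def reflect_chain_def)

definition reflect_l2 :: "l2 \<Rightarrow> l2" where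
  "reflect_l2 u = abs_l2 (\<lambda>x. rep_l2 u (1 - x))"

text \<open>The exceptional set is reflected by way of its indicator function: this has norm 0 in
  \<open>l2\<close>, and reflection preserves the norm.\<close>

lemma AE_unit_reflect:
  assumes "AE x in unit_measure. P x"
  shows "AE x in unit_measure. P (1 - x)"
proof -
  obtain N where N: "N \<in> null_sets unit_measure" "{x \<in> {0<..<1}. \<not> P x} \<subseteq> N"
  proof (rule AE_E3[OF assms])
    fix N assume "\<And>x. x \<in> space unit_measure - N \<Longrightarrow> P x" "N \<in> null_sets unit_measure"
    then show thesis by (intro that[of N]) auto
  qed
  have "integrable unit_measure (indicator N :: real \<Rightarrow> real)"
    using N(1) by (intro integrable_real_indicator) auto
  have N': "AE x in unit_measure. x \<notin> N" using N(1) by (rule AE_not_in)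
  have sq: "square_integrable (indicator N)"
  proof -
    have "(indicator N :: real \<Rightarrow> complex) \<in> borel_measurable unit_measure" using N(1) by auto
    moreover have "(\<lambda>x. (cmod (indicator N x))\<^sup>2) = (indicator N :: real \<Rightarrow> real)"
      by (auto simp: indicator_def)
    ultimately show ?thesis
      using \<open>integrable unit_measure (indicator N :: real \<Rightarrow> real)\<close> by (simp add: square_integrable_def)
  qed
  have "abs_l2 (indicator N) = 0"
    unfolding abs_l2_zero[symmetric] abs_l2_eq_iff[OF sq square_integrable_zero] using N' by eventually_elim simp
  then have "norm (abs_l2 (\<lambda>x. indicator N (1 - x))) = 0" using norm_abs_l2_reflect[OF sq] by simp
  then have "abs_l2 (\<lambda>x. indicator N (1 - x)) = abs_l2 (\<lambda>x. 0)" by (simp add: abs_l2_zero)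
  then have "AE x in unit_measure. indicator N (1 - x) = (0::complex)"
    unfolding abs_l2_eq_iff[OF square_integrable_reflect[OF sq] square_integrable_zero] .
  moreover have "AE x in unit_measure. x \<in> {0<..<1::real}" by (rule AE_unitI)
  ultimately show ?thesis
  proof eventually_elim
    case (elim x)
    then have "1 - x \<notin> N" "1 - x \<in> {0<..<1}" by (auto simp: indicator_eq_0_iff)
    then show ?case using N(2) by blast
  qed
qed

lemma reflect_l2_abs:
  assumes "square_integrable f"
  shows "reflect_l2 (abs_l2 f) = abs_l2 (\<lambda>x. f (1 - x))"
  unfolding reflect_l2_def
  by (subst abs_l2_eq_iff)
    (use assms square_integrable_reflect square_integrable_rep AE_unit_reflect[OF rep_abs_l2[OF assms]] in auto)

lemma reflect_l2_diff: "reflect_l2 (u - v) = reflect_l2 u - reflect_l2 v"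
proof -
  define f g where "f = rep_l2 u" and "g = rep_l2 v"
  have sq: "square_integrable f" "square_integrable g" by (simp_all add: f_def g_def square_integrable_rep)
  have uv: "u = abs_l2 f" "v = abs_l2 g" by (simp_all add: f_def g_def abs_rep_l2)
  show ?thesis
    unfolding uv abs_l2_diff[OF sq, symmetric] reflect_l2_abs[OF sq(1)] reflect_l2_abs[OF sq(2)]
      reflect_l2_abs[OF square_integrable_diff[OF sq]]
    by (rule abs_l2_diff) (intro square_integrable_reflect sq)+
qed

lemma norm_reflect_l2: "norm (reflect_l2 u) = norm u"
  unfolding reflect_l2_def norm_abs_l2_reflect[OF square_integrable_rep] abs_rep_l2 ..

definition zero_traces :: "(nat \<Rightarrow> real \<Rightarrow> complex) \<Rightarrow> bool" where
  "zero_traces Y \<longleftrightarrow> zero_trace 0 5 Y \<and> zero_trace 1 5 Y"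

lemma approx_reflect:
  assumes "approx zero_traces k E u"
  shows "approx zero_traces k E (reflect_l2 u)"
proof -
  have "approx zero_traces k (1 * E) (reflect_l2 u)"
  proof (rule approx_transform[OF assms])
    fix Y assume Y: "chain 5 Y" "zero_traces Y"
    have "reflect_chain Y 0 = (\<lambda>x. Y 0 (1 - x))" by (auto simp: reflect_chain_def)
    then have "abs_l2 (reflect_chain Y 0) = reflect_l2 (abs_l2 (Y 0))"
      using reflect_l2_abs[OF chain_sq[OF Y(1), of 0]] by simp
    then show "\<exists>Z. chain 5 Z \<and> zero_traces Z \<and> abs_l2 (Z 0) = reflect_l2 (abs_l2 (Y 0)) \<and> chain_norm 5 Z \<le> 1 * chain_norm 5 Y"
      using Y chain_reflect chain_norm_reflect zero_trace_reflect[of 0 5 Y] zero_trace_reflect[of 1 5 Y]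
      by (intro exI[of _ "reflect_chain Y"]) (auto simp: zero_traces_def)
  qed (auto simp: reflect_l2_diff norm_reflect_l2)
  then show ?thesis by simp
qed

section \<open>The polynomial partition of unity\<close>

definition bezout_chain :: "(nat \<Rightarrow> real \<Rightarrow> complex) \<Rightarrow> nat \<Rightarrow> real \<Rightarrow> complex" where
  "bezout_chain F m x = F m x + 5 * mul_affine 0 1 F m x + 15 * mul_affine 0 1 (mul_affine 0 1 F) m x
    + 35 * mul_affine 0 1 (mul_affine 0 1 (mul_affine 0 1 F)) m x
    + 70 * mul_affine 0 1 (mul_affine 0 1 (mul_affine 0 1 (mul_affine 0 1 F))) m x"

definition cutoff_chain :: "(nat \<Rightarrow> real \<Rightarrow> complex) \<Rightarrow> nat \<Rightarrow> real \<Rightarrow> complex" where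
  "cutoff_chain F = mul_affine 1 (-1) (mul_affine 1 (-1) (mul_affine 1 (-1) (mul_affine 1 (-1) (mul_affine 1 (-1) F))))"

lemma mul_affine_0: "mul_affine a b F 0 x = complex_of_real (a + b * x) * F 0 x"
  by (simp add: mul_affine_def)

text \<open>The identity behind \<open>bezout_op\<close>, now at the number x:
  \<open>bezout_chain\<close> multiplies by p(x), \<open>cutoff_chain\<close> by (1 - x)^5, and the
  reflected summand contributes x^5 p(1 - x).\<close>

lemma cutoff_partition:
  "cutoff_chain (bezout_chain F) 0 x + cutoff_chain (bezout_chain (reflect_chain F)) 0 (1 - x) = F 0 x"
proof -
  define X where "X = complex_of_real x"
  have "cutoff_chain (bezout_chain F) 0 x + cutoff_chain (bezout_chain (reflect_chain F)) 0 (1 - x)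
    = ((1 - X) ^ 5 * (1 + 5 * X + 15 * X ^ 2 + 35 * X ^ 3 + 70 * X ^ 4)
      + X ^ 5 * (1 + 5 * (1 - X) + 15 * (1 - X) ^ 2 + 35 * (1 - X) ^ 3 + 70 * (1 - X) ^ 4)) * F 0 x"
    unfolding cutoff_chain_def bezout_chain_def mul_affine_0 reflect_chain_def X_def
    by (simp add: algebra_simps eval_nat_numeral)
  also have "(1 - X) ^ 5 * (1 + 5 * X + 15 * X ^ 2 + 35 * X ^ 3 + 70 * X ^ 4)
      + X ^ 5 * (1 + 5 * (1 - X) + 15 * (1 - X) ^ 2 + 35 * (1 - X) ^ 3 + 70 * (1 - X) ^ 4) = 1"
    by algebra
  finally show ?thesis by simp
qed

lemma chain_bezout:
  assumes "chain k F" shows "chain k (bezout_chain F)"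
  unfolding bezout_chain_def[abs_def] by (intro chain_add chain_scale chain_mul_affine assms)

lemma chain_norm_mul_x:
  assumes "chain k F" "k \<le> 5"
  shows "chain_norm k (mul_affine 0 1 F) \<le> 36 * chain_norm k F"
    "chain_norm k (mul_affine 1 (-1) F) \<le> 36 * chain_norm k F"
proof -
  have "(real k + 1) * (real k + 1) \<le> 6 * 6" using assms(2) by (intro mult_mono) auto
  then have "(real k + 1) * (real k + 1) * chain_norm k F \<le> 36 * chain_norm k F"
    using chain_norm_nonneg by (intro mult_right_mono) auto
  then show "chain_norm k (mul_affine 0 1 F) \<le> 36 * chain_norm k F"
    "chain_norm k (mul_affine 1 (-1) F) \<le> 36 * chain_norm k F"
    using chain_norm_mul_affine[OF assms(1), of 0 1] chain_norm_mul_affine[OF assms(1), of 1 "-1"] by auto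
qed

lemma chain_norm_bezout:
  assumes F: "chain k F" and k: "k \<le> 5"
  shows "chain_norm k (bezout_chain F) \<le> 10 ^ 9 * chain_norm k F"
proof -
  define G1 where "G1 = mul_affine 0 1 F"
  define G2 where "G2 = mul_affine 0 1 G1"
  define G3 where "G3 = mul_affine 0 1 G2"
  define G4 where "G4 = mul_affine 0 1 G3"
  have c: "chain k G1" "chain k G2" "chain k G3" "chain k G4"
    by (simp_all add: G1_def G2_def G3_def G4_def F chain_mul_affine)
  have n: "chain_norm k G1 \<le> 36 * chain_norm k F" "chain_norm k G2 \<le> 36 * chain_norm k G1"
    "chain_norm k G3 \<le> 36 * chain_norm k G2" "chain_norm k G4 \<le> 36 * chain_norm k G3"
    unfolding G1_def G2_def G3_def G4_def
    by (intro chain_norm_mul_x k F c[unfolded G1_def G2_def G3_def G4_def])+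
  have "chain_norm k (bezout_chain F) \<le> chain_norm k F + chain_norm k (\<lambda>m x. 5 * G1 m x)
      + chain_norm k (\<lambda>m x. 15 * G2 m x) + chain_norm k (\<lambda>m x. 35 * G3 m x) + chain_norm k (\<lambda>m x. 70 * G4 m x)"
    unfolding bezout_chain_def[abs_def] G1_def[symmetric] G2_def[symmetric] G3_def[symmetric] G4_def[symmetric]
    by (intro order_trans[OF chain_norm_add] chain_add chain_scale c F add_mono order_refl)
  also have "\<dots> = chain_norm k F + 5 * chain_norm k G1 + 15 * chain_norm k G2 + 35 * chain_norm k G3 + 70 * chain_norm k G4"
    by (simp add: chain_norm_scale[OF c(1)] chain_norm_scale[OF c(2)] chain_norm_scale[OF c(3)] chain_norm_scale[OF c(4)])
  \<comment> \<open>Each multiplication by x costs 36; the largest term is 70 * 36^4, about 1.2 *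
    10^8.\<close>
  also have "\<dots> \<le> 10 ^ 9 * chain_norm k F"
    using n chain_norm_nonneg[of k F] by simp
  finally show ?thesis .
qed

lemma chain_cutoff: "chain k F \<Longrightarrow> chain k (cutoff_chain F)"
  unfolding cutoff_chain_def by (intro chain_mul_affine)

lemma chain_norm_cutoff:
  assumes F: "chain k F" and k: "k \<le> 5"
  shows "chain_norm k (cutoff_chain F) \<le> 36 ^ 5 * chain_norm k F"
proof -
  have step: "chain_norm k (mul_affine 1 (-1) G) \<le> 36 ^ Suc n * c" if "chain k G" "chain_norm k G \<le> 36 ^ n * c" for G n c
    using chain_norm_mul_x(2)[OF that(1) k] that(2) by simp
  show ?thesis
    using step[OF _ step[OF _ step[OF _ step[OF _ step[of F 0 "chain_norm k F"]]]]] F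
    unfolding cutoff_chain_def by (simp add: chain_mul_affine)
qed

text \<open>The five factors 1 - x create five vanishing traces at 1, starting from the empty
  condition, and keep those at 0.\<close>

lemma zero_trace_cutoff:
  assumes "zero_trace 0 5 F" shows "zero_traces (cutoff_chain F)"
proof -
  have "zero_trace 1 0 F" by (simp add: zero_trace_def)
  then have "zero_trace 1 (Suc (Suc (Suc (Suc (Suc 0))))) (cutoff_chain F)"
    unfolding cutoff_chain_def by (intro zero_trace_mul_affine_Suc) auto
  moreover have "zero_trace 0 5 (cutoff_chain F)"
    unfolding cutoff_chain_def by (intro zero_trace_mul_affine assms)
  ultimately show ?thesis by (simp add: zero_traces_def eval_nat_numeral)
qed

lemma zero_trace_bezout: "zero_trace c k F \<Longrightarrow> zero_trace c k (bezout_chain F)"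
  by (auto simp: zero_trace_def bezout_chain_def mul_affine_def)

lemma chain_norm_zero_trace:
  assumes "chain k Z" "zero_trace 0 k Z"
  shows "chain_norm k Z \<le> (real k + 1) * norm (abs_l2 (Z k))"
proof -
  have "norm (abs_l2 (Z (k - i))) \<le> norm (abs_l2 (Z k))" if "i \<le> k" for i
    using that
  proof (induction i)
    case (Suc i)
    have "ac (Z (k - Suc i)) (Z (Suc (k - Suc i)))" using Suc.prems by (intro chain_ac[OF assms(1)]) simp
    moreover have "Suc (k - Suc i) = k - i" using Suc.prems by simp
    ultimately have "norm (abs_l2 (Z (k - Suc i))) \<le> norm (abs_l2 (Z (k - i)))"
      using assms(2) Suc.prems ac_poincare[of "Z (k - Suc i)"] by (simp add: zero_trace_def)
    then show ?case using Suc by simp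
  qed simp
  then have "norm (abs_l2 (Z m)) \<le> norm (abs_l2 (Z k))" if "m \<le> k" for m
    using that by (metis diff_diff_cancel diff_le_self)
  then have "chain_norm k Z \<le> (\<Sum>m\<le>k. norm (abs_l2 (Z k)))"
    unfolding chain_norm_def by (intro sum_mono) auto
  then show ?thesis by (simp add: add.commute)
qed

text \<open>The smoothing acts on p(x) F, before the factor (1 - x)^5. The approximants V^5 z have
  zero traces at 0 but uncontrolled ones at 1, and the factor, applied to each approximant
  afterwards, annihilates these. Its size is at most 1, so the error in \<open>l2\<close> does not
  grow.\<close>

lemma approx_cutoff:
  assumes F: "chain k F" "zero_trace 0 k F" and k: "1 \<le> k" "k \<le> 4"
  shows "approx zero_traces k (10 ^ 30 * chain_norm k F) (abs_l2 (cutoff_chain (bezout_chain F) 0))"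
proof -
  define G where "G = bezout_chain F"
  have G: "chain k G" "zero_trace 0 k G"
    using F by (simp_all add: G_def chain_bezout zero_trace_bezout)
  define w where "w = abs_l2 (G k)"
  have V: "(volterra ^^ k) w = abs_l2 (G 0)" unfolding w_def by (rule chain_volterra[OF G])
  define e where "e j = norm (volterra_resolvent ((1/4) ^ j) (w - volterra_resolvent ((1/4) ^ j) w))" for j :: nat
  have "\<forall>j. \<exists>z. norm ((volterra ^^ k) w - (volterra ^^ 5) z) \<le> 126 * ((1/4) ^ j) ^ k * e j \<and>
      norm z \<le> 126 * (1 / (1/4) ^ j) ^ (5 - k) * e j"
    unfolding e_def by (intro allI volterra.smooth_approximant k) simp
  then obtain z where z: "\<And>j. norm ((volterra ^^ k) w - (volterra ^^ 5) (z j)) \<le> 126 * ((1/4) ^ j) ^ k * e j"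
      "\<And>j. norm (z j) \<le> 126 * (1 / (1/4) ^ j) ^ (5 - k) * e j" by metis
  have "\<forall>j. \<exists>Z. chain 5 Z \<and> zero_trace 0 5 Z \<and> abs_l2 (Z 5) = z j \<and> abs_l2 (Z 0) = (volterra ^^ 5) (z j)"
    by (intro allI volterra_chain)
  then obtain Z where Z: "\<And>j. chain 5 (Z j)" "\<And>j. zero_trace 0 5 (Z j)" "\<And>j. abs_l2 (Z j 5) = z j"
      "\<And>j. abs_l2 (Z j 0) = (volterra ^^ 5) (z j)" by metis
  \<comment> \<open>36^5 bounds the five multiplications by 1 - x, 6 comes from Poincare's
    inequality summed over the orders 0 to 5, and 126 from
    \<open>smooth_approximant\<close>.\<close>
  define M :: real where "M = 36 ^ 5 * 6 * 126"
  have e0: "0 \<le> e j" for j by (simp add: e_def)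
  show ?thesis
    unfolding G_def[symmetric]
  proof (rule approxI[where Y = "\<lambda>j. cutoff_chain (Z j)" and \<epsilon> = "\<lambda>j. M * e j"])
    fix j n
    show "chain 5 (cutoff_chain (Z j))" "zero_traces (cutoff_chain (Z j))"
      using Z chain_cutoff zero_trace_cutoff by auto
    have sq: "square_integrable (G 0)" "square_integrable (Z j 0)" using G(1) Z(1) chain_sq by auto
    have csq: "square_integrable (cutoff_chain G 0)" "square_integrable (cutoff_chain (Z j) 0)"
      by (rule chain_sq[OF chain_cutoff[OF G(1)]], simp) (rule chain_sq[OF chain_cutoff[OF Z(1)]], simp)
    have "norm (abs_l2 (cutoff_chain G 0) - abs_l2 (cutoff_chain (Z j) 0))
        = norm (abs_l2 (\<lambda>x. cutoff_chain G 0 x - cutoff_chain (Z j) 0 x))"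
      by (simp add: abs_l2_diff[OF csq])
    also have "\<dots> \<le> 1 * norm (abs_l2 (\<lambda>x. G 0 x - Z j 0 x))"
    proof (rule norm_abs_l2_mono)
      fix x :: real assume x: "x \<in> {0..1}"
      have "cutoff_chain G 0 x - cutoff_chain (Z j) 0 x = complex_of_real ((1 - x) ^ 5) * (G 0 x - Z j 0 x)"
        by (simp add: cutoff_chain_def mul_affine_0 eval_nat_numeral algebra_simps)
      then have "cmod (cutoff_chain G 0 x - cutoff_chain (Z j) 0 x) = (1 - x) ^ 5 * cmod (G 0 x - Z j 0 x)"
        using x by (simp only: norm_mult norm_of_real) simp
      also have "\<dots> \<le> 1 * cmod (G 0 x - Z j 0 x)"
        using x by (intro mult_right_mono power_le_one) auto
      finally show "cmod (cutoff_chain G 0 x - cutoff_chain (Z j) 0 x) \<le> 1 * cmod (G 0 x - Z j 0 x)" .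
    qed (use sq csq square_integrable_diff in auto)
    also have "\<dots> \<le> 126 * ((1/4) ^ j) ^ k * e j"
      using z(1)[of j] V Z(4) by (simp add: abs_l2_diff[OF sq])
    also have "\<dots> = ((1/4) ^ j) ^ k * (126 * e j)" by simp
    also have "\<dots> \<le> ((1/4) ^ j) ^ k * (M * e j)"
      using e0 by (intro mult_left_mono mult_right_mono) (auto simp: M_def)
    finally show "norm (abs_l2 (cutoff_chain G 0) - abs_l2 (cutoff_chain (Z j) 0)) \<le> ((1/4) ^ j) ^ k * (M * e j)" .
    have "chain_norm 5 (cutoff_chain (Z j)) \<le> 36 ^ 5 * (6 * norm (z j))"
      using chain_norm_cutoff[OF Z(1), of j] chain_norm_zero_trace[OF Z(1) Z(2), of j] by (simp add: Z(3))
    also have "\<dots> \<le> 36 ^ 5 * (6 * (126 * (1 / (1/4) ^ j) ^ (5 - k) * e j))"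
      by (intro mult_left_mono z(2)) auto
    also have "\<dots> = (1 / (1/4) ^ j) ^ (5 - k) * (M * e j)" by (simp add: M_def)
    finally have "((1/4) ^ j) ^ (5 - k) * chain_norm 5 (cutoff_chain (Z j))
        \<le> ((1/4) ^ j) ^ (5 - k) * ((1 / (1/4) ^ j) ^ (5 - k) * (M * e j))"
      by (intro mult_left_mono) auto
    also have "\<dots> = (((1/4) ^ j) * (1 / (1/4) ^ j)) ^ (5 - k) * (M * e j)" by (simp only: power_mult_distrib mult.assoc)
    also have "\<dots> = M * e j" by simp
    finally show "((1/4) ^ j) ^ (5 - k) * chain_norm 5 (cutoff_chain (Z j)) \<le> M * e j" .
    have "(\<Sum>j<n. (M * e j)\<^sup>2) = M\<^sup>2 * (\<Sum>j<n. (e j)\<^sup>2)" by (simp add: power_mult_distrib sum_distrib_left)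
    also have "\<dots> \<le> M\<^sup>2 * (2 * (norm w)\<^sup>2)"
      unfolding e_def by (intro mult_left_mono volterra.square_function) auto
    also have "\<dots> \<le> (2 * M * norm w)\<^sup>2" by (simp add: power_mult_distrib)
    also have "\<dots> \<le> (10 ^ 30 * chain_norm k F)\<^sup>2"
    proof (rule power_mono)
      have "norm w \<le> 10 ^ 9 * chain_norm k F"
        using norm_le_chain_norm[of k k G] chain_norm_bezout[OF F(1)] k by (simp add: w_def G_def)
      then show "2 * M * norm w \<le> 10 ^ 30 * chain_norm k F"
        using chain_norm_nonneg[of k F] by (simp add: M_def)
    qed (simp add: M_def)
    finally show "(\<Sum>j<n. (M * e j)\<^sup>2) \<le> (10 ^ 30 * chain_norm k F)\<^sup>2" .
  qed
qed

theorem approx_zero_traces: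
  assumes F: "chain k F" "zero_trace 0 k F" "zero_trace 1 k F" and k: "1 \<le> k" "k \<le> 4"
  shows "approx zero_traces k (4 * 10 ^ 30 * chain_norm k F) (abs_l2 (F 0))"
proof -
  define L R where "L = cutoff_chain (bezout_chain F) 0" and "R = cutoff_chain (bezout_chain (reflect_chain F)) 0"
  have rF: "chain k (reflect_chain F)" "zero_trace 0 k (reflect_chain F)"
    using F chain_reflect zero_trace_reflect[of 0 k F] by auto
  have sq: "square_integrable L" "square_integrable R"
    unfolding L_def R_def by (rule chain_sq[OF chain_cutoff[OF chain_bezout[OF F(1)]]], simp)
      (rule chain_sq[OF chain_cutoff[OF chain_bezout[OF rF(1)]]], simp)
  have "approx zero_traces k (10 ^ 30 * chain_norm k F) (abs_l2 L)"
    unfolding L_def by (rule approx_cutoff[OF F(1,2) k])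
  moreover have "approx zero_traces k (10 ^ 30 * chain_norm k F) (reflect_l2 (abs_l2 R))"
    using approx_reflect[OF approx_cutoff[OF rF k]] by (simp add: chain_norm_reflect[OF F(1)] R_def)
  ultimately have "approx zero_traces k (2 * (10 ^ 30 * chain_norm k F + 10 ^ 30 * chain_norm k F)) (abs_l2 L + reflect_l2 (abs_l2 R))"
    by (rule approx_add) (auto simp: zero_traces_def zero_trace_def chain_norm_nonneg)
  moreover have "abs_l2 L + reflect_l2 (abs_l2 R) = abs_l2 (F 0)"
  proof -
    have "F 0 = (\<lambda>x. L x + R (1 - x))" unfolding L_def R_def by (auto simp: cutoff_partition)
    then show ?thesis
      using abs_l2_add[OF sq(1) square_integrable_reflect[OF sq(2)]] reflect_l2_abs[OF sq(2)] by simp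
  qed
  ultimately show ?thesis by simp
qed

section \<open>Test functions\<close>

text \<open>The powers in the denominator close the family under differentiation up to linear
  combinations, so smoothness needs no estimate of the higher derivatives of exp(-1/x).\<close>

definition flat :: "nat \<Rightarrow> real \<Rightarrow> real" where
  "flat i x = (if 0 < x then exp (- 1 / x) / x ^ i else 0)"

lemma flat_div_tendsto_0: "((\<lambda>h. flat i h / h) \<longlongrightarrow> 0) (at 0)"
proof (rule filterlim_split_at_real)
  have "\<forall>\<^sub>F h in at_left 0. flat i h / h = 0"
    by (auto simp: flat_def eventually_at_left_field intro!: exI[of _ "-1"])
  then show "((\<lambda>h. flat i h / h) \<longlongrightarrow> 0) (at_left 0)" by (rule tendsto_eventually)
  have "((\<lambda>h. inverse h ^ Suc i / exp (inverse h)) \<longlongrightarrow> (0::real)) (at_right 0)"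
    by (rule filterlim_compose[OF tendsto_power_div_exp_0 filterlim_inverse_at_top_right])
  moreover have "\<forall>\<^sub>F h in at_right 0. inverse h ^ Suc i / exp (inverse h) = flat i h / h"
    by (auto simp: flat_def eventually_at_right_field exp_minus field_simps intro!: exI[of _ 1])
  ultimately show "((\<lambda>h. flat i h / h) \<longlongrightarrow> 0) (at_right 0)"
    by (rule Lim_transform_eventually)
qed

lemma flat_deriv: "(flat i has_real_derivative (flat (i + 2) x - real i * flat (i + 1) x)) (at x)"
proof -
  consider "x < 0" | "x = 0" | "0 < x" by linarith
  then show ?thesis
  proof cases
    case 1
    have "((\<lambda>x. 0) has_real_derivative 0) (at x)" by simp
    then have "(flat i has_real_derivative 0) (at x)"
      by (rule DERIV_cong_ev[THEN iffD1, rotated -1])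
        (use 1 in \<open>auto simp: flat_def eventually_nhds intro!: exI[of _ "{..<0}"]\<close>)
    then show ?thesis using 1 by (simp add: flat_def)
  next
    case 2
    show ?thesis
      using flat_div_tendsto_0[of i] unfolding 2 DERIV_def by (simp add: flat_def)
  next
    case 3
    have "((\<lambda>x. exp (- 1 / x) / x ^ i) has_real_derivative (flat (i + 2) x - real i * flat (i + 1) x)) (at x)"
    proof -
      have "((\<lambda>x. exp (- 1 / x)) has_real_derivative exp (- 1 / x) / x\<^sup>2) (at x)"
        using 3 by (auto intro!: derivative_eq_intros simp: power2_eq_square)
      from DERIV_divide[OF this DERIV_pow[of i x]] 3
      have "((\<lambda>x. exp (- 1 / x) / x ^ i) has_real_derivative
          (exp (- 1 / x) / x\<^sup>2 * x ^ i - exp (- 1 / x) * (real i * x ^ (i - Suc 0))) / (x ^ i * x ^ i)) (at x)" by simp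
      moreover have "(exp (- 1 / x) / x\<^sup>2 * x ^ i - exp (- 1 / x) * (real i * x ^ (i - Suc 0))) / (x ^ i * x ^ i)
          = flat (i + 2) x - real i * flat (i + 1) x"
        using 3 by (cases i) (auto simp: flat_def field_simps power2_eq_square)
      ultimately show ?thesis by simp
    qed
    then show ?thesis
      by (rule DERIV_cong_ev[THEN iffD1, rotated -1])
        (use 3 in \<open>auto simp: flat_def eventually_nhds intro!: exI[of _ "{0<..}"]\<close>)
  qed
qed

text \<open>The least family that contains the products of two \<open>flat\<close> factors and is
  closed under sums is also closed under differentiation. For c = 1 and i = j = 0, letting n tend to
  infinity yields the indicator of the open interval (a, b).\<close>

inductive bump :: "real \<Rightarrow> real \<Rightarrow> real \<Rightarrow> (real \<Rightarrow> real) \<Rightarrow> bool" for a b n where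
  bump_base: "bump a b n (\<lambda>x. c * (flat i (n * (x - a)) * flat j (n * (b - x))))"
| bump_add: "bump a b n f \<Longrightarrow> bump a b n g \<Longrightarrow> bump a b n (\<lambda>x. f x + g x)"

lemma bump_deriv:
  assumes "bump a b n f"
  shows "\<exists>f'. bump a b n f' \<and> (\<forall>x. (f has_real_derivative f' x) (at x))"
  using assms
proof induction
  case (bump_base c i j)
  define T where "T i j = (\<lambda>x. flat i (n * (x - a)) * flat j (n * (b - x)))" for i j
  define f' where "f' x = (c * n) * T (i + 2) j x + ((- c * n * real i) * T (i + 1) j x
      + ((- c * n) * T i (j + 2) x + (c * n * real j) * T i (j + 1) x))" for x
  have "bump a b n f'"
    unfolding f'_def T_def by (intro bump.intros)
  moreover have "((\<lambda>x. c * (flat i (n * (x - a)) * flat j (n * (b - x)))) has_real_derivative f' x) (at x)" for x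
    by (rule derivative_eq_intros DERIV_chain2[OF flat_deriv] refl)+
      (simp add: f'_def T_def algebra_simps)
  ultimately show ?case by blast
next
  case (bump_add f g)
  then obtain f' g' where "bump a b n f'" "\<forall>x. (f has_real_derivative f' x) (at x)"
    "bump a b n g'" "\<forall>x. (g has_real_derivative g' x) (at x)" by blast
  then show ?case
    by (intro exI[of _ "\<lambda>x. f' x + g' x"]) (auto intro!: bump.bump_add derivative_intros)
qed

lemma bump_iterated_deriv: "bump a b n f \<Longrightarrow> bump a b n ((deriv ^^ m) f)"
proof (induction m)
  case (Suc m)
  then obtain f' where f': "bump a b n f'" "\<forall>x. ((deriv ^^ m) f has_real_derivative f' x) (at x)"
    using bump_deriv by blast
  then have "deriv ((deriv ^^ m) f) = f'" by (auto intro: DERIV_imp_deriv)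
  then show ?case using f' by simp
qed simp

lemma bump_zero:
  assumes "bump a b n f" "0 < n" "x \<notin> {a<..<b}" shows "f x = 0"
  using assms by induction (auto simp: flat_def zero_less_mult_iff)

lemma test_function_bump:
  assumes "0 < a" "a \<le> b" "b < 1" "0 < n" "bump a b n f"
  shows "test_function f"
  unfolding test_function_def
proof (intro conjI allI)
  fix m x
  show "(deriv ^^ m) f differentiable at x"
    using bump_deriv[OF bump_iterated_deriv[OF assms(5)]] by (meson real_differentiable_def)
  show "\<exists>K. compact K \<and> K \<subseteq> {0<..<1} \<and> (\<forall>x. x \<notin> K \<longrightarrow> f x = 0)"
    by (rule exI[of _ "{a..b}"]) (use assms bump_zero[OF assms(5,4)] in auto)
qed

lemma test_function_deriv:
  assumes "test_function \<phi>" shows "test_function (deriv \<phi>)"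
proof -
  have s: "(deriv ^^ n) \<phi> differentiable at x" for n x using assms by (simp add: test_function_def)
  obtain K where K: "compact K" "K \<subseteq> {0<..<1}" "\<And>x. x \<notin> K \<Longrightarrow> \<phi> x = 0"
    using assms by (auto simp: test_function_def)
  have "deriv \<phi> x = 0" if "x \<notin> K" for x
  proof -
    have "((\<lambda>x. 0) has_real_derivative 0) (at x)" by simp
    then have "(\<phi> has_real_derivative 0) (at x)"
      by (rule DERIV_cong_ev[THEN iffD1, rotated -1])
        (use K that compact_imp_closed[OF K(1)] in \<open>auto simp: eventually_nhds intro!: exI[of _ "- K"]\<close>)
    then show ?thesis by (rule DERIV_imp_deriv)
  qed
  moreover have "(deriv ^^ n) (deriv \<phi>) differentiable at x" for n x
    using s[of "Suc n" x] by (simp add: funpow_swap1)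
  ultimately show ?thesis using K unfolding test_function_def by blast
qed

lemma test_function_DERIV:
  "test_function \<phi> \<Longrightarrow> (\<phi> has_real_derivative deriv \<phi> x) (at x)"
  using DERIV_deriv_iff_real_differentiable[of \<phi> x]
  unfolding test_function_def by (metis funpow_0)

lemma test_function_continuous: "test_function \<phi> \<Longrightarrow> continuous_on S \<phi>"
  by (meson DERIV_isCont continuous_at_imp_continuous_on test_function_DERIV)

lemma test_function_support:
  assumes "test_function \<phi>"
  obtains c d where "0 < c" "c \<le> d" "d < 1" "\<And>x. x \<notin> {c..d} \<Longrightarrow> \<phi> x = 0"
proof -
  obtain K where K: "compact K" "K \<subseteq> {0<..<1}" "\<And>x. x \<notin> K \<Longrightarrow> \<phi> x = 0"
    using assms by (auto simp: test_function_def)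
  show thesis
  proof (cases "K = {}")
    case True then show ?thesis using K by (intro that[of "1/2" "1/2"]) auto
  next
    case False
    obtain c d where "c \<in> K" "d \<in> K" "\<forall>x\<in>K. c \<le> x" "\<forall>x\<in>K. x \<le> d"
      using compact_attains_inf[OF K(1) False] compact_attains_sup[OF K(1) False] by blast
    then show ?thesis using K by (intro that[of c d]) (auto simp: subset_eq)
  qed
qed

lemma test_function_0: "test_function \<phi> \<Longrightarrow> x \<notin> {0<..<1} \<Longrightarrow> \<phi> x = 0"
  unfolding test_function_def by blast

lemma test_function_ac:
  assumes "test_function \<phi>"
  shows "ac (\<lambda>x. complex_of_real (\<phi> x)) (\<lambda>x. complex_of_real (deriv \<phi> x))"
proof (rule ac_C1)
  show "continuous_on {0..1} (\<lambda>x. complex_of_real (deriv \<phi> x))"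
    by (intro continuous_on_of_real test_function_continuous test_function_deriv assms)
  fix x :: real
  have "(\<phi> has_vector_derivative deriv \<phi> x) (at x within {0..1})"
    using has_field_derivative_at_within[OF test_function_DERIV[OF assms]]
    by (simp add: has_real_derivative_iff_has_vector_derivative)
  then show "((\<lambda>x. complex_of_real (\<phi> x)) has_vector_derivative complex_of_real (deriv \<phi> x)) (at x within {0..1})"
    by (rule bounded_linear.has_vector_derivative[OF bounded_linear_of_real])
qed

lemma iterated_deriv_diff_scale:
  fixes f g :: "real \<Rightarrow> real"
  assumes "\<And>n x. (deriv ^^ n) f differentiable (at x)" "\<And>n x. (deriv ^^ n) g differentiable (at x)"
  shows "(deriv ^^ n) (\<lambda>x. f x - c * g x) = (\<lambda>x. (deriv ^^ n) f x - c * (deriv ^^ n) g x)"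
proof (induction n)
  case (Suc n)
  have "deriv (\<lambda>x. (deriv ^^ n) f x - c * (deriv ^^ n) g x) x = deriv ((deriv ^^ n) f) x - c * deriv ((deriv ^^ n) g) x" for x
    using assms[of n x] by (intro DERIV_imp_deriv DERIV_diff DERIV_cmult)
      (auto simp: DERIV_deriv_iff_real_differentiable)
  then show ?case using Suc by auto
qed simp

lemma test_function_diff_scale:
  assumes "test_function f" "test_function g"
  shows "test_function (\<lambda>x. f x - c * g x)"
proof -
  have d: "(deriv ^^ n) f differentiable (at x)" "(deriv ^^ n) g differentiable (at x)" for n x
    using assms by (auto simp: test_function_def)
  obtain K L where "compact K" "K \<subseteq> {0<..<1}" "\<And>x. x \<notin> K \<Longrightarrow> f x = 0"
     "compact L" "L \<subseteq> {0<..<1}" "\<And>x. x \<notin> L \<Longrightarrow> g x = 0"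
    using assms unfolding test_function_def by metis
  then have "\<exists>K. compact K \<and> K \<subseteq> {0<..<1} \<and> (\<forall>x. x \<notin> K \<longrightarrow> f x - c * g x = 0)"
    by (intro exI[of _ "K \<union> L"]) auto
  moreover have "(deriv ^^ n) (\<lambda>x. f x - c * g x) differentiable (at x)" for n x
    unfolding iterated_deriv_diff_scale[OF d] using d by (intro derivative_intros) auto
  ultimately show ?thesis by (simp add: test_function_def)
qed

text \<open>Mean zero makes the primitive vanish to the right of the support as well as to the
  left.\<close>

lemma test_function_antiderivative:
  assumes psi: "test_function \<psi>" and int0: "integral {0..1} \<psi> = 0"
  shows "\<exists>\<phi>. test_function \<phi> \<and> deriv \<phi> = \<psi>"
proof -
  obtain c d where cd: "0 < c" "c \<le> d" "d < 1" "\<And>x. x \<notin> {c..d} \<Longrightarrow> \<psi> x = 0"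
    using test_function_support[OF psi] by blast
  define \<phi> where "\<phi> x = integral {-1..x} \<psi>" for x
  have I: "\<psi> integrable_on {a..b}" for a b
    using integrable_continuous_real test_function_continuous[OF psi] by blast
  have z: "integral {a..b} \<psi> = 0" if "b < c \<or> d < a" for a b
  proof -
    have "integral {a..b} \<psi> = integral {a..b} (\<lambda>x. 0)"
      by (rule Henstock_Kurzweil_Integration.integral_cong) (use that cd in auto)
    then show ?thesis by simp
  qed
  have left: "\<phi> x = 0" if "x < c" for x unfolding \<phi>_def using that by (intro z) auto
  have right: "\<phi> x = 0" if "d < x" for x
  proof -
    have 1: "integral {-1..0} \<psi> + integral {0..1} \<psi> = integral {-1..1} \<psi>"
      by (rule Henstock_Kurzweil_Integration.integral_combine) (auto intro: I)
    have "integral {-1..0} \<psi> = 0" using cd by (intro z) auto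
    with 1 int0 have "integral {-1..1} \<psi> = 0" by simp
    moreover have "integral {-1..min x 1} \<psi> + integral {min x 1..max x 1} \<psi> = integral {-1..max x 1} \<psi>"
      by (rule Henstock_Kurzweil_Integration.integral_combine) (use that cd in \<open>auto intro: I\<close>)
    moreover have "integral {min x 1..max x 1} \<psi> = 0" using that cd by (intro z) auto
    ultimately show ?thesis by (cases "x \<le> 1") (auto simp: \<phi>_def min_def max_def split: if_splits)
  qed
  have D: "(\<phi> has_real_derivative \<psi> x) (at x)" for x
  proof (cases "x < c")
    case True
    have "((\<lambda>x. 0) has_real_derivative 0) (at x)" by simp
    then have "(\<phi> has_real_derivative 0) (at x)"
      by (rule DERIV_cong_ev[THEN iffD1, rotated -1])
        (use True left in \<open>auto simp: eventually_nhds intro!: exI[of _ "{..<c}"]\<close>)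
    then show ?thesis using cd(4)[of x] True by simp
  next
    case False
    have "(\<phi> has_real_derivative \<psi> x) (at x within {-1..x+1})"
      unfolding \<phi>_def
      by (rule integral_has_real_derivative) (use False cd test_function_continuous[OF psi] in auto)
    moreover have "at x within {-1..x+1} = at x" by (rule at_within_interior) (use False cd in auto)
    ultimately show ?thesis by simp
  qed
  then have deriv: "deriv \<phi> = \<psi>" by (auto intro: DERIV_imp_deriv)
  have "(deriv ^^ n) \<phi> differentiable (at x)" for n x
  proof (cases n)
    case 0 then show ?thesis using D real_differentiable_def by auto
  next
    case (Suc m)
    have "(deriv ^^ n) \<phi> = (deriv ^^ m) \<psi>" unfolding Suc deriv[symmetric] by (simp add: funpow_swap1)
    then show ?thesis using psi by (simp add: test_function_def)
  qed
  moreover have "\<exists>K. compact K \<and> K \<subseteq> {0<..<1} \<and> (\<forall>x. x \<notin> K \<longrightarrow> \<phi> x = 0)"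
    using cd left right by (intro exI[of _ "{c..d}"]) (auto simp: not_le)
  ultimately show ?thesis using deriv by (auto simp: test_function_def)
qed

text \<open>On short intervals \<open>h\<close> is replaced by its value at the left end, whose
  contribution vanishes; what remains is a small multiple of the integral of |v|.\<close>

lemma integral_mult_continuous_eq_0:
  assumes v: "square_integrable v" and V: "\<And>x. x \<in> {0..1} \<Longrightarrow> integral {0..x} v = 0"
    and h: "continuous_on {0..1} h"
  shows "integral {0..1} (\<lambda>x. v x * h x) = 0"
proof -
  define F where "F x = integral {0..x} (\<lambda>x. v x * h x)" for x
  define \<mu> where "\<mu> x = integral {0..x} (\<lambda>x. cmod (v x))" for x
  have vh: "square_integrable (\<lambda>x. v x * h x)"
    using square_integrable_mult_continuous[OF h v] by (simp add: mult.commute)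
  have "cmod (F 1 - F 0) \<le> \<epsilon> * (\<mu> 1 - \<mu> 0)" if e: "0 < \<epsilon>" for \<epsilon>
  proof -
    have "uniformly_continuous_on {0..1} h" using h by (auto intro: compact_uniformly_continuous)
    then obtain \<delta> where d: "0 < \<delta>" "\<And>s t. s \<in> {0..1} \<Longrightarrow> t \<in> {0..1} \<Longrightarrow> dist t s < \<delta> \<Longrightarrow> dist (h t) (h s) < \<epsilon>"
      using e unfolding uniformly_continuous_on_def by blast
    show ?thesis
    proof (rule increment_bound_global[OF d(1)])
      fix x y :: real assume xy: "0 \<le> x" "x \<le> y" "y \<le> 1" "y - x < \<delta>"
      have "integral {0..x} v + integral {x..y} v = integral {0..y} v"
        by (rule Henstock_Kurzweil_Integration.integral_combine)
          (use xy square_integrable_integrable_on[OF v] in auto)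
      then have v0: "integral {x..y} v = 0" using V xy by simp
      have "F y - F x = integral {x..y} (\<lambda>t. v t * h t)"
        unfolding F_def using Henstock_Kurzweil_Integration.integral_combine[of 0 x y "\<lambda>t. v t * h t"]
          square_integrable_integrable_on[OF vh, of 0 y] xy by (simp add: algebra_simps)
      also have "\<dots> = integral {x..y} (\<lambda>t. v t * h t) - integral {x..y} v * h x" by (simp add: v0)
      also have "\<dots> = integral {x..y} (\<lambda>t. v t * h t - v t * h x)"
        using square_integrable_integrable_on[OF vh, of x y] square_integrable_integrable_on[OF v, of x y] xy
        by (simp add: Henstock_Kurzweil_Integration.integral_diff integrable_on_mult_left)
      also have "cmod \<dots> \<le> integral {x..y} (\<lambda>t. \<epsilon> * cmod (v t))"
      proof (rule integral_norm_bound_integral)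
        show "(\<lambda>t. v t * h t - v t * h x) integrable_on {x..y}"
          using square_integrable_integrable_on[OF vh, of x y] square_integrable_integrable_on[OF v, of x y] xy
          by (auto intro!: Henstock_Kurzweil_Integration.integrable_diff integrable_on_mult_left)
        show "(\<lambda>t. \<epsilon> * cmod (v t)) integrable_on {x..y}"
          using integrable_on_cmult_left[OF square_integrable_norm_integrable_on[OF v, of x y], of \<epsilon>] xy by simp
        fix t assume t: "t \<in> {x..y}"
        have "cmod (h t - h x) \<le> \<epsilon>" using d(2)[of x t] xy t by (auto simp: dist_norm less_imp_le)
        then have "cmod (v t) * cmod (h t - h x) \<le> cmod (v t) * \<epsilon>" by (intro mult_left_mono) auto
        moreover have "v t * h t - v t * h x = v t * (h t - h x)" by (simp add: algebra_simps)
        ultimately show "cmod (v t * h t - v t * h x) \<le> \<epsilon> * cmod (v t)" by (simp add: norm_mult mult.commute)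
      qed
      also have "\<dots> = \<epsilon> * integral {x..y} (\<lambda>t. cmod (v t))" by simp
      also have "integral {x..y} (\<lambda>t. cmod (v t)) = \<mu> y - \<mu> x"
        unfolding \<mu>_def using Henstock_Kurzweil_Integration.integral_combine[of 0 x y "\<lambda>t. cmod (v t)"]
          square_integrable_norm_integrable_on[OF v, of 0 y] xy by simp
      finally show "cmod (F y - F x) \<le> \<epsilon> * (\<mu> y - \<mu> x)" .
    qed auto
  qed
  note b = this
  have mu: "0 \<le> \<mu> 1 - \<mu> 0"
    using square_integrable_norm_integrable_on[OF v, of 0 1]
    by (auto simp: \<mu>_def intro!: Henstock_Kurzweil_Integration.integral_nonneg)
  have "cmod (F 1 - F 0) \<le> \<epsilon>" if "0 < \<epsilon>" for \<epsilon>
  proof -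
    have "cmod (F 1 - F 0) \<le> \<epsilon> / (\<mu> 1 - \<mu> 0 + 1) * (\<mu> 1 - \<mu> 0)" using mu that by (intro b) auto
    also have "\<dots> \<le> \<epsilon>" using mu that by (simp add: divide_simps)
    finally show ?thesis .
  qed
  then have "cmod (F 1 - F 0) \<le> 0" by (rule field_le_epsilon[of _ 0, simplified])
  then show ?thesis by (simp add: F_def)
qed

lemma AE_unit_iff_negligible:
  assumes "negligible N" "\<And>x. x \<in> {0<..<1} \<Longrightarrow> x \<notin> N \<Longrightarrow> P x"
  shows "AE x in unit_measure. P x"
proof -
  have "AE x in lebesgue. x \<notin> N" using assms(1) by (intro AE_not_in) (simp add: negligible_iff_null_sets)
  then have "AE x in lebesgue. x \<in> {0<..<1} \<longrightarrow> P x"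
    by eventually_elim (use assms(2) in auto)
  then show ?thesis by (subst AE_restrict_space_iff) auto
qed

text \<open>The function \<open>v\<close> is tested against \<open>w\<close>, its conjugate divided
  by 1 + |v|: then v w is nonnegative and vanishes only where \<open>v\<close> does. Being bounded
  and measurable, \<open>w\<close> is an almost everywhere limit of bounded continuous functions, to
  which \<open>integral_mult_continuous_eq_0\<close> applies.\<close>

lemma prim_zero_imp_zero:
  assumes v: "square_integrable v" and V: "\<And>x. x \<in> {0..1} \<Longrightarrow> integral {0..x} v = 0"
  shows "AE x in unit_measure. v x = 0"
proof -
  define w where "w x = cnj (v x) / complex_of_real (1 + cmod (v x))" for x
  have wb: "cmod (w x) \<le> 1" for x
  proof -
    have "0 < 1 + cmod (v x)" by (simp add: add_pos_nonneg)
    then show ?thesis by (simp add: w_def norm_divide divide_le_eq del: of_real_add)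
  qed
  have mv: "v \<in> borel_measurable unit_measure" using v by (simp add: square_integrable_def)
  have mcnj: "(\<lambda>x. cnj (v x)) \<in> borel_measurable unit_measure"
    using square_integrable_cnj[OF v] by (simp add: square_integrable_def)
  have mden: "(\<lambda>x. complex_of_real (1 + cmod (v x))) \<in> borel_measurable unit_measure"
    using mv by (auto intro!: measurable_compose[OF _ borel_measurable_continuous_onI[OF continuous_on_of_real[OF continuous_on_id]]])
  have mw: "w \<in> borel_measurable unit_measure"
    unfolding w_def by (rule borel_measurable_divide[OF mcnj mden])
  then have "w measurable_on {0<..<1}" by (subst measurable_on_iff_borel_measurable) auto
  then obtain N g where N: "negligible N" and g: "\<And>n. continuous_on UNIV (g n)"
    and lim: "\<And>x. x \<notin> N \<Longrightarrow> (\<lambda>n. g n x) \<longlonglongrightarrow> (if x \<in> {0<..<1} then w x else 0)"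
    unfolding measurable_on_def by metis
  \<comment> \<open>The truncation gives |h| \<le> 1, so that |v| dominates the integrands, and it
    leaves the limit unchanged because |w| \<le> 1.\<close>
  define h where "h n x = g n x / complex_of_real (max 1 (cmod (g n x)))" for n :: nat and x
  have hc: "continuous_on {0..1} (h n)" for n
    unfolding h_def using continuous_on_subset[OF g[of n], of "{0..1}"]
    by (intro continuous_intros) (auto simp: max_def)
  have hb: "cmod (h n x) \<le> 1" for n x by (simp add: h_def norm_divide divide_le_eq)
  have mvh: "(\<lambda>x. v x * h n x) \<in> borel_measurable unit_measure" for n
    using measurable_unit_continuous[OF hc[of n]] mv by (intro borel_measurable_times)
  have "(\<lambda>n. LINT x|unit_measure. v x * h n x) \<longlonglongrightarrow> (LINT x|unit_measure. v x * w x)"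
  proof (rule integral_dominated_convergence)
    show "(\<lambda>x. v x * w x) \<in> borel_measurable unit_measure" by (intro borel_measurable_times mv mw)
    show "integrable unit_measure (\<lambda>x. cmod (v x))"
      using square_integrable_imp_integrable[OF v] by simp
    show "AE x in unit_measure. (\<lambda>n. v x * h n x) \<longlonglongrightarrow> v x * w x"
    proof (rule AE_unit_iff_negligible[OF N])
      fix x :: real assume x: "x \<in> {0<..<1}" "x \<notin> N"
      have "(\<lambda>n. h n x) \<longlonglongrightarrow> w x / complex_of_real (max 1 (cmod (w x)))"
        unfolding h_def using lim[OF x(2)] x(1) by (intro tendsto_intros) auto
      moreover have "max 1 (cmod (w x)) = 1" using wb[of x] by simp
      ultimately show "(\<lambda>n. v x * h n x) \<longlonglongrightarrow> v x * w x" by (intro tendsto_intros) simp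
    qed
    show "AE x in unit_measure. cmod (v x * h n x) \<le> cmod (v x)" for n
      by (rule AE_unitI) (use hb in \<open>auto simp: norm_mult intro: mult_left_le\<close>)
  qed (rule mvh)
  moreover have "(LINT x|unit_measure. v x * h n x) = 0" for n
  proof -
    have "square_integrable (\<lambda>x. v x * h n x)"
      using square_integrable_mult_continuous[OF hc[of n] v] by (simp add: mult.commute)
    then show ?thesis
      using integral_unit_eq[OF square_integrable_imp_integrable] integral_mult_continuous_eq_0[OF v V hc] by simp
  qed
  ultimately have 0: "(LINT x|unit_measure. v x * w x) = 0" by (simp add: LIMSEQ_const_iff)
  have vw: "v x * w x = complex_of_real ((cmod (v x))\<^sup>2 / (1 + cmod (v x)))" for x
    using complex_norm_square[of "v x"] by (simp add: w_def)
  have "(LINT x|unit_measure. (cmod (v x))\<^sup>2 / (1 + cmod (v x))) = 0"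
    using 0 unfolding vw by (simp only: integral_complex_of_real of_real_eq_0_iff)
  moreover have "integrable unit_measure (\<lambda>x. (cmod (v x))\<^sup>2 / (1 + cmod (v x)))"
  proof (rule Bochner_Integration.integrable_bound)
    show "integrable unit_measure (\<lambda>x. cmod (v x))" using square_integrable_imp_integrable[OF v] by simp
    show "(\<lambda>x. (cmod (v x))\<^sup>2 / (1 + cmod (v x))) \<in> borel_measurable unit_measure" using mv by measurable
    show "AE x in unit_measure. norm ((cmod (v x))\<^sup>2 / (1 + cmod (v x))) \<le> norm (cmod (v x))"
    proof (rule AE_I2)
      fix x
      have "(cmod (v x))\<^sup>2 \<le> cmod (v x) * (1 + cmod (v x))" by (simp add: power2_eq_square algebra_simps)
      moreover have "0 < 1 + cmod (v x)" by (simp add: add_pos_nonneg)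
      ultimately show "norm ((cmod (v x))\<^sup>2 / (1 + cmod (v x))) \<le> norm (cmod (v x))"
        by (simp add: divide_le_eq)
    qed
  qed
  ultimately have "AE x in unit_measure. (cmod (v x))\<^sup>2 / (1 + cmod (v x)) = 0"
    by (subst (asm) integral_nonneg_eq_0_iff_AE) auto
  then show ?thesis by eventually_elim (auto simp: add_nonneg_eq_0_iff)
qed

text \<open>Bumps tending to the indicator of (a, b) show that \<open>v\<close> has integral 0 over
  every compact subinterval of the open interval. Its primitive is therefore constant inside and, by
  continuity, up to the end points, so \<open>prim_zero_imp_zero\<close> applies.\<close>

lemma fundamental_lemma:
  assumes v: "square_integrable v"
    and orth: "\<And>\<phi>. test_function \<phi> \<Longrightarrow> integral {0..1} (\<lambda>x. v x * complex_of_real (\<phi> x)) = 0"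
  shows "AE x in unit_measure. v x = 0"
proof (rule prim_zero_imp_zero[OF v])
  have ab: "integral {a..b} v = 0" if ab: "0 < a" "a \<le> b" "b < 1" for a b
  proof -
    define \<phi> where "\<phi> n x = 1 * (flat 0 (real (Suc n) * (x - a)) * flat 0 (real (Suc n) * (b - x)))" for n x
    have test: "test_function (\<phi> n)" for n
      using test_function_bump[OF ab, of "real (Suc n)"] bump_base[of a b "real (Suc n)" 1 0 0]
      unfolding \<phi>_def by simp
    have sq: "square_integrable (\<lambda>x. v x * complex_of_real (\<phi> n x))" for n
      using square_integrable_mult_continuous[OF continuous_on_of_real[OF test_function_continuous[OF test]] v]
      by (simp add: mult.commute)
    have flat_lim: "(\<lambda>n. flat 0 (real (Suc n) * y)) \<longlonglongrightarrow> (if 0 < y then 1 else 0)" for y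
    proof (cases "0 < y")
      case True
      have "filterlim (\<lambda>n. y * real (Suc n)) at_top sequentially"
        by (rule filterlim_tendsto_pos_mult_at_top[OF tendsto_const True])
          (rule filterlim_compose[OF filterlim_real_sequentially filterlim_Suc])
      then have "(\<lambda>n. exp (- inverse (y * real (Suc n)))) \<longlonglongrightarrow> exp (- 0)"
        by (intro tendsto_intros) (rule filterlim_compose[OF tendsto_inverse_0_at_top], auto intro: filterlim_ident)
      moreover have "exp (- inverse (y * real (Suc n))) = flat 0 (real (Suc n) * y)" for n
        using True by (simp add: flat_def mult.commute inverse_eq_divide zero_less_mult_iff del: of_nat_Suc)
      ultimately show ?thesis using True by simp
    next
      case False
      then have "flat 0 (real (Suc n) * y) = 0" for n
        by (simp add: flat_def zero_less_mult_iff del: of_nat_Suc)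
      then show ?thesis using False by simp
    qed
    have fb: "0 \<le> flat 0 y" "flat 0 y \<le> 1" for y by (auto simp: flat_def)
    have "(\<lambda>n. LINT x|unit_measure. v x * complex_of_real (\<phi> n x)) \<longlonglongrightarrow> (LINT x|unit_measure. indicator {a<..<b} x *\<^sub>R v x)"
    proof (rule integral_dominated_convergence)
      have mv: "v \<in> borel_measurable unit_measure" using v by (simp add: square_integrable_def)
      have "indicator {a<..<b} \<in> borel_measurable unit_measure"
        by (intro borel_measurable_indicator) (use ab in \<open>auto simp: sets_restrict_space_iff\<close>)
      then show "(\<lambda>x. indicator {a<..<b} x *\<^sub>R v x) \<in> borel_measurable unit_measure"
        by (intro borel_measurable_scaleR mv)
      show "(\<lambda>x. v x * complex_of_real (\<phi> n x)) \<in> borel_measurable unit_measure" for n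
        using sq by (simp add: square_integrable_def)
      show "integrable unit_measure (\<lambda>x. cmod (v x))" using square_integrable_imp_integrable[OF v] by simp
      have "(\<lambda>n. v x * complex_of_real (\<phi> n x)) \<longlonglongrightarrow> indicator {a<..<b} x *\<^sub>R v x" for x
      proof -
        have "(\<lambda>n. \<phi> n x) \<longlonglongrightarrow> 1 * ((if 0 < x - a then 1 else 0) * (if 0 < b - x then 1 else 0))"
          unfolding \<phi>_def by (intro tendsto_intros flat_lim)
        then have "(\<lambda>n. v x * complex_of_real (\<phi> n x)) \<longlonglongrightarrow> v x * complex_of_real (1 * ((if 0 < x - a then 1 else 0) * (if 0 < b - x then 1 else 0)))"
          by (intro tendsto_intros)
        then show ?thesis by (auto simp: indicator_def split: if_splits)
      qed
      then show "AE x in unit_measure. (\<lambda>n. v x * complex_of_real (\<phi> n x)) \<longlonglongrightarrow> indicator {a<..<b} x *\<^sub>R v x" by simp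
      show "AE x in unit_measure. cmod (v x * complex_of_real (\<phi> n x)) \<le> cmod (v x)" for n
        using fb by (auto simp: norm_mult \<phi>_def abs_mult intro!: mult_left_le mult_le_one)
    qed
    moreover have "(LINT x|unit_measure. v x * complex_of_real (\<phi> n x)) = 0" for n
      using integral_unit_eq[OF square_integrable_imp_integrable[OF sq]] orth[OF test] by simp
    ultimately have "(LINT x|unit_measure. indicator {a<..<b} x *\<^sub>R v x) = 0" by (simp add: LIMSEQ_const_iff)
    moreover have "(LINT x|unit_measure. indicator {a<..<b} x *\<^sub>R v x) = integral {0..1} (\<lambda>x. indicator {a<..<b} x *\<^sub>R v x)"
    proof (rule integral_unit_eq)
      have "indicator {a<..<b} \<in> borel_measurable unit_measure"
        by (intro borel_measurable_indicator) (use ab in \<open>auto simp: sets_restrict_space_iff\<close>)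
      moreover have "v \<in> borel_measurable unit_measure" using v by (simp add: square_integrable_def)
      ultimately have "(\<lambda>x. indicator {a<..<b} x *\<^sub>R v x) \<in> borel_measurable unit_measure"
        by (rule borel_measurable_scaleR)
      then show "integrable unit_measure (\<lambda>x. indicator {a<..<b} x *\<^sub>R v x)"
        by (rule Bochner_Integration.integrable_bound[OF square_integrable_imp_integrable[OF v]])
          (auto simp: indicator_def)
    qed
    also have "integral {0..1} (\<lambda>x. indicator {a<..<b} x *\<^sub>R v x) = integral {0..1} (\<lambda>x. if x \<in> {a..b} then v x else 0)"
      by (rule integral_spike[of "{a,b}"]) (auto simp: indicator_def)
    also have "\<dots> = integral {a..b} v"
    proof -
      have "{a..b} \<inter> {0..1} = {a..b}" using ab by auto
      then show ?thesis by (simp only: integral_restrict_Int)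
    qed
    finally show ?thesis by simp
  qed
  define V where "V x = integral {0..x} v" for x
  have ac: "ac V v" unfolding V_def using ac_antiderivative[OF v, of 0] by simp
  have const: "V x = V (1/2)" if "x \<in> {0<..<1}" for x
    using ab[of x "1/2"] ab[of "1/2" x] ac_integral[OF ac, of x "1/2"] ac_integral[OF ac, of "1/2" x] that
    by (cases "x \<le> 1/2") auto
  have c: "V x = V (1/2)" if "x \<in> {0..1}" for x
    by (rule continuous_AE_eq[OF ac_continuous[OF ac] continuous_on_const AE_unitI that]) (rule const)
  fix x :: real assume x: "x \<in> {0..1}"
  have "V x = V 0" using c[OF x] c[of 0] by simp
  then show "integral {0..x} v = 0" by (simp add: V_def)
qed

section \<open>Weak derivatives\<close>

lemma square_integrable_mult_test:
  assumes "square_integrable f" "test_function \<phi>"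
  shows "square_integrable (\<lambda>x. f x * complex_of_real (\<phi> x))"
  using square_integrable_mult_continuous[OF continuous_on_of_real[OF test_function_continuous[OF assms(2)]] assms(1)]
  by (simp add: mult.commute)

lemma test_function_iterated_deriv: "test_function \<phi> \<Longrightarrow> test_function ((deriv ^^ j) \<phi>)"
  by (induction j) (auto intro: test_function_deriv)

lemma integral_rep_test:
  assumes f: "square_integrable f" and phi: "test_function \<phi>"
  shows "(LINT x|unit_measure. rep_l2 (abs_l2 f) x * complex_of_real (\<phi> x))
    = integral {0..1} (\<lambda>x. f x * complex_of_real (\<phi> x))"
proof -
  have sq: "square_integrable (\<lambda>x. rep_l2 (abs_l2 f) x * complex_of_real (\<phi> x))"
    "square_integrable (\<lambda>x. f x * complex_of_real (\<phi> x))"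
    using square_integrable_mult_test phi f square_integrable_rep by auto
  have "(LINT x|unit_measure. rep_l2 (abs_l2 f) x * complex_of_real (\<phi> x))
      = (LINT x|unit_measure. f x * complex_of_real (\<phi> x))"
    by (rule integral_cong_AE)
      (use sq rep_abs_l2[OF f] in \<open>auto simp: square_integrable_def elim!: eventually_mono\<close>)
  then show ?thesis using integral_unit_eq[OF square_integrable_imp_integrable[OF sq(2)]] by simp
qed

lemma has_weak_deriv_abs:
  assumes "square_integrable f" "square_integrable g"
  shows "has_weak_deriv j (abs_l2 f) (abs_l2 g) \<longleftrightarrow>
    (\<forall>\<phi>. test_function \<phi> \<longrightarrow> integral {0..1} (\<lambda>x. f x * complex_of_real ((deriv ^^ j) \<phi> x))
      = (-1) ^ j * integral {0..1} (\<lambda>x. g x * complex_of_real (\<phi> x)))"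
  unfolding has_weak_deriv_def
  using integral_rep_test[OF assms(1) test_function_iterated_deriv] integral_rep_test[OF assms(2)]
  by auto

lemma has_weak_deriv_unique:
  assumes "has_weak_deriv j u v" "has_weak_deriv j u w"
  shows "v = w"
proof -
  define f g where "f = rep_l2 v" and "g = rep_l2 w"
  have sq: "square_integrable f" "square_integrable g" by (simp_all add: f_def g_def square_integrable_rep)
  have vw: "v = abs_l2 f" "w = abs_l2 g" by (simp_all add: f_def g_def abs_rep_l2)
  have "AE x in unit_measure. f x - g x = 0"
  proof (rule fundamental_lemma[OF square_integrable_diff[OF sq]])
    fix \<phi> assume phi: "test_function \<phi>"
    have "(-1) ^ j * integral {0..1} (\<lambda>x. f x * complex_of_real (\<phi> x)) = (-1) ^ j * integral {0..1} (\<lambda>x. g x * complex_of_real (\<phi> x))"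
      using assms integral_rep_test[OF sq(1) phi] integral_rep_test[OF sq(2) phi] phi
      unfolding has_weak_deriv_def vw by metis
    then have "integral {0..1} (\<lambda>x. f x * complex_of_real (\<phi> x)) = integral {0..1} (\<lambda>x. g x * complex_of_real (\<phi> x))"
      by simp
    moreover have "(\<lambda>x. f x * complex_of_real (\<phi> x)) integrable_on {0..1}" "(\<lambda>x. g x * complex_of_real (\<phi> x)) integrable_on {0..1}"
      using square_integrable_integrable_on[OF square_integrable_mult_test[OF _ phi], of _ 0 1] sq by auto
    ultimately show "integral {0..1} (\<lambda>x. (f x - g x) * complex_of_real (\<phi> x)) = 0"
      by (simp add: left_diff_distrib Henstock_Kurzweil_Integration.integral_diff)
  qed
  then have "AE x in unit_measure. f x = g x" by eventually_elim simp
  then show ?thesis unfolding vw abs_l2_eq_iff[OF sq] .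
qed

lemma weak_deriv_eq: "has_weak_deriv j u v \<Longrightarrow> weak_deriv j u = v"
  unfolding weak_deriv_def by (rule the_equality) (auto intro: has_weak_deriv_unique)

lemma ac_test_parts:
  assumes f: "ac f g" and phi: "test_function \<phi>"
  shows "integral {0..1} (\<lambda>x. f x * complex_of_real (deriv \<phi> x)) = - integral {0..1} (\<lambda>x. g x * complex_of_real (\<phi> x))"
proof -
  have "integral {0..1} (\<lambda>x. g x * complex_of_real (\<phi> x) + f x * complex_of_real (deriv \<phi> x)) = 0"
    using ac_integral[OF ac_mult[OF f test_function_ac[OF phi]], of 0 1] test_function_0[OF phi] by simp
  moreover have "(\<lambda>x. g x * complex_of_real (\<phi> x)) integrable_on {0..1}" "(\<lambda>x. f x * complex_of_real (deriv \<phi> x)) integrable_on {0..1}"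
    using square_integrable_integrable_on[OF square_integrable_mult_test[OF ac_sqD[OF f] phi], of 0 1]
      square_integrable_integrable_on[OF square_integrable_mult_test[OF ac_sq[OF f] test_function_deriv[OF phi]], of 0 1] by auto
  ultimately have "integral {0..1} (\<lambda>x. g x * complex_of_real (\<phi> x)) + integral {0..1} (\<lambda>x. f x * complex_of_real (deriv \<phi> x)) = 0"
    by (simp add: Henstock_Kurzweil_Integration.integral_add)
  then show ?thesis by (simp add: eq_neg_iff_add_eq_0 add.commute)
qed

lemma chain_has_weak_deriv:
  assumes F: "chain k F" and "m \<le> k"
  shows "has_weak_deriv m (abs_l2 (F 0)) (abs_l2 (F m))"
proof -
  have "integral {0..1} (\<lambda>x. F 0 x * complex_of_real ((deriv ^^ m) \<phi> x))
      = (-1) ^ m * integral {0..1} (\<lambda>x. F m x * complex_of_real (\<phi> x))" if "test_function \<phi>" for \<phi>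
    using \<open>m \<le> k\<close> that
  proof (induction m arbitrary: \<phi>)
    case (Suc m)
    have "integral {0..1} (\<lambda>x. F 0 x * complex_of_real ((deriv ^^ m) (deriv \<phi>) x))
        = (-1) ^ m * integral {0..1} (\<lambda>x. F m x * complex_of_real (deriv \<phi> x))"
      using Suc.prems by (intro Suc.IH test_function_deriv) auto
    also have "integral {0..1} (\<lambda>x. F m x * complex_of_real (deriv \<phi> x)) = - integral {0..1} (\<lambda>x. F (Suc m) x * complex_of_real (\<phi> x))"
      using Suc.prems by (intro ac_test_parts chain_ac[OF F]) auto
    finally show ?case by (simp add: funpow_swap1)
  qed simp
  then show ?thesis
    by (subst has_weak_deriv_abs) (use chain_sq[OF F] \<open>m \<le> k\<close> in auto)
qed

text \<open>Every test function differs from a multiple of a fixed one, \<open>\<phi>0\<close>, by a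
  test function of mean zero, which is the derivative of another. With \<open>c\<close> fixed by
  \<open>\<phi>0\<close>, the difference z - c is orthogonal to all test functions.\<close>

lemma du_Bois_Reymond:
  assumes z: "square_integrable z"
    and orth: "\<And>\<phi>. test_function \<phi> \<Longrightarrow> integral {0..1} (\<lambda>x. z x * complex_of_real (deriv \<phi> x)) = 0"
  shows "\<exists>c. AE x in unit_measure. z x = c"
proof -
  have T: "(\<lambda>x. f x * complex_of_real (\<phi> x)) integrable_on {0..1}" if "test_function \<phi>" "square_integrable f" for f \<phi>
    using square_integrable_integrable_on[OF square_integrable_mult_test[OF that(2,1)], of 0 1] by simp
  have I: "\<phi> integrable_on {0..1}" if "test_function \<phi>" for \<phi>
    using integrable_continuous_real test_function_continuous[OF that] by blast
  have I': "integral {0..1} (\<lambda>x. complex_of_real (\<phi> x)) = complex_of_real (integral {0..1} \<phi>)" if "test_function \<phi>" for \<phi>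
    using integral_linear[OF I[OF that] bounded_linear_of_real[where 'a = complex]] by (simp add: o_def)
  \<comment> \<open>A test function of nonzero mean is obtained indirectly: otherwise the constant 1
    would vanish by the fundamental lemma.\<close>
  have "\<exists>\<phi>. test_function \<phi> \<and> integral {0..1} \<phi> \<noteq> 0"
  proof (rule ccontr)
    assume "\<not> ?thesis"
    then have "AE x in unit_measure. (1::complex) = 0"
      by (intro fundamental_lemma[of "\<lambda>x. 1"]) (auto simp: square_integrable_const I')
    then have "(1::complex) = 0"
      using continuous_AE_eq[of "\<lambda>_. 1" "\<lambda>_. 0" 0] by auto
    then show False by simp
  qed
  then obtain \<phi>0 where p0: "test_function \<phi>0" "integral {0..1} \<phi>0 \<noteq> 0" by blast
  define c where "c = integral {0..1} (\<lambda>x. z x * complex_of_real (\<phi>0 x)) / complex_of_real (integral {0..1} \<phi>0)"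
  have "AE x in unit_measure. z x - c = 0"
  proof (rule fundamental_lemma)
    show "square_integrable (\<lambda>x. z x - c)" by (intro square_integrable_diff z square_integrable_const)
    fix \<psi> assume psi: "test_function \<psi>"
    define r where "r = integral {0..1} \<psi> / integral {0..1} \<phi>0"
    have test: "test_function (\<lambda>x. \<psi> x - r * \<phi>0 x)" by (rule test_function_diff_scale[OF psi p0(1)])
    have "integral {0..1} (\<lambda>x. \<psi> x - r * \<phi>0 x) = integral {0..1} \<psi> - r * integral {0..1} \<phi>0"
      using I[OF psi] integrable_on_cmult_left[OF I[OF p0(1)], of r]
      by (simp add: Henstock_Kurzweil_Integration.integral_diff)
    also have "\<dots> = 0" using p0(2) by (simp add: r_def)
    finally obtain \<phi> where phi: "test_function \<phi>" "deriv \<phi> = (\<lambda>x. \<psi> x - r * \<phi>0 x)"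
      using test_function_antiderivative[OF test] by blast
    have "0 = integral {0..1} (\<lambda>x. z x * complex_of_real (\<psi> x) - complex_of_real r * (z x * complex_of_real (\<phi>0 x)))"
      using orth[OF phi(1)] by (simp add: phi(2) algebra_simps)
    also have "\<dots> = integral {0..1} (\<lambda>x. z x * complex_of_real (\<psi> x)) - complex_of_real r * integral {0..1} (\<lambda>x. z x * complex_of_real (\<phi>0 x))"
      using T[OF psi z] integrable_on_mult_right[OF T[OF p0(1) z], of "complex_of_real r"]
      by (simp add: Henstock_Kurzweil_Integration.integral_diff)
    also have "complex_of_real r * integral {0..1} (\<lambda>x. z x * complex_of_real (\<phi>0 x)) = c * integral {0..1} (\<lambda>x. complex_of_real (\<psi> x))"
      using p0(2) by (simp add: r_def c_def I'[OF psi])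
    finally show "integral {0..1} (\<lambda>x. (z x - c) * complex_of_real (\<psi> x)) = 0"
      using T[OF psi z] T[OF psi square_integrable_const[of c]]
      by (simp add: left_diff_distrib Henstock_Kurzweil_Integration.integral_diff)
  qed
  then have "AE x in unit_measure. z x = c" by eventually_elim simp
  then show ?thesis ..
qed

lemma weak_deriv_1_ac:
  assumes "has_weak_deriv 1 u v"
  shows "\<exists>f. ac f (rep_l2 v) \<and> u = abs_l2 f"
proof -
  define f g where "f = rep_l2 u" and "g = rep_l2 v"
  have sq: "square_integrable f" "square_integrable g" by (simp_all add: f_def g_def square_integrable_rep)
  have uv: "u = abs_l2 f" "v = abs_l2 g" by (simp_all add: f_def g_def abs_rep_l2)
  have G: "ac (\<lambda>x. integral {0..x} g) g" using ac_antiderivative[OF sq(2), of 0] by simp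
  note sqG = ac_sq[OF G]
  have "\<exists>c. AE x in unit_measure. f x - integral {0..x} g = c"
  proof (rule du_Bois_Reymond[OF square_integrable_diff[OF sq(1) sqG]])
    fix \<phi> assume phi: "test_function \<phi>"
    have "integral {0..1} (\<lambda>x. f x * complex_of_real (deriv \<phi> x)) = - integral {0..1} (\<lambda>x. g x * complex_of_real (\<phi> x))"
      using assms phi unfolding uv has_weak_deriv_abs[OF sq] by simp
    moreover have "(\<lambda>x. f x * complex_of_real (deriv \<phi> x)) integrable_on {0..1}"
      "(\<lambda>x. integral {0..x} g * complex_of_real (deriv \<phi> x)) integrable_on {0..1}"
      using square_integrable_integrable_on[OF square_integrable_mult_test[OF sq(1) test_function_deriv[OF phi]], of 0 1]
        square_integrable_integrable_on[OF square_integrable_mult_test[OF sqG test_function_deriv[OF phi]], of 0 1] by auto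
    ultimately show "integral {0..1} (\<lambda>x. (f x - integral {0..x} g) * complex_of_real (deriv \<phi> x)) = 0"
      using ac_test_parts[OF G phi] by (simp add: left_diff_distrib Henstock_Kurzweil_Integration.integral_diff)
  qed
  then obtain c where c: "AE x in unit_measure. f x - integral {0..x} g = c" by blast
  have h: "ac (\<lambda>x. c + integral {0..x} g) g" by (rule ac_antiderivative[OF sq(2)])
  have "AE x in unit_measure. f x = c + integral {0..x} g" using c by eventually_elim (auto simp: algebra_simps)
  then have "u = abs_l2 (\<lambda>x. c + integral {0..x} g)"
    unfolding uv abs_l2_eq_iff[OF sq(1) ac_sq[OF h]] .
  then show ?thesis using h by (auto simp: g_def)
qed

text \<open>\<open>sobolev\<close> speaks of each order separately. Comparing consecutive orders,
  one of them on the test function \<open>deriv \<phi>\<close>, yields the first order relations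
  from which chains are built.\<close>

lemma has_weak_deriv_step:
  assumes "has_weak_deriv m u v" "has_weak_deriv (Suc m) u w"
  shows "has_weak_deriv 1 v w"
  unfolding has_weak_deriv_def
proof (intro allI impI)
  fix \<phi> assume phi: "test_function \<phi>"
  have "(LINT x|unit_measure. rep_l2 u x * complex_of_real ((deriv ^^ m) (deriv \<phi>) x)) =
        (-1) ^ m * (LINT x|unit_measure. rep_l2 v x * complex_of_real (deriv \<phi> x))"
    using assms(1) test_function_deriv[OF phi] unfolding has_weak_deriv_def by blast
  moreover have "(LINT x|unit_measure. rep_l2 u x * complex_of_real ((deriv ^^ m) (deriv \<phi>) x)) =
        (-1) ^ Suc m * (LINT x|unit_measure. rep_l2 w x * complex_of_real (\<phi> x))"
    using assms(2) phi unfolding has_weak_deriv_def by (simp add: funpow_swap1)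
  ultimately have "(-1) ^ m * (LINT x|unit_measure. rep_l2 v x * complex_of_real (deriv \<phi> x)) =
     (-1) ^ m * - (LINT x|unit_measure. rep_l2 w x * complex_of_real (\<phi> x))" by simp
  then have "(LINT x|unit_measure. rep_l2 v x * complex_of_real (deriv \<phi> x)) = - (LINT x|unit_measure. rep_l2 w x * complex_of_real (\<phi> x))"
    by (rule mult_left_cancel[THEN iffD1, rotated]) simp
  then show "(LINT x|unit_measure. rep_l2 v x * complex_of_real ((deriv ^^ 1) \<phi> x)) =
     (-1) ^ 1 * (LINT x|unit_measure. rep_l2 w x * complex_of_real (\<phi> x))" by simp
qed

lemma weak_deriv_0: "weak_deriv 0 u = u"
  by (rule weak_deriv_eq) (simp add: has_weak_deriv_def)

lemma sobolev_chain:
  assumes "u \<in> sobolev k"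
  obtains F where "chain k F" "\<And>m. m \<le> k \<Longrightarrow> abs_l2 (F m) = weak_deriv m u"
proof -
  have W: "has_weak_deriv m u (weak_deriv m u)" if "m \<le> k" for m
    using assms that weak_deriv_eq by (auto simp: sobolev_def)
  have "\<forall>m. \<exists>f. m < k \<longrightarrow> ac f (rep_l2 (weak_deriv (Suc m) u)) \<and> weak_deriv m u = abs_l2 f"
    using weak_deriv_1_ac has_weak_deriv_step W by (meson Suc_leI less_imp_le)
  then obtain f where f: "\<And>m. m < k \<Longrightarrow> ac (f m) (rep_l2 (weak_deriv (Suc m) u))"
      "\<And>m. m < k \<Longrightarrow> weak_deriv m u = abs_l2 (f m)" by metis
  \<comment> \<open>At order \<open>k\<close> there need not be a continuous representative, so an
    arbitrary one is taken. Below \<open>k\<close> the primitives \<open>f m\<close> are used; each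
    is an admissible derivative of the preceding entry because it changes the given one only on a
    null set.\<close>
  define F where "F m = (if m < k then f m else rep_l2 (weak_deriv m u))" for m
  have abs: "abs_l2 (F m) = weak_deriv m u" for m
    using f(2) by (simp add: F_def abs_rep_l2)
  have "chain k F"
    unfolding chain_def
  proof (intro conjI allI impI)
    fix m assume m: "m < k"
    have sq: "square_integrable (F (Suc m))"
      using f(1)[of "Suc m"] ac_sq square_integrable_rep by (auto simp: F_def)
    have "AE x in unit_measure. rep_l2 (weak_deriv (Suc m) u) x = F (Suc m) x"
      using rep_abs_l2[OF sq] by (simp add: abs)
    then show "ac (F m) (F (Suc m))"
      using ac_AE_cong[OF f(1)[OF m] sq] m by (simp add: F_def)
  qed (simp add: F_def square_integrable_rep)
  with abs show thesis by (intro that[of F]) auto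
qed

lemma chain_sobolev:
  assumes "chain k F"
  shows "abs_l2 (F 0) \<in> sobolev k" "m \<le> k \<Longrightarrow> weak_deriv m (abs_l2 (F 0)) = abs_l2 (F m)"
  using chain_has_weak_deriv[OF assms] weak_deriv_eq by (auto simp: sobolev_def)

lemma point_value_ac:
  assumes f: "ac f g" and x: "x \<in> {0..1}"
  shows "point_value (abs_l2 f) x = f x"
  unfolding point_value_def
proof (rule the_equality)
  have r: "AE y in unit_measure. rep_l2 (abs_l2 f) y = f y" by (rule rep_abs_l2[OF ac_sq[OF f]])
  then show "\<exists>g. continuous_on {0..1} g \<and> (AE y in unit_measure. rep_l2 (abs_l2 f) y = g y) \<and> g x = f x"
    using ac_continuous[OF f] by blast
  fix c assume "\<exists>g. continuous_on {0..1} g \<and> (AE y in unit_measure. rep_l2 (abs_l2 f) y = g y) \<and> g x = c"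
  then obtain g where g: "continuous_on {0..1} g" "AE y in unit_measure. rep_l2 (abs_l2 f) y = g y" "g x = c" by blast
  have "AE y in unit_measure. g y = f y" using g(2) r by eventually_elim simp
  then show "c = f x" using continuous_AE_eq[OF g(1) ac_continuous[OF f] _ x] g(3) by simp
qed

lemma sobolev_norm_chain:
  assumes "chain k F"
  shows "sobolev_norm k (abs_l2 (F 0)) \<le> chain_norm k F"
    "chain_norm k F \<le> (real k + 1) * sobolev_norm k (abs_l2 (F 0))"
proof -
  have eq: "sobolev_norm k (abs_l2 (F 0)) = L2_set (\<lambda>m. norm (abs_l2 (F m))) {..k}"
    unfolding sobolev_norm_def L2_set_def
    by (intro arg_cong[where f = sqrt] sum.cong) (simp_all add: chain_sobolev(2)[OF assms])
  show "sobolev_norm k (abs_l2 (F 0)) \<le> chain_norm k F"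
    unfolding eq chain_norm_def by (rule L2_set_le_sum) simp
  have "norm (abs_l2 (F m)) \<le> L2_set (\<lambda>m. norm (abs_l2 (F m))) {..k}" if "m \<in> {..k}" for m
    using that by (intro member_le_L2_set) auto
  then have "chain_norm k F \<le> (\<Sum>m\<le>k. L2_set (\<lambda>m. norm (abs_l2 (F m))) {..k})"
    unfolding chain_norm_def by (rule sum_mono)
  then show "chain_norm k F \<le> (real k + 1) * sobolev_norm k (abs_l2 (F 0))"
    by (simp add: eq add.commute)
qed

text \<open>For chains the traces are ordinary function values, so \<open>point_value\<close>
  disappears behind \<open>sobolev_bc_iff\<close>.\<close>

definition boundary_conditions :: "real \<Rightarrow> nat \<Rightarrow> (nat \<Rightarrow> real \<Rightarrow> complex) \<Rightarrow> bool" where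
  "boundary_conditions \<alpha> k F \<longleftrightarrow>
     (1 \<le> k \<longrightarrow> F 0 0 = 0 \<and> F 0 1 = 0) \<and>
     (2 \<le> k \<longrightarrow> F 1 0 = 0 \<and> F 1 1 = 0) \<and>
     (3 \<le> k \<longrightarrow> F 2 1 = complex_of_real \<alpha> * F 2 0)"

lemma sobolev_bc_iff:
  assumes F: "chain k F"
  shows "abs_l2 (F 0) \<in> sobolev_bc \<alpha> k \<longleftrightarrow> boundary_conditions \<alpha> k F"
proof -
  have pv: "point_value (weak_deriv m (abs_l2 (F 0))) x = F m x" if "m < k" "x \<in> {0..1}" for m x
    using chain_sobolev(2)[OF F, of m] point_value_ac[OF chain_ac[OF F that(1)] that(2)] that by simp
  have pv0: "point_value (abs_l2 (F 0)) x = F 0 x" if "0 < k" "x \<in> {0..1}" for x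
    using pv[OF that] by (simp add: weak_deriv_0)
  show ?thesis
    using chain_sobolev(1)[OF F]
    by (simp add: sobolev_bc_def boundary_conditions_def pv pv0)
qed

lemma sobolev_bc_chain:
  assumes "u \<in> sobolev_bc \<alpha> k"
  obtains F where "chain k F" "boundary_conditions \<alpha> k F" "abs_l2 (F 0) = u"
proof -
  have u: "u \<in> sobolev k" using assms by (simp add: sobolev_bc_def)
  obtain F where F: "chain k F" "\<And>m. m \<le> k \<Longrightarrow> abs_l2 (F m) = weak_deriv m u" by (rule sobolev_chain[OF u], rule that)
  have "abs_l2 (F 0) = u" using F(2)[of 0] by (simp add: weak_deriv_0)
  then show thesis using that F(1) assms sobolev_bc_iff[OF F(1)] by blast
qed

section \<open>Semigroups on \<open>L\<^sup>2\<close>\<close>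

text \<open>Riesz-Fischer: a subsequence with increments at most 2^(-n) converges almost everywhere,
  and Fatou's lemma bounds the distance to its limit in norm.\<close>

lemma l2_Cauchy_convergent:
  fixes X :: "nat \<Rightarrow> l2"
  assumes "Cauchy X" shows "convergent X"
proof -
  have "\<forall>n. \<exists>N. \<forall>m\<ge>N. \<forall>k\<ge>N. norm (X m - X k) < (1/2) ^ n"
    using assms by (simp add: Cauchy_iff)
  then obtain N where N: "\<And>n m k. N n \<le> m \<Longrightarrow> N n \<le> k \<Longrightarrow> norm (X m - X k) < (1/2) ^ n" by metis
  \<comment> \<open>The sum is nondecreasing in \<open>n\<close> and dominates each of
    \<open>N 0\<close>, ..., \<open>N n\<close>.\<close>
  define r where "r n = (\<Sum>i\<le>n. N i)" for n
  have rN: "N n \<le> r m" if "n \<le> m" for n m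
    unfolding r_def by (rule member_le_sum) (use that in auto)
  define f where "f n = rep_l2 (X (r n))" for n
  have sq: "square_integrable (f n)" for n by (simp add: f_def square_integrable_rep)
  have Xf: "X (r n) = abs_l2 (f n)" for n by (simp add: f_def abs_rep_l2)
  have mf [measurable]: "f n \<in> borel_measurable unit_measure" for n using sq by (simp add: square_integrable_def)
  have sqd: "square_integrable (\<lambda>x. f m x - f n x)" for m n by (intro square_integrable_diff sq)
  have nd: "norm (abs_l2 (\<lambda>x. f m x - f n x)) \<le> (1/2) ^ n" if "n \<le> m" for m n
    using N[of n "r m" "r n"] rN that by (simp add: abs_l2_diff[OF sq sq] Xf less_imp_le)
  have "(\<integral>\<^sup>+x. (\<Sum>n. ennreal (cmod (f (Suc n) x - f n x))) \<partial>unit_measure)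
      = (\<Sum>n. \<integral>\<^sup>+x. ennreal (cmod (f (Suc n) x - f n x)) \<partial>unit_measure)"
    by (rule nn_integral_suminf) measurable
  also have "\<dots> \<le> (\<Sum>n. ennreal ((1/2) ^ n))"
  proof (rule suminf_le)
    fix n
    have "(\<integral>\<^sup>+x. ennreal (cmod (f (Suc n) x - f n x)) \<partial>unit_measure) = ennreal (LINT x|unit_measure. cmod (f (Suc n) x - f n x))"
      using square_integrable_imp_integrable[OF sqd] by (intro nn_integral_eq_integral) auto
    also have "(LINT x|unit_measure. cmod (f (Suc n) x - f n x)) = integral {0..1} (\<lambda>x. cmod (f (Suc n) x - f n x))"
      using square_integrable_imp_integrable[OF sqd[of "Suc n" n]] by (intro integral_unit_eq) auto
    also have "\<dots> \<le> norm (abs_l2 (\<lambda>x. f (Suc n) x - f n x))"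
      using integral_norm_mult_le[OF sqd square_integrable_const[of 1], of "Suc n" n] by (simp add: norm_abs_l2_const)
    also have "\<dots> \<le> (1/2) ^ n" by (rule nd) simp
    finally show "(\<integral>\<^sup>+x. ennreal (cmod (f (Suc n) x - f n x)) \<partial>unit_measure) \<le> ennreal ((1/2) ^ n)"
      by (simp add: ennreal_leI)
  qed auto
  also have "\<dots> = ennreal (\<Sum>n. (1/2) ^ n)"
    by (rule suminf_ennreal2) (auto intro: summable_geometric)
  also have "\<dots> < \<infinity>" by simp
  finally have fin: "(\<integral>\<^sup>+x. (\<Sum>n. ennreal (cmod (f (Suc n) x - f n x))) \<partial>unit_measure) \<noteq> \<infinity>"
    by (rule less_imp_neq)
  have "AE x in unit_measure. (\<Sum>n. ennreal (cmod (f (Suc n) x - f n x))) \<noteq> \<infinity>"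
    by (rule nn_integral_PInf_AE[OF _ fin]) measurable
  then have conv: "AE x in unit_measure. convergent (\<lambda>n. f n x)"
  proof eventually_elim
    case (elim x)
    have "summable (\<lambda>n. cmod (f (Suc n) x - f n x))"
      by (rule summable_suminf_not_top) (use elim in auto)
    then have "summable (\<lambda>n. f (Suc n) x - f n x)" by (rule summable_norm_cancel)
    then have "convergent (\<lambda>n. \<Sum>i<n. f (Suc i) x - f i x)" by (simp only: summable_iff_convergent)
    then have "convergent (\<lambda>n. f n x - f 0 x)" by (simp only: sum_lessThan_telescope[of "\<lambda>n. f n x"])
    then have "convergent (\<lambda>n. (f n x - f 0 x) + f 0 x)" by (intro convergent_add convergent_const)
    then show ?case by simp
  qed
  define F where "F x = lim (\<lambda>n. f n x)" for x
  have mF [measurable]: "F \<in> borel_measurable unit_measure" unfolding F_def by measurable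
  have lim: "AE x in unit_measure. (\<lambda>n. f n x) \<longlonglongrightarrow> F x"
    using conv by eventually_elim (simp add: F_def convergent_LIMSEQ_iff)
  have fatou: "(\<integral>\<^sup>+x. ennreal ((cmod (F x - f n x))\<^sup>2) \<partial>unit_measure) \<le> ennreal (((1/2) ^ n)\<^sup>2)" for n
  proof -
    have "AE x in unit_measure. ennreal ((cmod (F x - f n x))\<^sup>2) = liminf (\<lambda>m. ennreal ((cmod (f m x - f n x))\<^sup>2))"
      using lim
    proof eventually_elim
      case (elim x)
      then have "(\<lambda>m. ennreal ((cmod (f m x - f n x))\<^sup>2)) \<longlonglongrightarrow> ennreal ((cmod (F x - f n x))\<^sup>2)"
        by (intro tendsto_intros)
      then show ?case by (rule lim_imp_Liminf[OF sequentially_bot, symmetric])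
    qed
    then have "(\<integral>\<^sup>+x. ennreal ((cmod (F x - f n x))\<^sup>2) \<partial>unit_measure) = (\<integral>\<^sup>+x. liminf (\<lambda>m. ennreal ((cmod (f m x - f n x))\<^sup>2)) \<partial>unit_measure)"
      by (rule nn_integral_cong_AE)
    also have "\<dots> \<le> liminf (\<lambda>m. \<integral>\<^sup>+x. ennreal ((cmod (f m x - f n x))\<^sup>2) \<partial>unit_measure)"
      by (rule nn_integral_liminf) measurable
    also have "\<dots> \<le> ennreal (((1/2) ^ n)\<^sup>2)"
    proof (rule Liminf_le)
      have "(\<integral>\<^sup>+x. ennreal ((cmod (f m x - f n x))\<^sup>2) \<partial>unit_measure) \<le> ennreal (((1/2) ^ n)\<^sup>2)" if "n \<le> m" for m
      proof -
        have "(\<integral>\<^sup>+x. ennreal ((cmod (f m x - f n x))\<^sup>2) \<partial>unit_measure) = ennreal (LINT x|unit_measure. (cmod (f m x - f n x))\<^sup>2)"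
          using sqd[of m n] by (intro nn_integral_eq_integral) (auto simp: square_integrable_def)
        also have "\<dots> = ennreal ((norm (abs_l2 (\<lambda>x. f m x - f n x)))\<^sup>2)" by (simp add: norm_abs_l2[OF sqd])
        also have "\<dots> \<le> ennreal (((1/2) ^ n)\<^sup>2)" by (intro ennreal_leI power_mono nd that) simp
        finally show ?thesis .
      qed
      then show "\<forall>\<^sub>F m in sequentially. (\<integral>\<^sup>+x. ennreal ((cmod (f m x - f n x))\<^sup>2) \<partial>unit_measure) \<le> ennreal (((1/2) ^ n)\<^sup>2)"
        by (rule eventually_sequentiallyI)
    qed simp
    finally show ?thesis .
  qed
  have sqF': "square_integrable (\<lambda>x. F x - f n x)" for n
    unfolding square_integrable_def
  proof
    show "integrable unit_measure (\<lambda>x. (cmod (F x - f n x))\<^sup>2)"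
      using fatou[of n] by (intro integrableI_bounded) (auto intro: le_less_trans)
  qed measurable
  have sqF: "square_integrable F"
    using square_integrable_add[OF sqF'[of 0] sq[of 0]] by simp
  have close: "norm (abs_l2 F - X (r n)) \<le> (1/2) ^ n" for n
  proof -
    have "ennreal ((norm (abs_l2 F - X (r n)))\<^sup>2) = ennreal (LINT x|unit_measure. (cmod (F x - f n x))\<^sup>2)"
      by (simp add: Xf abs_l2_diff[OF sqF sq, symmetric] norm_abs_l2[OF sqF'])
    also have "\<dots> = (\<integral>\<^sup>+x. ennreal ((cmod (F x - f n x))\<^sup>2) \<partial>unit_measure)"
      using sqF'[of n] by (intro nn_integral_eq_integral[symmetric]) (auto simp: square_integrable_def)
    also have "\<dots> \<le> ennreal (((1/2) ^ n)\<^sup>2)" by (rule fatou)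
    finally have "(norm (abs_l2 F - X (r n)))\<^sup>2 \<le> ((1/2) ^ n)\<^sup>2" by (subst (asm) ennreal_le_iff) auto
    then show ?thesis by (rule power2_le_imp_le) simp
  qed
  have "X \<longlonglongrightarrow> abs_l2 F"
  proof (rule LIMSEQ_I)
    fix e :: real assume e: "0 < e"
    have "\<exists>n. (1/2::real) ^ n < e / 2" using e by (intro real_arch_pow_inv) auto
    then obtain n where n: "(1/2::real) ^ n < e / 2" by blast
    have "norm (X m - abs_l2 F) < e" if "r n \<le> m" for m
    proof -
      have "norm (X m - X (r n)) < (1/2) ^ n" using N rN[of n n] that order_trans by blast
      moreover have "norm (X m - abs_l2 F) \<le> norm (X m - X (r n)) + norm (abs_l2 F - X (r n))"
        using norm_triangle_ineq4[of "X m - X (r n)" "abs_l2 F - X (r n)"] by simp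
      ultimately show ?thesis using close[of n] n by linarith
    qed
    then show "\<exists>no. \<forall>m\<ge>no. norm (X m - abs_l2 F) < e" by blast
  qed
  then show ?thesis by (rule convergentI)
qed

instance l2 :: banach
  by standard (rule l2_Cauchy_convergent)

text \<open>Banach-Steinhaus by Baire's theorem: one of the closed sets \<open>A N\<close> contains
  a ball, and differences of points of that ball reach every direction.\<close>

lemma uniform_boundedness:
  fixes T :: "nat \<Rightarrow> 'a::banach \<Rightarrow> 'b::real_normed_vector"
  assumes T: "\<And>n. bounded_linear (T n)" and pw: "\<And>u. \<exists>B. \<forall>n. norm (T n u) \<le> B"
  shows "\<exists>M\<ge>0. \<forall>n u. norm (T n u) \<le> M * norm u"
proof -
  define A where "A N = {u. \<forall>n. norm (T n u) \<le> real N}" for N :: nat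
  have closed: "closed (A N)" for N
  proof -
    have "closed (\<Inter>n. {u. norm (T n u) \<le> real N})"
      by (intro closed_INT ballI closed_Collect_le continuous_on_norm continuous_on_const linear_continuous_on T)
    moreover have "(\<Inter>n. {u. norm (T n u) \<le> real N}) = A N" by (auto simp: A_def)
    ultimately show ?thesis by simp
  qed
  have cover: "(\<Union>N. A N) = UNIV"
  proof -
    have "\<exists>N. u \<in> A N" for u
    proof -
      obtain B where "\<forall>n. norm (T n u) \<le> B" using pw by blast
      moreover obtain N where "B \<le> real N" using real_arch_simple by blast
      ultimately have "u \<in> A N" by (auto simp: A_def intro: order_trans)
      then show ?thesis ..
    qed
    then show ?thesis by auto
  qed
  have "\<exists>N. interior (A N) \<noteq> {}"
  proof (rule ccontr)
    assume "\<not> ?thesis"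
    then have "euclidean interior_of \<Union>(range A) = {}"
      by (intro Baire_category_alt) (auto simp: completely_metrizable_space_euclidean closed)
    then show False using cover by simp
  qed
  then obtain N u0 where "u0 \<in> interior (A N)" by blast
  then obtain r where r: "0 < r" "ball u0 r \<subseteq> A N" by (meson mem_interior)
  have bound: "norm (T n u) \<le> (4 * real N / r) * norm u" for n u
  proof (cases "u = 0")
    case True then show ?thesis using linear_0[OF bounded_linear.linear[OF T]] by simp
  next
    case False
    define c where "c = r / (2 * norm u)"
    have c: "0 < c" using r False by (simp add: c_def)
    have "u0 \<in> A N" "u0 + c *\<^sub>R u \<in> A N"
      using r False by (auto simp: c_def subset_eq dist_norm)
    then have "norm (T n u0) \<le> real N" "norm (T n (u0 + c *\<^sub>R u)) \<le> real N" by (auto simp: A_def)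
    moreover have "c *\<^sub>R T n u = T n (u0 + c *\<^sub>R u) - T n u0"
      using bounded_linear.linear[OF T] by (simp add: linear_add linear_scale)
    then have "c * norm (T n u) = norm (T n (u0 + c *\<^sub>R u) - T n u0)" using c by (metis abs_of_pos norm_scaleR)
    ultimately have "c * norm (T n u) \<le> 2 * real N"
      using norm_triangle_ineq4[of "T n (u0 + c *\<^sub>R u)" "T n u0"] by linarith
    then have "norm (T n u) \<le> 2 * real N / c" using c by (simp add: le_divide_eq mult.commute)
    also have "\<dots> = (4 * real N / r) * norm u" using r False by (simp add: c_def)
    finally show ?thesis .
  qed
  show ?thesis by (rule exI[of _ "4 * real N / r"]) (use r bound in auto)
qed

lemma right_difference_quotient:
  assumes "(f has_vector_derivative v) (at t within {t..t + 1})"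
  shows "((\<lambda>h. (f (t + h) - f t) /\<^sub>R h) \<longlongrightarrow> v) (at_right 0)"
proof (rule tendstoI)
  fix e :: real assume e: "0 < e"
  then obtain d where d: "0 < d" "\<And>y. y \<in> {t..t + 1} \<Longrightarrow> norm (y - t) < d \<Longrightarrow>
      norm (f y - f t - (y - t) *\<^sub>R v) \<le> e / 2 * norm (y - t)"
    using assms unfolding has_vector_derivative_def has_derivative_within_alt by (meson half_gt_zero)
  have "dist ((f (t + h) - f t) /\<^sub>R h) v < e" if h: "0 < h" "h < min d 1" for h
  proof -
    have "norm (f (t + h) - f t - h *\<^sub>R v) \<le> e / 2 * h" using d(2)[of "t + h"] h by simp
    moreover have "(f (t + h) - f t) /\<^sub>R h - v = (f (t + h) - f t - h *\<^sub>R v) /\<^sub>R h"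
      using h by (simp add: scaleR_diff_right)
    ultimately have "dist ((f (t + h) - f t) /\<^sub>R h) v \<le> inverse h * (e / 2 * h)"
      using h by (simp add: dist_norm mult_left_mono del: inverse_eq_divide)
    also have "\<dots> < e" using h e by simp
    finally show ?thesis .
  qed
  then show "\<forall>\<^sub>F h in at_right 0. dist ((f (t + h) - f t) /\<^sub>R h) v < e"
    using d(1) by (auto simp: eventually_at_right_field intro!: exI[of _ "min d 1"])
qed

section \<open>Strongly continuous semigroups and their generators\<close>

locale c0_semigroup =
  fixes S :: "real \<Rightarrow> 'a::banach \<Rightarrow> 'a"
  assumes C0: "C0_semigroup S"
begin

lemma bl: "0 \<le> t \<Longrightarrow> bounded_linear (S t)" and S0: "S 0 u = u"
  and Sadd: "0 \<le> s \<Longrightarrow> 0 \<le> t \<Longrightarrow> S (s + t) u = S s (S t u)"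
  and Slim: "((\<lambda>t. S t u) \<longlongrightarrow> u) (at_right 0)"
  using C0 unfolding C0_semigroup_def by auto

lemma Sdiff: "0 \<le> t \<Longrightarrow> S t (u - v) = S t u - S t v"
  and Sscale: "0 \<le> t \<Longrightarrow> S t (c *\<^sub>R u) = c *\<^sub>R S t u"
  using bounded_linear.linear[OF bl] linear_diff linear_scale by metis+

lemma right_modulus:
  assumes "0 < e" obtains d where "0 < d" "\<And>h. 0 \<le> h \<Longrightarrow> h < d \<Longrightarrow> norm (S h u - u) < e"
proof -
  have "\<forall>\<^sub>F h in at_right 0. dist (S h u) u < e" by (rule tendstoD[OF Slim assms])
  then obtain d where d: "0 < d" "\<And>h. 0 < h \<Longrightarrow> h < d \<Longrightarrow> dist (S h u) u < e"
    by (auto simp: eventually_at_right_field)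
  have "norm (S h u - u) < e" if "0 \<le> h" "h < d" for h
    using d(2)[of h] that S0 assms by (cases "h = 0") (auto simp: dist_norm)
  with d(1) that show thesis by blast
qed

text \<open>Without such a bound there are times t_n tending to 0 at which the operator norm exceeds
  n. For each fixed v, however, S(t_n) v converges to v, which contradicts uniform
  boundedness.\<close>

lemma local_bound: "\<exists>M \<delta>. 0 < \<delta> \<and> (\<forall>t u. 0 \<le> t \<and> t \<le> \<delta> \<longrightarrow> norm (S t u) \<le> M * norm u)"
proof (rule ccontr)
  assume "\<not> ?thesis"
  then have "\<forall>n. \<exists>t u. 0 \<le> t \<and> t \<le> 1 / real (Suc n) \<and> \<not> norm (S t u) \<le> real n * norm u"
    by (metis of_nat_0_less_iff zero_less_Suc zero_less_divide_1_iff)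
  then obtain t u where t: "\<And>n. 0 \<le> t n" "\<And>n. t n \<le> 1 / real (Suc n)"
     and u: "\<And>n. \<not> norm (S (t n) (u n)) \<le> real n * norm (u n)" by metis
  have "\<exists>M\<ge>0. \<forall>n v. norm (S (t n) v) \<le> M * norm v"
  proof (rule uniform_boundedness)
    show "bounded_linear (S (t n))" for n using bl t by blast
    fix v
    obtain d where d: "0 < d" "\<And>h. 0 \<le> h \<Longrightarrow> h < d \<Longrightarrow> norm (S h v - v) < 1"
      using right_modulus[of 1 v] by auto
    obtain n0 where n0: "1 / real (Suc n0) < d"
      using reals_Archimedean[OF d(1)] by (auto simp: inverse_eq_divide)
    define B where "B = norm v + 1 + (\<Sum>n<n0. norm (S (t n) v))"
    have "norm (S (t n) v) \<le> B" for n
    proof (cases "n < n0")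
      case True
      have "norm (S (t n) v) \<le> (\<Sum>n<n0. norm (S (t n) v))" by (rule member_le_sum) (use True in auto)
      then show ?thesis using norm_ge_zero[of v] unfolding B_def by linarith
    next
      case False
      then have "1 / real (Suc n) \<le> 1 / real (Suc n0)" by (intro divide_left_mono) auto
      then have "norm (S (t n) v - v) < 1" using t n0 by (intro d(2)) (auto intro: order_trans le_less_trans)
      moreover have "norm (S (t n) v) \<le> norm (S (t n) v - v) + norm v"
        using norm_triangle_ineq[of "S (t n) v - v" v] by simp
      moreover have "0 \<le> (\<Sum>n<n0. norm (S (t n) v))" by (intro sum_nonneg) auto
      ultimately show ?thesis unfolding B_def by linarith
    qed
    then show "\<exists>B. \<forall>n. norm (S (t n) v) \<le> B" by blast
  qed
  then obtain M where M: "0 \<le> M" "\<And>n v. norm (S (t n) v) \<le> M * norm v" by blast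
  obtain n where "M \<le> real n" using real_arch_simple by blast
  then have "norm (S (t n) (u n)) \<le> real n * norm (u n)"
    using M(2)[of n "u n"] mult_right_mono[of M "real n" "norm (u n)"] by auto
  with u show False by blast
qed

lemma bound: "\<exists>K\<ge>0. \<forall>t u. 0 \<le> t \<and> t \<le> T \<longrightarrow> norm (S t u) \<le> K * norm u"
proof -
  obtain M \<delta> where d: "0 < \<delta>" and M: "\<And>t u. 0 \<le> t \<Longrightarrow> t \<le> \<delta> \<Longrightarrow> norm (S t u) \<le> M * norm u"
    using local_bound by blast
  define L where "L = max 1 M"
  have L: "norm (S t u) \<le> L * norm u" if "0 \<le> t" "t \<le> \<delta>" for t u
    using M[OF that, of u] mult_right_mono[of M L "norm u"] by (simp add: L_def)
  have L1: "1 \<le> L" by (simp add: L_def)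
  have *: "norm (S t u) \<le> L ^ Suc n * norm u" if "0 \<le> t" "t \<le> real (Suc n) * \<delta>" for n t u
    using that
  proof (induction n arbitrary: t u)
    case 0 then show ?case using L by simp
  next
    case (Suc n)
    show ?case
    proof (cases "t \<le> \<delta>")
      case True
      have "L * norm u \<le> L ^ Suc (Suc n) * norm u"
        using self_le_power[OF L1, of "Suc (Suc n)"] by (intro mult_right_mono) auto
      then show ?thesis using L[of t u] True Suc.prems by linarith
    next
      case False
      have "S t u = S \<delta> (S (t - \<delta>) u)" using Sadd[of \<delta> "t - \<delta>" u] d False by simp
      then have "norm (S t u) \<le> L * norm (S (t - \<delta>) u)" using L[of \<delta>] d by simp
      also have "\<dots> \<le> L * (L ^ Suc n * norm u)"
        using False Suc.prems L1 by (intro mult_left_mono Suc.IH) (auto simp: algebra_simps)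
      finally show ?thesis by simp
    qed
  qed
  obtain n where "T / \<delta> \<le> real n" using real_arch_simple by blast
  then have "T \<le> real (Suc n) * \<delta>" using d by (simp add: divide_le_eq algebra_simps)
  then show ?thesis using * L1 by (intro exI[of _ "L ^ Suc n"]) (auto intro: order_trans)
qed

text \<open>For s < t the increment is S(s) applied to an increment at time 0. The bound on compact
  time intervals makes this uniform in s, which gives continuity from the left as well as from the
  right.\<close>

lemma orbit_continuous: "continuous_on {0..} (\<lambda>t. S t u)"
  unfolding continuous_on_iff
proof (intro ballI allI impI)
  fix t0 e :: real assume t0: "t0 \<in> {0..}" and e: "0 < e"
  obtain K where K: "0 \<le> K" "\<And>t u. 0 \<le> t \<Longrightarrow> t \<le> t0 + 1 \<Longrightarrow> norm (S t u) \<le> K * norm u"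
    using bound[of "t0 + 1"] by blast
  obtain d where d: "0 < d" "\<And>h. 0 \<le> h \<Longrightarrow> h < d \<Longrightarrow> norm (S h u - u) < e / (K + 1)"
    using right_modulus[of "e / (K + 1)" u] e K(1) by auto
  have step: "norm (S t u - S s u) < e" if "0 \<le> s" "s \<le> t" "t \<le> t0 + 1" "t - s < d" for s t
  proof -
    have "S t u - S s u = S s (S (t - s) u - u)"
      using Sadd[of s "t - s" u] that by (simp add: Sdiff)
    then have "norm (S t u - S s u) \<le> K * norm (S (t - s) u - u)" using K(2)[of s] that by simp
    also have "\<dots> \<le> K * (e / (K + 1))" using d(2)[of "t - s"] that K(1) by (intro mult_left_mono) auto
    also have "\<dots> < e" using e K(1) by (simp add: divide_simps)
    finally show ?thesis .
  qed
  show "\<exists>d>0. \<forall>t\<in>{0..}. dist t t0 < d \<longrightarrow> dist (S t u) (S t0 u) < e"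
  proof (intro exI[of _ "min d 1"] conjI ballI impI)
    fix t assume t: "t \<in> {0..}" "dist t t0 < min d 1"
    show "dist (S t u) (S t0 u) < e"
      using step[of t0 t] step[of t t0] t t0 by (cases "t0 \<le> t") (auto simp: dist_norm norm_minus_commute)
  qed (use d in auto)
qed

lemma generator_orbit:
  assumes lim: "((\<lambda>h. (S h u - u) /\<^sub>R h) \<longlongrightarrow> v) (at_right 0)" and t: "0 \<le> t"
  shows "((\<lambda>h. (S h (S t u) - S t u) /\<^sub>R h) \<longlongrightarrow> S t v) (at_right 0)"
proof -
  have "((\<lambda>h. S t ((S h u - u) /\<^sub>R h)) \<longlongrightarrow> S t v) (at_right 0)"
    by (rule bounded_linear.tendsto[OF bl[OF t] lim])
  moreover have "\<forall>\<^sub>F h in at_right 0. S t ((S h u - u) /\<^sub>R h) = (S h (S t u) - S t u) /\<^sub>R h"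
    using eventually_at_right_less[of 0]
  proof eventually_elim
    case (elim h)
    then have "S t (S h u) = S h (S t u)" using Sadd[of t h u] Sadd[of h t u] t by (simp add: add.commute)
    then show ?case using t by (simp add: Sscale Sdiff)
  qed
  ultimately show ?thesis by (rule Lim_transform_eventually)
qed

text \<open>The generator gives a derivative from the right only. From the left, the right-sided
  expansion is taken with base point \<open>t\<close> instead of \<open>t0\<close>, and then S(t) v
  is replaced by S(t0) v by continuity of the orbit.\<close>

lemma orbit_derivative:
  assumes lim: "((\<lambda>h. (S h u - u) /\<^sub>R h) \<longlongrightarrow> v) (at_right 0)" and t0: "0 \<le> t0"
  shows "((\<lambda>t. S t u) has_vector_derivative S t0 v) (at t0 within {0..})"
  unfolding has_vector_derivative_def has_derivative_within_alt
proof (intro conjI allI impI)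
  show "bounded_linear (\<lambda>x. x *\<^sub>R S t0 v)" by (rule bounded_linear_scaleR_left)
  fix e :: real assume e: "0 < e"
  obtain K where K: "0 \<le> K" "\<And>t u. 0 \<le> t \<Longrightarrow> t \<le> t0 + 1 \<Longrightarrow> norm (S t u) \<le> K * norm u"
    using bound[of "t0 + 1"] by blast
  have eK: "0 < e / 2 / (K + 1)" using e K(1) by simp
  have "\<forall>\<^sub>F h in at_right 0. dist ((S h u - u) /\<^sub>R h) v < e / 2 / (K + 1)" by (rule tendstoD[OF lim eK])
  then obtain d1 where d1: "0 < d1" "\<And>h. 0 < h \<Longrightarrow> h < d1 \<Longrightarrow> dist ((S h u - u) /\<^sub>R h) v < e / 2 / (K + 1)"
    by (auto simp: eventually_at_right_field)
  have diff: "norm (S h u - u - h *\<^sub>R v) \<le> e / 2 / (K + 1) * h" if "0 \<le> h" "h < d1" for h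
  proof (cases "h = 0")
    case True then show ?thesis by (simp add: S0)
  next
    case False
    then have h: "0 < h" using that by simp
    have "S h u - u - h *\<^sub>R v = h *\<^sub>R ((S h u - u) /\<^sub>R h - v)" using h by (simp add: scaleR_diff_right)
    then have "norm (S h u - u - h *\<^sub>R v) = h * dist ((S h u - u) /\<^sub>R h) v" using h by (simp add: dist_norm)
    also have "\<dots> \<le> h * (e / 2 / (K + 1))" using d1(2)[OF h that(2)] h by (intro mult_left_mono) auto
    finally show ?thesis by (simp add: mult.commute)
  qed
  have ext: "norm (S t u - S s u - (t - s) *\<^sub>R S s v) \<le> e / 2 * (t - s)"
    if "0 \<le> s" "s \<le> t" "t \<le> t0 + 1" "t - s < d1" for s t
  proof -
    have "S t u - S s u - (t - s) *\<^sub>R S s v = S s (S (t - s) u - u - (t - s) *\<^sub>R v)"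
      using Sadd[of s "t - s" u] that by (simp add: Sdiff Sscale)
    then have "norm (S t u - S s u - (t - s) *\<^sub>R S s v) \<le> K * norm (S (t - s) u - u - (t - s) *\<^sub>R v)"
      using K(2)[of s] that by simp
    also have "\<dots> \<le> K * (e / 2 / (K + 1) * (t - s))" using that K(1) by (intro mult_left_mono diff) auto
    also have "\<dots> = (K / (K + 1)) * (e / 2 * (t - s))" by simp
    also have "\<dots> \<le> 1 * (e / 2 * (t - s))" using K(1) e that by (intro mult_right_mono) (auto simp: divide_simps)
    finally show ?thesis by simp
  qed
  obtain d2 where d2: "0 < d2" "\<And>t. 0 \<le> t \<Longrightarrow> dist t t0 < d2 \<Longrightarrow> dist (S t v) (S t0 v) < e / 2"
    using orbit_continuous[of v] t0 e unfolding continuous_on_iff by (metis atLeast_iff half_gt_zero)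
  show "\<exists>d>0. \<forall>t\<in>{0..}. norm (t - t0) < d \<longrightarrow> norm (S t u - S t0 u - (t - t0) *\<^sub>R S t0 v) \<le> e * norm (t - t0)"
  proof (intro exI[of _ "min (min d1 d2) 1"] conjI ballI impI)
    fix t assume t: "t \<in> {0..}" "norm (t - t0) < min (min d1 d2) 1"
    show "norm (S t u - S t0 u - (t - t0) *\<^sub>R S t0 v) \<le> e * norm (t - t0)"
    proof (cases "t0 \<le> t")
      case True
      then have "norm (S t u - S t0 u - (t - t0) *\<^sub>R S t0 v) \<le> e / 2 * (t - t0)" using t t0 by (intro ext) auto
      also have "\<dots> \<le> e * (t - t0)" using e True by (intro mult_right_mono) auto
      finally show ?thesis using True by simp
    next
      case False
      then have 1: "norm (S t0 u - S t u - (t0 - t) *\<^sub>R S t v) \<le> e / 2 * (t0 - t)" using t t0 by (intro ext) auto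
      have "norm (S t v - S t0 v) \<le> e / 2" using d2(2)[of t] t by (auto simp: dist_norm less_imp_le)
      then have 2: "norm ((t0 - t) *\<^sub>R (S t v - S t0 v)) \<le> (t0 - t) * (e / 2)"
        using False by (simp add: mult_left_mono)
      have "S t u - S t0 u - (t - t0) *\<^sub>R S t0 v = - ((S t0 u - S t u - (t0 - t) *\<^sub>R S t v) + (t0 - t) *\<^sub>R (S t v - S t0 v))"
        by (simp add: algebra_simps)
      then have "norm (S t u - S t0 u - (t - t0) *\<^sub>R S t0 v)
          \<le> norm (S t0 u - S t u - (t0 - t) *\<^sub>R S t v) + norm ((t0 - t) *\<^sub>R (S t v - S t0 v))"
        by (metis norm_minus_cancel norm_triangle_ineq)
      also have "\<dots> \<le> e * (t0 - t)" using 1 2 by (simp add: algebra_simps)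
      finally show ?thesis using False by simp
    qed
  qed (use d1 d2 in auto)
qed

text \<open>The witness is the mean of S(r) u over [0, h]: it tends to u as h tends to 0, and its
  difference quotients converge to (S(h) u - u) / h.\<close>

lemma generator_dense:
  assumes "0 < e"
  shows "\<exists>w v. ((\<lambda>h. (S h w - w) /\<^sub>R h) \<longlongrightarrow> v) (at_right 0) \<and> norm (w - u) < e"
proof -
  define G where "G t = integral {0..t} (\<lambda>r. S r u)" for t
  have cont: "continuous_on {a..b} (\<lambda>r. S r u)" if "0 \<le> a" for a b
    by (rule continuous_on_subset[OF orbit_continuous]) (use that in auto)
  have I: "(\<lambda>r. S r u) integrable_on {a..b}" if "0 \<le> a" for a b
    by (rule integrable_continuous_real[OF cont[OF that]])
  have G: "((\<lambda>h. (G (t + h) - G t) /\<^sub>R h) \<longlongrightarrow> S t u) (at_right 0)" if t: "0 \<le> t" for t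
  proof -
    have "(G has_vector_derivative S t u) (at t within {0..t + 1})"
      unfolding G_def by (rule integral_has_vector_derivative) (use t cont in auto)
    then have "(G has_vector_derivative S t u) (at t within {t..t + 1})"
      by (rule has_vector_derivative_within_subset) (use t in auto)
    then show ?thesis by (rule right_difference_quotient)
  qed
  have G0: "G 0 = 0" by (simp add: G_def)
  have "((\<lambda>h. G h /\<^sub>R h) \<longlongrightarrow> u) (at_right 0)" using G[of 0] by (simp add: G0 S0)
  then have "\<forall>\<^sub>F h in at_right 0. dist (G h /\<^sub>R h) u < e" by (rule tendstoD[OF _ assms])
  then obtain b where b: "0 < b" "\<And>h. 0 < h \<Longrightarrow> h < b \<Longrightarrow> dist (G h /\<^sub>R h) u < e"
    by (auto simp: eventually_at_right_field)
  define h where "h = b / 2"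
  have h: "0 < h" "norm (G h /\<^sub>R h - u) < e" using b(1) b(2)[of h] by (auto simp: h_def dist_norm)
  have shift: "S r (G h) - G h = (G (h + r) - G h) - (G (0 + r) - G 0)" if r: "0 < r" for r
  proof -
    have "S r (G h) = integral {0..h} (\<lambda>x. S r (S x u))"
      unfolding G_def using integral_linear[OF I bl[of r], of 0 h] r by (simp add: o_def)
    also have "\<dots> = integral {0..h} (\<lambda>x. S (x + r) u)"
      by (rule Henstock_Kurzweil_Integration.integral_cong) (use r Sadd[of r] in \<open>auto simp: add.commute\<close>)
    also have "\<dots> = integral {r..h + r} (\<lambda>x. S x u)"
      using integral_shift_Icc_real[of 0 h "\<lambda>x. S x u" r] by (simp add: add.commute o_def)
    also have "\<dots> = G (h + r) - G r"
      unfolding G_def using Henstock_Kurzweil_Integration.integral_combine[of 0 r "h + r" "\<lambda>x. S x u"] h r I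
      by (simp add: algebra_simps)
    finally show ?thesis by (simp add: G0)
  qed
  have "((\<lambda>r. (G (h + r) - G h) /\<^sub>R r - (G (0 + r) - G 0) /\<^sub>R r) \<longlongrightarrow> S h u - S 0 u) (at_right 0)"
    by (intro tendsto_diff G) (use h in auto)
  moreover have "\<forall>\<^sub>F r in at_right 0. (G (h + r) - G h) /\<^sub>R r - (G (0 + r) - G 0) /\<^sub>R r = (S r (G h) - G h) /\<^sub>R r"
    using eventually_at_right_less[of 0] by eventually_elim (simp add: shift scaleR_diff_right)
  ultimately have "((\<lambda>r. (S r (G h) - G h) /\<^sub>R r) \<longlongrightarrow> S h u - S 0 u) (at_right 0)"
    by (rule Lim_transform_eventually)
  from tendsto_scaleR[OF tendsto_const[of "inverse h"] this]
  have "((\<lambda>r. inverse h *\<^sub>R ((S r (G h) - G h) /\<^sub>R r)) \<longlongrightarrow> inverse h *\<^sub>R (S h u - S 0 u)) (at_right 0)" .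
  moreover have "\<forall>\<^sub>F r in at_right 0. inverse h *\<^sub>R ((S r (G h) - G h) /\<^sub>R r) = (S r (G h /\<^sub>R h) - G h /\<^sub>R h) /\<^sub>R r"
    using eventually_at_right_less[of 0] by eventually_elim (simp add: Sscale scaleR_diff_right mult.commute)
  ultimately have "((\<lambda>r. (S r (G h /\<^sub>R h) - G h /\<^sub>R h) /\<^sub>R r) \<longlongrightarrow> inverse h *\<^sub>R (S h u - S 0 u)) (at_right 0)"
    by (rule Lim_transform_eventually)
  then show ?thesis using h(2) by blast
qed

end

text \<open>On the domain, exp(2 \<omega> s) times the quadratic form of \<open>B\<close> along the
  orbit has nonpositive derivative. Comparing the form with the squared norm at the times 0 and t
  costs sqrt K. All other \<open>u\<close> follow by density.\<close>

theorem lyapunov_decay: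
  fixes S :: "real \<Rightarrow> 'a::{banach,real_inner} \<Rightarrow> 'a"
  assumes C0: "C0_semigroup S" and gen: "is_generator S D A"
    and B: "bounded_linear B" and sym: "\<And>u v. B u \<bullet> v = u \<bullet> B v"
    and lower: "\<And>u. (norm u)\<^sup>2 \<le> B u \<bullet> u" and upper: "\<And>u. B u \<bullet> u \<le> K * (norm u)\<^sup>2"
    and diss: "\<And>u. u \<in> D \<Longrightarrow> A u \<bullet> B u \<le> - \<omega> * (B u \<bullet> u)"
    and t: "0 \<le> t"
  shows "norm (S t u) \<le> sqrt K * exp (- \<omega> * t) * norm u"
proof -
  interpret c0_semigroup S by unfold_locales (rule C0)
  have lim: "((\<lambda>h. (S h u - u) /\<^sub>R h) \<longlongrightarrow> A u) (at_right 0)" if "u \<in> D" for u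
    using gen that by (simp add: is_generator_def)
  have D: "D = {u. \<exists>v. ((\<lambda>h. (S h u - u) /\<^sub>R h) \<longlongrightarrow> v) (at_right 0)}"
    using gen by (simp add: is_generator_def)
  have inv: "S s u \<in> D" "A (S s u) = S s (A u)" if "u \<in> D" "0 \<le> s" for s u
  proof -
    have l: "((\<lambda>h. (S h (S s u) - S s u) /\<^sub>R h) \<longlongrightarrow> S s (A u)) (at_right 0)"
      by (rule generator_orbit[OF lim[OF that(1)] that(2)])
    then show "S s u \<in> D" unfolding D by blast
    from lim[OF this] l show "A (S s u) = S s (A u)"
      by (rule tendsto_unique[OF trivial_limit_at_right_real])
  qed
  have dec: "norm (S t u) \<le> sqrt K * exp (- \<omega> * t) * norm u" if u: "u \<in> D" for u
  proof -
    define f where "f s = exp (2 * \<omega> * s) * (B (S s u) \<bullet> S s u)" for s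
    have deriv: "((\<lambda>s. S s u) has_vector_derivative A (S s u)) (at s within {0..})" if "0 \<le> s" for s
      using orbit_derivative[OF lim[OF u] that] inv(2)[OF u that] by simp
    have fd: "(f has_real_derivative exp (2 * \<omega> * s) * (2 * \<omega> * (B (S s u) \<bullet> S s u) + 2 * (A (S s u) \<bullet> B (S s u)))) (at s within {0..})"
      if s: "0 \<le> s" for s
    proof -
      have d: "((\<lambda>s. S s u) has_derivative (\<lambda>h. h *\<^sub>R A (S s u))) (at s within {0..})"
        using deriv[OF s] by (simp add: has_vector_derivative_def)
      have "((\<lambda>s. B (S s u) \<bullet> S s u) has_derivative (\<lambda>h. B (S s u) \<bullet> (h *\<^sub>R A (S s u)) + B (h *\<^sub>R A (S s u)) \<bullet> S s u)) (at s within {0..})"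
        by (intro has_derivative_inner bounded_linear.has_derivative[OF B d] d)
      also have "(\<lambda>h. B (S s u) \<bullet> (h *\<^sub>R A (S s u)) + B (h *\<^sub>R A (S s u)) \<bullet> S s u) = (\<lambda>h. (2 * (A (S s u) \<bullet> B (S s u))) * h)"
        by (auto simp: fun_eq_iff sym inner_commute linear_scale[OF bounded_linear.linear[OF B]] algebra_simps)
          (metis inner_commute sym)+
      finally have "((\<lambda>s. B (S s u) \<bullet> S s u) has_real_derivative 2 * (A (S s u) \<bullet> B (S s u))) (at s within {0..})"
        by (simp add: has_field_derivative_def)
      then show ?thesis unfolding f_def
        by (auto intro!: derivative_eq_intros simp: algebra_simps)
    qed
    have "f t \<le> f 0"
    proof (rule DERIV_nonpos_imp_decreasing_open[OF t])
      fix s assume s: "0 < s" "s < t"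
      have "at s within {0..} = at s" by (rule at_within_interior) (use s in auto)
      then have "DERIV f s :> exp (2 * \<omega> * s) * (2 * \<omega> * (B (S s u) \<bullet> S s u) + 2 * (A (S s u) \<bullet> B (S s u)))"
        using fd[of s] s by simp
      moreover have "2 * \<omega> * (B (S s u) \<bullet> S s u) + 2 * (A (S s u) \<bullet> B (S s u)) \<le> 0"
        using diss[OF inv(1)[OF u, of s]] s by simp
      ultimately show "\<exists>y. DERIV f s :> y \<and> y \<le> 0" by (meson exp_ge_zero mult_nonneg_nonpos)
    next
      have "continuous_on {0..} f"
        unfolding continuous_on_eq_continuous_within using fd DERIV_continuous by blast
      then show "continuous_on {0..t} f" by (rule continuous_on_subset) auto
    qed
    then have "exp (2 * \<omega> * t) * (norm (S t u))\<^sup>2 \<le> K * (norm u)\<^sup>2"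
    proof -
      have "exp (2 * \<omega> * t) * (norm (S t u))\<^sup>2 \<le> f t"
        unfolding f_def by (intro mult_left_mono lower) auto
      also have "\<dots> \<le> f 0" by fact
      also have "\<dots> \<le> K * (norm u)\<^sup>2" using upper[of u] by (simp add: f_def S0)
      finally show ?thesis .
    qed
    then have "exp (2 * (- \<omega> * t)) * (exp (2 * \<omega> * t) * (norm (S t u))\<^sup>2) \<le> exp (2 * (- \<omega> * t)) * (K * (norm u)\<^sup>2)"
      by (intro mult_left_mono) auto
    then have le: "(norm (S t u))\<^sup>2 \<le> exp (2 * (- \<omega> * t)) * (K * (norm u)\<^sup>2)"
      by (simp add: mult.assoc[symmetric] flip: exp_add)
    have "norm (S t u) \<le> sqrt (exp (2 * (- \<omega> * t)) * (K * (norm u)\<^sup>2))"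
      by (rule real_le_rsqrt[OF le])
    also have "\<dots> = sqrt K * exp (- \<omega> * t) * norm u"
      by (simp only: real_sqrt_mult real_sqrt_abs exp_double real_sqrt_power) simp
    finally show ?thesis .
  qed
  \<comment> \<open>This crude bound on [0, t] serves only to pass to the limit when
    \<open>u\<close> is approximated from the domain; it does not enter the final constant.\<close>
  obtain L where L: "0 \<le> L" "\<And>s v. 0 \<le> s \<Longrightarrow> s \<le> t \<Longrightarrow> norm (S s v) \<le> L * norm v" using bound[of t] by blast
  show ?thesis
  proof (cases "u = 0")
    case True
    then show ?thesis using linear_0[OF bounded_linear.linear[OF bl[OF t]]] by simp
  next
    case False
    have K0: "0 \<le> sqrt K * exp (- \<omega> * t)"
    proof -
      have "(norm u)\<^sup>2 \<le> K * (norm u)\<^sup>2" using lower[of u] upper[of u] by linarith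
      then show ?thesis using False by simp
    qed
    show ?thesis
    proof (rule field_le_epsilon)
      fix e :: real assume e: "0 < e"
      define C where "C = L + sqrt K * exp (- \<omega> * t) + 1"
      have C: "0 < C" using L(1) K0 by (simp add: C_def)
      have "0 < e / C" using e C by simp
      then obtain w v where w: "((\<lambda>h. (S h w - w) /\<^sub>R h) \<longlongrightarrow> v) (at_right 0)" "norm (w - u) < e / C"
        using generator_dense by blast
      have "w \<in> D" using w(1) unfolding D by blast
      note d = dec[OF this]
      have "norm (S t u) \<le> norm (S t w) + norm (S t (w - u))"
        using norm_triangle_ineq4[of "S t w" "S t (w - u)"] t by (simp add: Sdiff)
      also have "\<dots> \<le> sqrt K * exp (- \<omega> * t) * norm w + L * norm (w - u)"
        using d L(2)[of t "w - u"] t by (intro add_mono) auto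
      also have "\<dots> \<le> sqrt K * exp (- \<omega> * t) * (norm u + norm (w - u)) + L * norm (w - u)"
        using K0 L(1) norm_triangle_ineq[of u "w - u"] by (intro add_mono mult_left_mono) auto
      also have "\<dots> = sqrt K * exp (- \<omega> * t) * norm u + (L + sqrt K * exp (- \<omega> * t)) * norm (w - u)"
        by (simp add: algebra_simps)
      also have "\<dots> \<le> sqrt K * exp (- \<omega> * t) * norm u + C * (e / C)"
        using w(2) K0 L(1) by (intro add_left_mono mult_mono) (auto simp: C_def)
      finally show "norm (S t u) \<le> sqrt K * exp (- \<omega> * t) * norm u + e" using C by simp
    qed
  qed
qed

section \<open>The Kawahara operator\<close>

text \<open>The operator of the Lyapunov functional. The form \<open>M + 1 * x\<close> makes the
  factor an instance of \<open>ac_affine\<close>.\<close>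

definition weight :: "real \<Rightarrow> l2 \<Rightarrow> l2" where
  "weight M u = abs_l2 (\<lambda>x. complex_of_real (M + 1 * x) * rep_l2 u x)"

lemma square_integrable_weight:
  "square_integrable f \<Longrightarrow> square_integrable (\<lambda>x. complex_of_real (a + b * x) * f x)"
  by (rule square_integrable_mult_continuous[OF ac_continuous[OF ac_affine]])

lemma weight_abs:
  assumes "square_integrable f"
  shows "weight M (abs_l2 f) = abs_l2 (\<lambda>x. complex_of_real (M + 1 * x) * f x)"
proof -
  have "AE x in unit_measure. complex_of_real (M + 1 * x) * rep_l2 (abs_l2 f) x = complex_of_real (M + 1 * x) * f x"
    using rep_abs_l2[OF assms] by eventually_elim simp
  then show ?thesis
    unfolding weight_def
      abs_l2_eq_iff[OF square_integrable_weight[OF square_integrable_rep] square_integrable_weight[OF assms]] .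
qed

lemma bounded_linear_weight:
  assumes "0 \<le> M" shows "bounded_linear (weight M)"
proof (rule bounded_linear_intro[where K = "M + 1"])
  fix u v :: l2 and r :: real
  define f g where "f = rep_l2 u" and "g = rep_l2 v"
  have sq: "square_integrable f" "square_integrable g" by (simp_all add: f_def g_def square_integrable_rep)
  have uv: "u = abs_l2 f" "v = abs_l2 g" by (simp_all add: f_def g_def abs_rep_l2)
  show "weight M (u + v) = weight M u + weight M v"
    unfolding uv abs_l2_add[OF sq, symmetric] weight_abs[OF sq(1)] weight_abs[OF sq(2)]
      weight_abs[OF square_integrable_add[OF sq]]
      abs_l2_add[OF square_integrable_weight[OF sq(1)] square_integrable_weight[OF sq(2)], symmetric]
    by (simp add: distrib_left)
  show "weight M (r *\<^sub>R u) = r *\<^sub>R weight M u"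
    unfolding uv abs_l2_scaleR[OF sq(1), symmetric] weight_abs[OF sq(1)]
      weight_abs[OF square_integrable_scale[OF sq(1)]] abs_l2_scaleR[OF square_integrable_weight[OF sq(1)], symmetric]
    by (simp add: mult.left_commute)
  have "norm (weight M u) \<le> (M + 1) * norm u"
    unfolding uv weight_abs[OF sq(1)]
    by (rule norm_abs_l2_mono[OF square_integrable_weight[OF sq(1)] sq(1)])
      (use assms in \<open>auto simp: norm_mult simp del: of_real_add intro!: mult_right_mono\<close>)
  then show "norm (weight M u) \<le> norm u * (M + 1)" by (simp add: mult.commute)
qed

lemma inner_weight:
  assumes "square_integrable f" "square_integrable g"
  shows "weight M (abs_l2 f) \<bullet> abs_l2 g = Re (integral {0..1} (\<lambda>x. complex_of_real (M + 1 * x) * (f x * cnj (g x))))"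
  unfolding weight_abs[OF assms(1)] inner_abs_l2_integral[OF square_integrable_weight[OF assms(1)] assms(2)]
  by (simp add: mult.assoc)

lemma weight_symmetric: "weight M u \<bullet> v = u \<bullet> weight M v"
proof -
  define f g where "f = rep_l2 u" and "g = rep_l2 v"
  have sq: "square_integrable f" "square_integrable g" by (simp_all add: f_def g_def square_integrable_rep)
  have uv: "u = abs_l2 f" "v = abs_l2 g" by (simp_all add: f_def g_def abs_rep_l2)
  have "u \<bullet> weight M v = Re (integral {0..1} (\<lambda>x. f x * cnj (complex_of_real (M + 1 * x) * g x)))"
    unfolding uv weight_abs[OF sq(2)] by (rule inner_abs_l2_integral[OF sq(1) square_integrable_weight[OF sq(2)]])
  also have "(\<lambda>x. f x * cnj (complex_of_real (M + 1 * x) * g x)) = (\<lambda>x. complex_of_real (M + 1 * x) * (f x * cnj (g x)))"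
    by (auto simp: mult_ac)
  finally show ?thesis unfolding uv inner_weight[OF sq] by simp
qed

lemma weight_bounds:
  shows "M * (norm u)\<^sup>2 \<le> weight M u \<bullet> u" "weight M u \<bullet> u \<le> (M + 1) * (norm u)\<^sup>2"
proof -
  define f where "f = rep_l2 u"
  have sq: "square_integrable f" and u: "u = abs_l2 f" by (simp_all add: f_def square_integrable_rep abs_rep_l2)
  have I: "(\<lambda>x. (cmod (f x))\<^sup>2) integrable_on {0..1}" by (rule norm_power2_integrable_on[OF sq])
  have "(\<lambda>x. x * (cmod (f x))\<^sup>2) absolutely_integrable_on {0..1}"
  proof -
    have "integrable unit_measure (\<lambda>x. x * (cmod (f x))\<^sup>2)"
    proof (rule Bochner_Integration.integrable_bound)
      show "integrable unit_measure (\<lambda>x. (cmod (f x))\<^sup>2)" using sq by (simp add: square_integrable_def)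
      have "(\<lambda>x::real. x) \<in> borel_measurable unit_measure"
        by (rule continuous_imp_measurable_on_sets_lebesgue) auto
      then show "(\<lambda>x. x * (cmod (f x))\<^sup>2) \<in> borel_measurable unit_measure"
        using sq by (intro borel_measurable_times) (auto simp: square_integrable_def)
      show "AE x in unit_measure. norm (x * (cmod (f x))\<^sup>2) \<le> norm ((cmod (f x))\<^sup>2)"
        by (rule AE_unitI) (auto simp: abs_mult mult_left_le_one_le)
    qed
    then show ?thesis by (simp add: integrable_unit_iff)
  qed
  then have I': "(\<lambda>x. x * (cmod (f x))\<^sup>2) integrable_on {0..1}" by (simp add: absolutely_integrable_on_def)
  have IM: "(\<lambda>x. (M + x) * (cmod (f x))\<^sup>2) integrable_on {0..1}"
    using Henstock_Kurzweil_Integration.integrable_add[OF integrable_on_cmult_left[OF I, of M] I']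
    by (simp add: algebra_simps)
  have "weight M u \<bullet> u = Re (integral {0..1} (\<lambda>x. complex_of_real ((M + x) * (cmod (f x))\<^sup>2)))"
    unfolding u inner_weight[OF sq sq] by (simp add: complex_norm_square[symmetric] del: of_real_power)
  also have "\<dots> = integral {0..1} (\<lambda>x. (M + x) * (cmod (f x))\<^sup>2)"
    using integral_linear[OF IM bounded_linear_of_real[where 'a = complex]] by (simp add: o_def)
  finally have eq: "weight M u \<bullet> u = integral {0..1} (\<lambda>x. (M + x) * (cmod (f x))\<^sup>2)" .
  have n: "(norm u)\<^sup>2 = integral {0..1} (\<lambda>x. (cmod (f x))\<^sup>2)" unfolding u by (rule norm_abs_l2_integral[OF sq])
  have "integral {0..1} (\<lambda>x. M * (cmod (f x))\<^sup>2) \<le> integral {0..1} (\<lambda>x. (M + x) * (cmod (f x))\<^sup>2)"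
    by (rule integral_le) (use integrable_on_cmult_left[OF I, of M] IM in \<open>auto intro: mult_right_mono\<close>)
  then show "M * (norm u)\<^sup>2 \<le> weight M u \<bullet> u" by (simp add: eq n)
  have "integral {0..1} (\<lambda>x. (M + x) * (cmod (f x))\<^sup>2) \<le> integral {0..1} (\<lambda>x. (M + 1) * (cmod (f x))\<^sup>2)"
    by (rule integral_le) (use integrable_on_cmult_left[OF I, of "M + 1"] IM in \<open>auto intro: mult_right_mono\<close>)
  then show "weight M u \<bullet> u \<le> (M + 1) * (norm u)\<^sup>2" by (simp add: eq n)
qed

text \<open>Multiplying the equation by \<open>(M + x) u\<close>: the boundary term at \<open>1\<close> produced by the weight \<open>x\<close>
  is absorbed by the dissipation \<open>(1 - \<alpha>\<^sup>2) |u''(0)|\<^sup>2\<close>, amplified by \<open>M\<close>.\<close>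

lemma kawahara_dissipation:
  assumes F: "chain 5 F" "boundary_conditions \<alpha> 5 F" and M: "\<alpha>\<^sup>2 * (1 + M) \<le> M"
  shows "(abs_l2 (F 5) - abs_l2 (F 3)) \<bullet> weight M (abs_l2 (F 0)) \<le> - (3/2) * (norm (abs_l2 (F 0)))\<^sup>2"
proof -
  have ac: "ac (F m) (F (Suc m))" if "m < 5" for m by (rule chain_ac[OF F(1) that])
  have acs: "ac (F 0) (F 1)" "ac (F 1) (F 2)" "ac (F 2) (F 3)" "ac (F 3) (F 4)" "ac (F 4) (F 5)"
    using ac[of 0] ac[of 1] ac[of 2] ac[of 3] ac[of 4] by (simp_all add: eval_nat_numeral)
  have sq: "square_integrable (F m)" if "m \<le> 5" for m by (rule chain_sq[OF F(1) that])
  have bc: "F 0 0 = 0" "F 0 1 = 0" "F 1 0 = 0" "F 1 1 = 0" "F 2 1 = complex_of_real \<alpha> * F 2 0"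
    using F(2) by (auto simp: boundary_conditions_def)
  define u where "u m = abs_l2 (F m)" for m
  define W where "W = weight M"
  have W: "abs_l2 (\<lambda>x. complex_of_real (M + 1 * x) * F m x) = W (u m)" if "m \<le> 5" for m
    unfolding W_def u_def weight_abs[OF sq[OF that]] ..
  have sym: "W v \<bullet> w = v \<bullet> W w" for v w unfolding W_def by (rule weight_symmetric)
  have parts: "u (Suc m) \<bullet> abs_l2 g + u m \<bullet> abs_l2 g' = Re (F m 1 * cnj (g 1)) - Re (F m 0 * cnj (g 0))"
    if "m < 5" "ac g g'" for m g g'
    unfolding u_def by (rule ac_parts[OF ac[OF that(1)] that(2)])
  define G where "G m x = complex_of_real (M + 1 * x) * F m x" for m x
  have acG: "ac (G m) (\<lambda>x. F m x + G (Suc m) x)" if "m < 5" for m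
    unfolding G_def by (rule ac_cong[OF ac_mult[OF ac_affine[of M 1] ac[OF that]]]) auto
  have absG: "abs_l2 (G m) = W (u m)" if "m \<le> 5" for m unfolding G_def[abs_def] by (rule W[OF that])
  have sqG: "square_integrable (G m)" if "m \<le> 5" for m
    unfolding G_def using square_integrable_weight[OF sq[OF that], of M 1] by simp
  have absG': "abs_l2 (\<lambda>x. F m x + G (Suc m) x) = u m + W (u (Suc m))" if "m < 5" for m
    using abs_l2_add[OF sq[of m] sqG[of "Suc m"]] absG[of "Suc m"] that by (simp add: u_def)
  have pF: "u (Suc m) \<bullet> u n + u m \<bullet> u (Suc n) = Re (F m 1 * cnj (F n 1)) - Re (F m 0 * cnj (F n 0))"
    if "m < 5" "n < 5" for m n
    using parts[OF that(1) ac[OF that(2)]] by (simp add: u_def)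
  have pG: "u (Suc m) \<bullet> W (u n) + u m \<bullet> (u n + W (u (Suc n))) = Re (F m 1 * cnj (G n 1)) - Re (F m 0 * cnj (G n 0))"
    if "m < 5" "n < 5" for m n
    using parts[OF that(1) acG[OF that(2)]] absG[of n] absG'[of n] that by simp
  have G0: "G 0 0 = 0" "G 0 1 = 0" "G 1 0 = 0" "G 1 1 = 0" using bc by (simp_all add: G_def)
  \<comment> \<open>A parts formula against \<open>W (u n)\<close> contributes an extra
    \<open>u n\<close>, the derivative of the weight. In the formulas used below all boundary terms
    vanish, except those of the second derivative in fact \<open>5\<close>.\<close>
  have 1: "u 5 \<bullet> W (u 0) + u 4 \<bullet> u 0 + u 4 \<bullet> W (u 1) = 0"
    using pG[of 4 0] by (simp add: G0 inner_add_right eval_nat_numeral)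
  have 2: "u 4 \<bullet> u 0 + u 3 \<bullet> u 1 = 0" using pF[of 3 0] by (simp add: bc eval_nat_numeral)
  have 3: "u 4 \<bullet> W (u 1) + u 3 \<bullet> u 1 + u 3 \<bullet> W (u 2) = 0"
    using pG[of 3 1] G0 by (simp add: inner_add_right eval_nat_numeral)
  have 4: "u 3 \<bullet> u 1 + u 2 \<bullet> u 2 = 0" using pF[of 2 1] bc by (simp add: eval_nat_numeral)
  have 5: "2 * (u 3 \<bullet> W (u 2)) + u 2 \<bullet> u 2 = (1 + M) * (\<alpha>\<^sup>2 * (cmod (F 2 0))\<^sup>2) - M * (cmod (F 2 0))\<^sup>2"
  proof -
    have "u 3 \<bullet> W (u 2) + u 2 \<bullet> u 2 + u 2 \<bullet> W (u 3) = Re (F 2 1 * cnj (G 2 1)) - Re (F 2 0 * cnj (G 2 0))"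
      using pG[of 2 2] by (simp add: inner_add_right eval_nat_numeral)
    moreover have "u 2 \<bullet> W (u 3) = u 3 \<bullet> W (u 2)" by (metis sym inner_commute)
    moreover have "F 2 0 * cnj (G 2 0) = complex_of_real (M * (cmod (F 2 0))\<^sup>2)"
      using complex_norm_square[of "F 2 0"] by (simp add: G_def mult_ac)
    moreover have "F 2 1 * cnj (G 2 1) = complex_of_real ((1 + M) * (\<alpha>\<^sup>2 * (cmod (F 2 0))\<^sup>2))"
    proof -
      have "F 2 1 * cnj (G 2 1) = complex_of_real (1 + M) * (complex_of_real (\<alpha>\<^sup>2) * (F 2 0 * cnj (F 2 0)))"
        by (simp add: G_def bc(5) power2_eq_square mult_ac add_ac)
      then show ?thesis by (simp only: complex_norm_square[symmetric] of_real_mult)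
    qed
    ultimately show ?thesis by simp
  qed
  have 6: "u 3 \<bullet> W (u 0) + u 2 \<bullet> u 0 + u 2 \<bullet> W (u 1) = 0"
    using pG[of 2 0] by (simp add: G0 inner_add_right eval_nat_numeral)
  have 7: "u 2 \<bullet> u 0 + u 1 \<bullet> u 1 = 0" using pF[of 1 0] by (simp add: bc eval_nat_numeral)
  have 8: "2 * (u 2 \<bullet> W (u 1)) + u 1 \<bullet> u 1 = 0"
  proof -
    have "u 2 \<bullet> W (u 1) + u 1 \<bullet> u 1 + u 1 \<bullet> W (u 2) = 0"
      using pG[of 1 1] bc by (simp add: inner_add_right eval_nat_numeral)
    moreover have "u 1 \<bullet> W (u 2) = u 2 \<bullet> W (u 1)" by (metis sym inner_commute)
    ultimately show ?thesis by simp
  qed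
  have "(1 + M) * (\<alpha>\<^sup>2 * (cmod (F 2 0))\<^sup>2) \<le> M * (cmod (F 2 0))\<^sup>2"
    using mult_right_mono[OF M, of "(cmod (F 2 0))\<^sup>2"] by (simp add: mult_ac)
  \<comment> \<open>By facts 1 to 4, (u5, W u0) = -2 |u2|^2 + (u3, W u2), and fact 5 turns the last
    term into -|u2|^2 / 2 plus a nonpositive boundary term. By facts 6 to 8, (u3, W u0) = (3/2)
    |u1|^2.\<close>
  then have "u 5 \<bullet> W (u 0) - u 3 \<bullet> W (u 0) \<le> - (5/2) * (u 2 \<bullet> u 2) - (3/2) * (u 1 \<bullet> u 1)"
    using 1 2 3 4 5 6 7 8 by linarith
  also have "\<dots> \<le> - (3/2) * (norm (u 1))\<^sup>2" by (simp add: power2_norm_eq_inner)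
  also have "\<dots> \<le> - (3/2) * (norm (u 0))\<^sup>2"
    using power_mono[OF ac_poincare[OF acs(1) bc(1)] norm_ge_zero, of 2] by (simp add: u_def)
  finally show ?thesis by (simp add: u_def W_def inner_diff_left)
qed

text \<open>The intended sequence is \<open>N m = s ^ m * \<parallel>F m\<parallel>\<close> for a chain \<open>F\<close> and a scale \<open>0 < s \<le> 1\<close>.\<close>

definition interpolates :: "nat \<Rightarrow> (nat \<Rightarrow> real) \<Rightarrow> bool" where
  "interpolates k N \<longleftrightarrow> (\<forall>m. 0 \<le> N m) \<and>
     (\<forall>m s. Suc m < k \<longrightarrow> 0 < s \<longrightarrow> s \<le> 1 \<longrightarrow> N (Suc m) \<le> 36 * (N m / s + s * N (Suc (Suc m))))"

text \<open>Induction on \<open>m\<close>: the hypothesis, used with a small parameter, bounds the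
  contribution of \<open>N m\<close> by half of \<open>N (Suc m)\<close>, which the left side
  absorbs, and a multiple of \<open>N 0\<close>. The constant depends on \<epsilon> and
  \<open>m\<close> but not on \<open>N\<close>, so it can serve at all scales.\<close>

lemma interpolates_step:
  assumes "0 < \<epsilon>"
  shows "\<exists>K\<ge>0. \<forall>N k. interpolates k N \<longrightarrow> m < k \<longrightarrow> N m \<le> \<epsilon> * N (Suc m) + K * N 0"
  using assms
proof (induction m arbitrary: \<epsilon>)
  case 0
  show ?case by (rule exI[of _ 1]) (use 0 in \<open>auto simp: interpolates_def\<close>)
next
  case (Suc m)
  \<comment> \<open>Then 36 s is at most \<epsilon> / 2, and the parameter s / 72 of the induction
    hypothesis becomes 1/2 after multiplication by 36 / s.\<close>
  define s where "s = min 1 (\<epsilon> / 72)"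
  have s: "0 < s" "s \<le> 1" "36 * s \<le> \<epsilon> / 2" using Suc.prems by (auto simp: s_def)
  obtain K where K: "0 \<le> K" "\<And>N k. interpolates k N \<Longrightarrow> m < k \<Longrightarrow> N m \<le> s / 72 * N (Suc m) + K * N 0"
    using Suc.IH[of "s / 72"] s by auto
  show ?case
  proof (intro exI[of _ "72 * K / s"] conjI allI impI)
    fix N k assume N: "interpolates k N" "Suc m < k"
    have nn: "0 \<le> N i" for i using N(1) by (simp add: interpolates_def)
    have "N (Suc m) \<le> 36 * (N m / s + s * N (Suc (Suc m)))"
      using N s by (simp add: interpolates_def)
    also have "\<dots> = 36 / s * N m + 36 * s * N (Suc (Suc m))" by (simp add: algebra_simps)
    also have "\<dots> \<le> 36 / s * (s / 72 * N (Suc m) + K * N 0) + \<epsilon> / 2 * N (Suc (Suc m))"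
      using K(2)[OF N(1)] N(2) s nn by (intro add_mono mult_left_mono mult_right_mono) auto
    also have "36 / s * (s / 72 * N (Suc m) + K * N 0) = 1/2 * N (Suc m) + 36 * K / s * N 0"
      using s by (simp add: field_simps)
    finally have "N (Suc m) \<le> 1/2 * N (Suc m) + 36 * K / s * N 0 + \<epsilon> / 2 * N (Suc (Suc m))" .
    then have "2 * N (Suc m) \<le> 2 * (1/2 * N (Suc m) + 36 * K / s * N 0 + \<epsilon> / 2 * N (Suc (Suc m)))"
      by (rule mult_left_mono) simp
    then show "N (Suc m) \<le> \<epsilon> * N (Suc (Suc m)) + 72 * K / s * N 0" by (simp add: distrib_left)
  qed (use K s in auto)
qed

lemma interpolates_top:
  "\<exists>K\<ge>0. \<forall>N k. interpolates k N \<longrightarrow> m + d = k \<longrightarrow> N m \<le> N k + K * N 0"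
proof (induction d arbitrary: m)
  case 0
  show ?case by (rule exI[of _ 0]) auto
next
  case (Suc d)
  obtain K where K: "0 \<le> K" "\<And>N k. interpolates k N \<Longrightarrow> Suc m + d = k \<Longrightarrow> N (Suc m) \<le> N k + K * N 0"
    using Suc.IH by blast
  obtain L where L: "0 \<le> L" "\<And>N k. interpolates k N \<Longrightarrow> m < k \<Longrightarrow> N m \<le> 1 * N (Suc m) + L * N 0"
    using interpolates_step[of 1 m] by auto
  show ?case
  proof (intro exI[of _ "K + L"] conjI allI impI)
    fix N k assume N: "interpolates k N" "m + Suc d = k"
    then show "N m \<le> N k + (K + L) * N 0" using K(2)[of k N] L(2)[of k N] by (simp add: algebra_simps)
  qed (use K L in auto)
qed

lemma interpolates_eps:
  assumes "0 < \<epsilon>"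
  shows "\<exists>K\<ge>0. \<forall>N. interpolates k N \<longrightarrow> m < k \<longrightarrow> N m \<le> \<epsilon> * N k + K * N 0"
proof -
  obtain K where K: "0 \<le> K" "\<And>N k. interpolates k N \<Longrightarrow> m < k \<Longrightarrow> N m \<le> \<epsilon> * N (Suc m) + K * N 0"
    using interpolates_step[OF assms] by blast
  obtain L where L: "0 \<le> L" "\<And>N k'. interpolates k' N \<Longrightarrow> Suc m + (k - Suc m) = k' \<Longrightarrow> N (Suc m) \<le> N k' + L * N 0"
    using interpolates_top[of "Suc m" "k - Suc m"] by blast
  show ?thesis
  proof (intro exI[of _ "\<epsilon> * L + K"] conjI allI impI)
    fix N assume N: "interpolates k N" "m < k"
    have "N m \<le> \<epsilon> * N (Suc m) + K * N 0" by (rule K(2)[OF N])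
    also have "\<dots> \<le> \<epsilon> * (N k + L * N 0) + K * N 0"
      using L(2)[OF N(1)] N(2) assms by (intro add_right_mono mult_left_mono) auto
    finally show "N m \<le> \<epsilon> * N k + (\<epsilon> * L + K) * N 0" by (simp add: algebra_simps)
  qed (use K L assms in auto)
qed

text \<open>Rescaling: the numbers s^m |F m| satisfy \<open>interpolates\<close> because
  \<open>ac_interpolation\<close> may be used at the scale s t. The point is that \<open>K\<close>
  does not depend on \<open>s\<close>, which later runs through the powers of 1/4.\<close>

lemma chain_interpolation:
  assumes "0 < \<epsilon>"
  shows "\<exists>K\<ge>0. \<forall>F s m. chain k F \<longrightarrow> 0 < s \<longrightarrow> s \<le> 1 \<longrightarrow> m < k \<longrightarrow>
    s ^ m * norm (abs_l2 (F m)) \<le> \<epsilon> * (s ^ k * norm (abs_l2 (F k))) + K * norm (abs_l2 (F 0))"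
proof -
  have "\<forall>m. \<exists>K\<ge>0. \<forall>N. interpolates k N \<longrightarrow> m < k \<longrightarrow> N m \<le> \<epsilon> * N k + K * N 0"
    using interpolates_eps[OF assms] by blast
  then obtain K where K: "\<And>m. 0 \<le> K m" "\<And>m N. interpolates k N \<Longrightarrow> m < k \<Longrightarrow> N m \<le> \<epsilon> * N k + K m * N 0"
    by metis
  show ?thesis
  proof (intro exI[of _ "\<Sum>m<k. K m"] conjI allI impI)
    fix F s m assume F: "chain k F" and s: "0 < s" "s \<le> (1::real)" and m: "m < k"
    define N where "N m = s ^ m * norm (abs_l2 (F m))" for m
    have "interpolates k N"
      unfolding interpolates_def
    proof (intro conjI allI impI)
      show "0 \<le> N m" for m using s by (simp add: N_def)
      fix m t assume m: "Suc m < k" and t: "0 < t" "t \<le> (1::real)"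
      have "norm (abs_l2 (F (Suc m))) \<le> 36 * (norm (abs_l2 (F m)) / (s * t) + (s * t) * norm (abs_l2 (F (Suc (Suc m)))))"
        using m s t by (intro ac_interpolation chain_ac[OF F] mult_le_one) auto
      then have "s ^ Suc m * norm (abs_l2 (F (Suc m)))
          \<le> s ^ Suc m * (36 * (norm (abs_l2 (F m)) / (s * t) + (s * t) * norm (abs_l2 (F (Suc (Suc m))))))"
        using s by (intro mult_left_mono) auto
      also have "\<dots> = 36 * (N m / t + t * N (Suc (Suc m)))" using s t by (simp add: N_def field_simps)
      finally show "N (Suc m) \<le> 36 * (N m / t + t * N (Suc (Suc m)))" by (simp add: N_def)
    qed
    from K(2)[OF this m] have "N m \<le> \<epsilon> * N k + K m * N 0" .
    also have "K m * N 0 \<le> (\<Sum>m<k. K m) * N 0"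
      by (intro mult_right_mono member_le_sum) (use m K(1) in \<open>auto simp: N_def\<close>)
    finally show "s ^ m * norm (abs_l2 (F m)) \<le> \<epsilon> * (s ^ k * norm (abs_l2 (F k))) + (\<Sum>m<k. K m) * norm (abs_l2 (F 0))"
      by (simp add: N_def)
  qed (use K(1) in \<open>auto intro: sum_nonneg\<close>)
qed

text \<open>The third derivative is absorbed by interpolation, with the factor 1/2 in front of the
  fifth.\<close>

lemma kawahara_elliptic:
  "\<exists>C\<ge>0. \<forall>F. chain 5 F \<longrightarrow>
    chain_norm 5 F \<le> C * (norm (abs_l2 (F 5) - abs_l2 (F 3)) + norm (abs_l2 (F 0)))"
proof -
  obtain K where K: "0 \<le> K" "\<And>F s m. chain 5 F \<Longrightarrow> 0 < s \<Longrightarrow> s \<le> 1 \<Longrightarrow> m < 5 \<Longrightarrow>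
      s ^ m * norm (abs_l2 (F m)) \<le> 1/2 * (s ^ 5 * norm (abs_l2 (F 5))) + K * norm (abs_l2 (F 0))"
    using chain_interpolation[of "1/2" 5] by auto
  show ?thesis
  proof (intro exI[of _ "12 + 12 * K"] conjI allI impI)
    fix F assume F: "chain 5 F"
    define n a where "n m = norm (abs_l2 (F m))" and "a = norm (abs_l2 (F 5) - abs_l2 (F 3))" for m
    have m: "n m \<le> 1/2 * n 5 + K * n 0" if "m < 5" for m using K(2)[OF F, of 1 m] that by (simp add: n_def)
    have "n 5 \<le> a + n 3"
      unfolding n_def a_def using norm_triangle_ineq[of "abs_l2 (F 5) - abs_l2 (F 3)" "abs_l2 (F 3)"] by simp
    then have 5: "n 5 \<le> 2 * a + 2 * (K * n 0)" using m[of 3] by simp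
    have a0: "0 \<le> a" "0 \<le> n 0" "0 \<le> K * n 0" using K(1) by (simp_all add: a_def n_def)
    have "n m \<le> a + 2 * (K * n 0)" if "m < 5" for m using m[OF that] 5 by simp
    then have "n m \<le> 2 * a + 2 * (K * n 0)" if "m \<le> 5" for m
    proof (cases "m = 5")
      case False
      then have "n m \<le> a + 2 * (K * n 0)" using \<open>\<And>m. m < 5 \<Longrightarrow> n m \<le> a + 2 * (K * n 0)\<close>[of m] that by simp
      then show ?thesis using a0(1) by linarith
    qed (use 5 in simp)
    then have "(\<Sum>m\<le>5. n m) \<le> (\<Sum>m\<le>5::nat. 2 * a + 2 * (K * n 0))" by (intro sum_mono) auto
    then have "chain_norm 5 F \<le> 12 * a + 12 * (K * n 0)" by (simp add: chain_norm_def n_def)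
    also have "\<dots> \<le> (12 + 12 * K) * (a + n 0)" using a0 mult_nonneg_nonneg[OF K(1) a0(1)] by (simp add: algebra_simps)
    finally show "chain_norm 5 F \<le> (12 + 12 * K) * (norm (abs_l2 (F 5) - abs_l2 (F 3)) + norm (abs_l2 (F 0)))"
      by (simp add: n_def a_def)
  qed (use K(1) in auto)
qed

section \<open>Decay on L^2 and on the domain of the generator\<close>

lemma kawahara_op_chain:
  assumes "chain 5 F"
  shows "kawahara_op (abs_l2 (F 0)) = abs_l2 (F 5) - abs_l2 (F 3)"
  unfolding kawahara_op_def using chain_sobolev(2)[OF assms] by simp

lemma kawahara_l2_decay:
  assumes \<alpha>: "\<bar>\<alpha>\<bar> < 1" and C0: "C0_semigroup S" and gen: "is_generator S (kawahara_domain \<alpha>) kawahara_op"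
  shows "\<exists>\<omega>>0. \<exists>C\<ge>1. \<forall>t\<ge>0. \<forall>u. norm (S t u) \<le> C * exp (- \<omega> * t) * norm u"
proof -
  \<comment> \<open>This choice gives M - \<alpha>^2 (1 + M) = 1 - \<alpha>^2 > 0, so the boundary
    contribution has the good sign.\<close>
  define M where "M = 1 / (1 - \<alpha>\<^sup>2)"
  have a2: "\<alpha>\<^sup>2 < 1" using \<alpha> by (simp add: abs_square_less_1)
  then have M1: "1 \<le> M" by (simp add: M_def)
  have M2: "\<alpha>\<^sup>2 * (1 + M) \<le> M"
  proof -
    have "M * (1 - \<alpha>\<^sup>2) = 1" using a2 by (simp add: M_def)
    then have "M - \<alpha>\<^sup>2 * (1 + M) = 1 - \<alpha>\<^sup>2" by (simp add: algebra_simps)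
    then show ?thesis using a2 by linarith
  qed
  \<comment> \<open>The dissipation 3/2 with respect to the squared norm, divided by the upper bound
    M + 1 of the weight.\<close>
  define \<omega> where "\<omega> = 3 / 2 / (M + 1)"
  have om: "0 < \<omega>" using M1 by (simp add: \<omega>_def)
  have "norm (S t u) \<le> sqrt (M + 1) * exp (- \<omega> * t) * norm u" if t: "0 \<le> t" for t u
  proof (rule lyapunov_decay[OF C0 gen bounded_linear_weight[of M] weight_symmetric _ weight_bounds(2) _ t])
    show "0 \<le> M" using M1 by simp
    show "(norm u)\<^sup>2 \<le> weight M u \<bullet> u" for u
      using weight_bounds(1)[of M u] mult_right_mono[OF M1, of "(norm u)\<^sup>2"] by simp
    fix u assume "u \<in> kawahara_domain \<alpha>"
    then have u: "u \<in> sobolev_bc \<alpha> 5" by (simp add: sobolev_bc_5)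
    obtain F where F: "chain 5 F" "boundary_conditions \<alpha> 5 F" "abs_l2 (F 0) = u"
      by (rule sobolev_bc_chain[OF u], rule that)
    have "kawahara_op u \<bullet> weight M u \<le> - (3/2) * (norm u)\<^sup>2"
      using kawahara_dissipation[OF F(1,2) M2] kawahara_op_chain[OF F(1)] F(3) by simp
    also have "\<dots> = - \<omega> * ((M + 1) * (norm u)\<^sup>2)"
    proof -
      have "\<omega> * (M + 1) = 3 / 2" using M1 by (simp add: \<omega>_def divide_eq_eq)
      then have "- \<omega> * ((M + 1) * (norm u)\<^sup>2) = - (3 / 2) * (norm u)\<^sup>2"
        by (metis mult.assoc mult_minus_left)
      then show ?thesis by simp
    qed
    also have "\<dots> \<le> - \<omega> * (weight M u \<bullet> u)"
      using weight_bounds(2)[of M u] om by (simp add: mult_left_mono)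
    finally show "kawahara_op u \<bullet> weight M u \<le> - \<omega> * (weight M u \<bullet> u)" .
  qed
  moreover have "1 \<le> sqrt (M + 1)" using M1 by simp
  ultimately show ?thesis using om by blast
qed

text \<open>\<open>S t\<close> commutes with the generator, so the graph norm decays as the
  \<open>l2\<close> norm does, and \<open>kawahara_elliptic\<close> converts it into the H^5 norm.
  Requiring \<open>C'\<close> to be at least \<open>C\<close> lets one constant serve both end
  points of the interpolation.\<close>

lemma kawahara_domain_decay:
  assumes C0: "C0_semigroup S" and gen: "is_generator S (kawahara_domain \<alpha>) kawahara_op"
    and dec: "\<And>t u. 0 \<le> t \<Longrightarrow> norm (S t u) \<le> C * exp (- \<omega> * t) * norm u" and C: "1 \<le> C"
  shows "\<exists>C'\<ge>C. \<forall>t\<ge>0. \<forall>Y. chain 5 Y \<longrightarrow> boundary_conditions \<alpha> 5 Y \<longrightarrow>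
    (\<exists>Z. chain 5 Z \<and> boundary_conditions \<alpha> 5 Z \<and> abs_l2 (Z 0) = S t (abs_l2 (Y 0)) \<and>
      chain_norm 5 Z \<le> C' * exp (- \<omega> * t) * chain_norm 5 Y)"
proof -
  interpret c0_semigroup S by unfold_locales (rule C0)
  obtain K where K: "0 \<le> K" "\<And>F. chain 5 F \<Longrightarrow> chain_norm 5 F \<le> K * (norm (abs_l2 (F 5) - abs_l2 (F 3)) + norm (abs_l2 (F 0)))"
    using kawahara_elliptic by blast
  have lim: "((\<lambda>h. (S h u - u) /\<^sub>R h) \<longlongrightarrow> kawahara_op u) (at_right 0)" if "u \<in> kawahara_domain \<alpha>" for u
    using gen that by (simp add: is_generator_def)
  have D: "kawahara_domain \<alpha> = {u. \<exists>v. ((\<lambda>h. (S h u - u) /\<^sub>R h) \<longlongrightarrow> v) (at_right 0)}"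
    using gen by (simp add: is_generator_def)
  show ?thesis
  proof (intro exI[of _ "C * (2 * K + 1)"] conjI allI impI)
    show "C \<le> C * (2 * K + 1)" using C K(1) by simp
    fix t :: real and Y assume t: "0 \<le> t" and Y: "chain 5 Y" "boundary_conditions \<alpha> 5 Y"
    define u where "u = abs_l2 (Y 0)"
    have u: "u \<in> kawahara_domain \<alpha>"
      using sobolev_bc_iff[OF Y(1)] Y(2) by (simp add: u_def flip: sobolev_bc_5)
    have l: "((\<lambda>h. (S h (S t u) - S t u) /\<^sub>R h) \<longlongrightarrow> S t (kawahara_op u)) (at_right 0)"
      by (rule generator_orbit[OF lim[OF u] t])
    then have Su: "S t u \<in> kawahara_domain \<alpha>" unfolding D by blast
    have ASu: "kawahara_op (S t u) = S t (kawahara_op u)"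
      by (rule tendsto_unique[OF trivial_limit_at_right_real lim[OF Su] l])
    have Su': "S t u \<in> sobolev_bc \<alpha> 5" using Su by (simp add: sobolev_bc_5)
    obtain Z where Z: "chain 5 Z" "boundary_conditions \<alpha> 5 Z" "abs_l2 (Z 0) = S t u"
      by (rule sobolev_bc_chain[OF Su'], rule that)
    define E where "E = C * exp (- \<omega> * t)"
    have E: "0 \<le> E" using C by (simp add: E_def)
    have sum: "norm (abs_l2 (Y 5)) + norm (abs_l2 (Y 3)) + norm (abs_l2 (Y 0)) \<le> chain_norm 5 Y"
      by (simp add: chain_norm_def eval_nat_numeral)
    have "chain_norm 5 Z \<le> K * (norm (S t (kawahara_op u)) + norm (S t u))"
      using K(2)[OF Z(1)] kawahara_op_chain[OF Z(1)] Z(3) ASu by simp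
    also have "\<dots> \<le> K * (E * norm (kawahara_op u) + E * norm u)"
      using dec[OF t] K(1) by (intro mult_left_mono add_mono) (auto simp: E_def)
    also have "\<dots> = K * E * (norm (abs_l2 (Y 5) - abs_l2 (Y 3)) + norm (abs_l2 (Y 0)))"
      by (simp only: u_def kawahara_op_chain[OF Y(1)] distrib_left mult.assoc)
    also have "\<dots> \<le> K * E * chain_norm 5 Y"
      using sum norm_triangle_ineq4[of "abs_l2 (Y 5)" "abs_l2 (Y 3)"] K(1) E by (intro mult_left_mono) auto
    also have "\<dots> \<le> (2 * K + 1) * E * chain_norm 5 Y"
      using K(1) E chain_norm_nonneg by (intro mult_right_mono) auto
    finally have "chain_norm 5 Z \<le> C * (2 * K + 1) * exp (- \<omega> * t) * chain_norm 5 Y" by (simp add: E_def mult_ac)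
    with Z show "\<exists>Z. chain 5 Z \<and> boundary_conditions \<alpha> 5 Z \<and> abs_l2 (Z 0) = S t (abs_l2 (Y 0)) \<and>
      chain_norm 5 Z \<le> C * (2 * K + 1) * exp (- \<omega> * t) * chain_norm 5 Y" by (auto simp: u_def)
  qed
qed

section \<open>Intermediate Sobolev spaces\<close>

text \<open>Two geometric series of sum 2, one on each side of i; max i j - min i j is |i - j| in
  natural numbers.\<close>

lemma sum_half_powers_le:
  assumes "finite J" shows "(\<Sum>j\<in>J. (1/2::real) ^ (max i j - min i j)) \<le> 4"
proof -
  have "(\<Sum>j\<in>J. (1/2::real) ^ (max i j - min i j))
      = (\<Sum>j\<in>{j\<in>J. j \<le> i}. (1/2) ^ (max i j - min i j)) + (\<Sum>j\<in>{j\<in>J. i < j}. (1/2) ^ (max i j - min i j))"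
    using assms by (subst sum.union_disjoint[symmetric]) (auto intro!: sum.cong)
  also have "(\<Sum>j\<in>{j\<in>J. j \<le> i}. (1/2::real) ^ (max i j - min i j)) = (\<Sum>n\<in>(\<lambda>j. i - j) ` {j\<in>J. j \<le> i}. (1/2) ^ n)"
    by (subst sum.reindex) (auto simp: inj_on_def max_def min_def intro!: sum.cong)
  also have "\<dots> \<le> (\<Sum>n. (1/2) ^ n)"
    using assms by (intro sum_le_suminf) (auto intro: summable_geometric)
  also have "(\<Sum>j\<in>{j\<in>J. i < j}. (1/2::real) ^ (max i j - min i j)) = (\<Sum>n\<in>(\<lambda>j. j - i) ` {j\<in>J. i < j}. (1/2) ^ n)"
    by (subst sum.reindex) (auto simp: inj_on_def max_def min_def intro!: sum.cong)
  also have "\<dots> \<le> (\<Sum>n. (1/2) ^ n)"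
    using assms by (intro sum_le_suminf) (auto intro: summable_geometric)
  finally show ?thesis by (simp add: suminf_geometric)
qed

text \<open>Schur's test: 2 a_i a_j \<le> a_i^2 + a_j^2, and each row of the symmetric matrix of
  weights sums to at most 4 C.\<close>

lemma almost_orthogonal_sum:
  fixes x :: "nat \<Rightarrow> 'a::real_inner"
  assumes J: "finite J" and C: "0 \<le> C"
    and inner: "\<And>i j. i \<in> J \<Longrightarrow> j \<in> J \<Longrightarrow> \<bar>x i \<bullet> x j\<bar> \<le> C * (1/2) ^ (max i j - min i j) * (a i * a j)"
  shows "(norm (\<Sum>j\<in>J. x j))\<^sup>2 \<le> 4 * C * (\<Sum>j\<in>J. (a j)\<^sup>2)"
proof -
  define w where "w i j = C * (1/2) ^ (max i j - min i j)" for i j :: nat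
  have w: "0 \<le> w i j" "w i j = w j i" for i j using C by (auto simp: w_def max.commute min.commute)
  have wsum: "(\<Sum>j\<in>J. w i j) \<le> 4 * C" for i
    using mult_left_mono[OF sum_half_powers_le[OF J, of i] C] by (simp add: w_def sum_distrib_left mult.commute)
  have "(norm (\<Sum>j\<in>J. x j))\<^sup>2 = (\<Sum>i\<in>J. \<Sum>j\<in>J. x i \<bullet> x j)"
    by (simp add: power2_norm_eq_inner inner_sum_left inner_sum_right inner_commute)
  also have "\<dots> \<le> (\<Sum>i\<in>J. \<Sum>j\<in>J. w i j * (a i)\<^sup>2 / 2 + w i j * (a j)\<^sup>2 / 2)"
  proof (intro sum_mono)
    fix i j assume ij: "i \<in> J" "j \<in> J"
    have "x i \<bullet> x j \<le> w i j * (a i * a j)" using inner[OF ij] unfolding w_def by linarith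
    also have "\<dots> \<le> w i j * ((a i)\<^sup>2 / 2 + (a j)\<^sup>2 / 2)"
      using sum_squares_bound[of "a i" "a j"] by (intro mult_left_mono w) simp
    finally show "x i \<bullet> x j \<le> w i j * (a i)\<^sup>2 / 2 + w i j * (a j)\<^sup>2 / 2" by (simp add: distrib_left)
  qed
  also have "\<dots> = (\<Sum>i\<in>J. \<Sum>j\<in>J. w i j * (a i)\<^sup>2 / 2) + (\<Sum>i\<in>J. \<Sum>j\<in>J. w i j * (a j)\<^sup>2 / 2)"
    by (simp add: sum.distrib)
  also have "(\<Sum>i\<in>J. \<Sum>j\<in>J. w i j * (a j)\<^sup>2 / 2) = (\<Sum>i\<in>J. \<Sum>j\<in>J. w i j * (a i)\<^sup>2 / 2)"
    by (subst sum.swap) (simp add: w(2))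
  also have "(\<Sum>i\<in>J. \<Sum>j\<in>J. w i j * (a i)\<^sup>2 / 2) + (\<Sum>i\<in>J. \<Sum>j\<in>J. w i j * (a i)\<^sup>2 / 2)
      = (\<Sum>i\<in>J. (\<Sum>j\<in>J. w i j) * (a i)\<^sup>2)"
    by (simp add: sum.distrib[symmetric] sum_distrib_right)
  also have "\<dots> \<le> (\<Sum>i\<in>J. 4 * C * (a i)\<^sup>2)" by (intro sum_mono mult_right_mono wsum) auto
  finally show ?thesis by (simp add: sum_distrib_left)
qed

text \<open>For a fixed test function both sides of the defining identity are continuous in
  \<open>l2\<close>.\<close>

lemma has_weak_deriv_limit:
  assumes X: "X \<longlonglongrightarrow> u" and Z: "Z \<longlonglongrightarrow> v" and W: "\<And>n. has_weak_deriv j (X n) (Z n)"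
  shows "has_weak_deriv j u v"
proof -
  have lim: "(\<lambda>n. LINT x|unit_measure. rep_l2 (X n) x * complex_of_real (\<phi> x)) \<longlonglongrightarrow> (LINT x|unit_measure. rep_l2 u x * complex_of_real (\<phi> x))"
    if X: "X \<longlonglongrightarrow> u" and phi: "test_function \<phi>" for X u \<phi>
  proof (rule LIM_zero_cancel, rule Lim_null_comparison)
    define c where "c = norm (abs_l2 (\<lambda>x. complex_of_real (\<phi> x)))"
    have sp: "square_integrable (\<lambda>x. complex_of_real (\<phi> x))" by (rule ac_sq[OF test_function_ac[OF phi]])
    have "norm ((LINT x|unit_measure. rep_l2 (X n) x * complex_of_real (\<phi> x)) - (LINT x|unit_measure. rep_l2 u x * complex_of_real (\<phi> x)))
        \<le> norm (X n - u) * c" for n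
    proof -
      note r = square_integrable_rep[of "X n"] square_integrable_rep[of u]
      note m = square_integrable_mult_test[OF r(1) phi] square_integrable_mult_test[OF r(2) phi]
      have "(LINT x|unit_measure. rep_l2 (X n) x * complex_of_real (\<phi> x)) - (LINT x|unit_measure. rep_l2 u x * complex_of_real (\<phi> x))
          = integral {0..1} (\<lambda>x. rep_l2 (X n) x * complex_of_real (\<phi> x)) - integral {0..1} (\<lambda>x. rep_l2 u x * complex_of_real (\<phi> x))"
        using integral_unit_eq[OF square_integrable_imp_integrable[OF m(1)]] integral_unit_eq[OF square_integrable_imp_integrable[OF m(2)]] by simp
      also have "\<dots> = integral {0..1} (\<lambda>x. (rep_l2 (X n) x - rep_l2 u x) * complex_of_real (\<phi> x))"
        using square_integrable_integrable_on[OF m(1), of 0 1] square_integrable_integrable_on[OF m(2), of 0 1]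
        by (simp add: left_diff_distrib Henstock_Kurzweil_Integration.integral_diff)
      also have "cmod \<dots> \<le> integral {0..1} (\<lambda>x. cmod (rep_l2 (X n) x - rep_l2 u x) * cmod (complex_of_real (\<phi> x)))"
        by (rule integral_norm_bound_integral)
          (use square_integrable_integrable_on[OF square_integrable_mult_test[OF square_integrable_diff[OF r] phi], of 0 1]
            norm_mult_integrable_on[OF square_integrable_diff[OF r] sp] in \<open>auto simp: norm_mult\<close>)
      also have "\<dots> \<le> norm (abs_l2 (\<lambda>x. rep_l2 (X n) x - rep_l2 u x)) * c"
        unfolding c_def by (rule integral_norm_mult_le[OF square_integrable_diff[OF r] sp])
      also have "abs_l2 (\<lambda>x. rep_l2 (X n) x - rep_l2 u x) = X n - u"
        by (simp add: abs_l2_diff[OF r] abs_rep_l2)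
      finally show ?thesis .
    qed
    then show "\<forall>\<^sub>F n in sequentially. norm ((LINT x|unit_measure. rep_l2 (X n) x * complex_of_real (\<phi> x)) - (LINT x|unit_measure. rep_l2 u x * complex_of_real (\<phi> x)))
        \<le> norm (X n - u) * c" by simp
    have "(\<lambda>n. norm (X n - u)) \<longlonglongrightarrow> 0" using X by (simp add: LIM_zero tendsto_norm_zero)
    then show "(\<lambda>n. norm (X n - u) * c) \<longlonglongrightarrow> 0" by (rule tendsto_mult_left_zero)
  qed
  show ?thesis
    unfolding has_weak_deriv_def
  proof (intro allI impI)
    fix \<phi> assume phi: "test_function \<phi>"
    have "(\<lambda>n. LINT x|unit_measure. rep_l2 (X n) x * complex_of_real ((deriv ^^ j) \<phi> x)) \<longlonglongrightarrow> (LINT x|unit_measure. rep_l2 u x * complex_of_real ((deriv ^^ j) \<phi> x))"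
      by (rule lim[OF X test_function_iterated_deriv[OF phi]])
    moreover have "(LINT x|unit_measure. rep_l2 (X n) x * complex_of_real ((deriv ^^ j) \<phi> x)) = (-1) ^ j * (LINT x|unit_measure. rep_l2 (Z n) x * complex_of_real (\<phi> x))" for n
      using W phi unfolding has_weak_deriv_def by blast
    moreover have "(\<lambda>n. (-1) ^ j * (LINT x|unit_measure. rep_l2 (Z n) x * complex_of_real (\<phi> x))) \<longlonglongrightarrow> (-1) ^ j * (LINT x|unit_measure. rep_l2 v x * complex_of_real (\<phi> x))"
      by (intro tendsto_mult tendsto_const lim[OF Z phi])
    ultimately show "(LINT x|unit_measure. rep_l2 u x * complex_of_real ((deriv ^^ j) \<phi> x)) = (-1) ^ j * (LINT x|unit_measure. rep_l2 v x * complex_of_real (\<phi> x))"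
      using LIMSEQ_unique by (simp only:)
  qed
qed

lemma chain_trace_le:
  assumes F: "chain k F" and m: "m < k" and c: "c = 0 \<or> c = 1"
  shows "cmod (F m c) \<le> norm (abs_l2 (F m)) + norm (abs_l2 (F (Suc m)))"
proof (rule power2_le_imp_le)
  have "(cmod (F m c))\<^sup>2 \<le> (norm (abs_l2 (F m)))\<^sup>2 + 2 * norm (abs_l2 (F m)) * norm (abs_l2 (F (Suc m)))"
    by (rule ac_trace[OF chain_ac[OF F m] c])
  also have "\<dots> \<le> (norm (abs_l2 (F m)) + norm (abs_l2 (F (Suc m))))\<^sup>2" by (simp add: power2_sum)
  finally show "(cmod (F m c))\<^sup>2 \<le> (norm (abs_l2 (F m)) + norm (abs_l2 (F (Suc m))))\<^sup>2" .
qed simp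

text \<open>One integration by parts moves a derivative from the finer to the coarser scale, which gains
  the factor \<open>(s j / s i) ^ (1/2) = (1/2) ^ (j - i)\<close>; the boundary terms gain just as much by the
  multiplicative trace inequality.\<close>

lemma scale_almost_orthogonal:
  assumes d: "\<And>j. chain 5 (d j)" and k: "1 \<le> k" "k \<le> 4" and K: "0 \<le> K"
    and bound: "\<And>j m. m \<le> 5 \<Longrightarrow> ((1/4) ^ j) ^ m * norm (abs_l2 (d j m)) \<le> K * (((1/4) ^ j) ^ k * a j)"
    and a: "\<And>j. 0 \<le> a j"
  shows "\<bar>abs_l2 (d i k) \<bullet> abs_l2 (d j k)\<bar> \<le> (7 * K\<^sup>2) * (1/2) ^ (max i j - min i j) * (a i * a j)"
proof -
  define n where "n j m = norm (abs_l2 (d j m))" for j m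
  have main: "\<bar>abs_l2 (d i k) \<bullet> abs_l2 (d j k)\<bar> \<le> (7 * K\<^sup>2) * (1/2) ^ (j - i) * (a i * a j)" if ij: "i \<le> j" for i j
  proof -
    define s where "s j = (1/4::real) ^ j" for j :: nat
    have s: "0 < s j" for j by (simp add: s_def)
    define q where "q = (1/2::real) ^ (j - i)"
    have "q\<^sup>2 = (1/4) ^ (j - i)"
      unfolding q_def power2_eq_square power_mult_distrib[symmetric] by simp
    then have q: "0 \<le> q" "q \<le> 1" "s j = q\<^sup>2 * s i"
      using ij by (simp_all add: q_def s_def power_le_one power_add[symmetric])
    \<comment> \<open>Only the orders k - 1, k and k + 1 of the bound are needed, each divided by a
      power of the scale; the limits on \<open>k\<close> keep them between 0 and 5.\<close>
    have b: "n l k \<le> K * a l" "n l (k - 1) \<le> K * s l * a l" "s l * n l (Suc k) \<le> K * a l" for l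
    proof -
      have 1: "s l ^ k * n l k \<le> s l ^ k * (K * a l)" using bound[of k l] k by (simp add: n_def s_def mult_ac)
      then show "n l k \<le> K * a l" using s[of l] by (simp add: mult_le_cancel_left_pos)
      have e: "s l ^ k = s l ^ (k - 1) * s l" using k by (cases k) auto
      have "s l ^ (k - 1) * n l (k - 1) \<le> s l ^ (k - 1) * (K * s l * a l)"
        using bound[of "k - 1" l] k e by (simp add: n_def s_def[symmetric] mult_ac)
      then show "n l (k - 1) \<le> K * s l * a l" using s[of l] by (simp add: mult_le_cancel_left_pos)
      have "s l ^ k * (s l * n l (Suc k)) \<le> s l ^ k * (K * a l)"
        using bound[of "Suc k" l] k by (simp add: n_def s_def[symmetric] mult_ac)
      then show "s l * n l (Suc k) \<le> K * a l" using s[of l] by (simp add: mult_le_cancel_left_pos)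
    qed
    have nn: "0 \<le> n l m" for l m by (simp add: n_def)
    have Kaa: "0 \<le> K * a l" for l using K a by simp
    have aci: "ac (d i k) (d i (Suc k))" using chain_ac[OF d[of i], of k] k by simp
    have acj: "ac (d j (k - 1)) (d j k)" using chain_ac[OF d[of j], of "k - 1"] k by simp
    \<comment> \<open>By the trace inequality the square of the first factor is of size 1 / s_i and
      that of the second of size s_j; the square root of s_j / s_i is \<open>q\<close>.\<close>
    have tr: "cmod (d i k c) * cmod (d j (k - 1) c) \<le> 3 * K\<^sup>2 * q * (a i * a j)" if c: "c = 0 \<or> c = 1" for c
    proof (rule power2_le_imp_le)
      have 1: "s i * (cmod (d i k c))\<^sup>2 \<le> 3 * (K * a i)\<^sup>2"
      proof -
        have "s i * (cmod (d i k c))\<^sup>2 \<le> s i * ((n i k)\<^sup>2 + 2 * n i k * n i (Suc k))"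
          using ac_trace[OF aci c] s[of i] by (intro mult_left_mono) (auto simp: n_def)
        also have "\<dots> = s i * (n i k)\<^sup>2 + 2 * n i k * (s i * n i (Suc k))" by (simp add: algebra_simps)
        also have "\<dots> \<le> 1 * (K * a i)\<^sup>2 + 2 * (K * a i) * (K * a i)"
        proof (rule add_mono)
          have "s i \<le> 1" by (simp add: s_def power_le_one)
          then show "s i * (n i k)\<^sup>2 \<le> 1 * (K * a i)\<^sup>2"
            by (rule mult_mono[OF _ power_mono[OF b(1) nn]]) auto
          have "0 \<le> s i * n i (Suc k)" using s[of i] nn by simp
          then show "2 * n i k * (s i * n i (Suc k)) \<le> 2 * (K * a i) * (K * a i)"
            using mult_mono[OF b(1)[of i] b(3)[of i] Kaa] by simp
        qed
        finally show ?thesis by (simp add: power2_eq_square mult_ac)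
      qed
      have 2: "(cmod (d j (k - 1) c))\<^sup>2 \<le> s j * (3 * (K * a j)\<^sup>2)"
      proof -
        have "(cmod (d j (k - 1) c))\<^sup>2 \<le> (n j (k - 1))\<^sup>2 + 2 * n j (k - 1) * n j k"
          using ac_trace[OF acj c] by (simp add: n_def)
        also have "\<dots> \<le> (K * s j * a j)\<^sup>2 + 2 * (K * s j * a j) * (K * a j)"
          using b[of j] nn K a[of j] s[of j] Kaa by (intro add_mono mult_mono power_mono) auto
        also have "\<dots> = s j * (s j * (K * a j)\<^sup>2 + 2 * (K * a j)\<^sup>2)" by (simp add: power2_eq_square algebra_simps)
        also have "\<dots> \<le> s j * (1 * (K * a j)\<^sup>2 + 2 * (K * a j)\<^sup>2)"
          using s[of j] by (intro mult_left_mono add_mono mult_right_mono) (auto simp: s_def power_le_one)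
        finally show ?thesis by simp
      qed
      have "s i * (cmod (d i k c) * cmod (d j (k - 1) c))\<^sup>2 = (s i * (cmod (d i k c))\<^sup>2) * (cmod (d j (k - 1) c))\<^sup>2"
        by (simp add: power_mult_distrib)
      also have "\<dots> \<le> (3 * (K * a i)\<^sup>2) * (s j * (3 * (K * a j)\<^sup>2))" using s[of i] by (intro mult_mono[OF 1 2]) auto
      also have "\<dots> = s i * (3 * K\<^sup>2 * q * (a i * a j))\<^sup>2" by (simp add: q(3) power2_eq_square mult_ac)
      finally show "(cmod (d i k c) * cmod (d j (k - 1) c))\<^sup>2 \<le> (3 * K\<^sup>2 * q * (a i * a j))\<^sup>2"
        using s[of i] by (simp only: mult_le_cancel_left_pos)
    qed (use K a q in auto)
    have "abs_l2 (d i (Suc k)) \<bullet> abs_l2 (d j (k - 1)) + abs_l2 (d i k) \<bullet> abs_l2 (d j k)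
      = Re (d i k 1 * cnj (d j (k - 1) 1)) - Re (d i k 0 * cnj (d j (k - 1) 0))"
      by (rule ac_parts[OF aci acj])
    moreover have "\<bar>Re (d i k c * cnj (d j (k - 1) c))\<bar> \<le> cmod (d i k c) * cmod (d j (k - 1) c)" for c
      using abs_Re_le_cmod[of "d i k c * cnj (d j (k - 1) c)"] by (simp add: norm_mult)
    moreover have "\<bar>abs_l2 (d i (Suc k)) \<bullet> abs_l2 (d j (k - 1))\<bar> \<le> K\<^sup>2 * q * (a i * a j)"
    proof -
      have "\<bar>abs_l2 (d i (Suc k)) \<bullet> abs_l2 (d j (k - 1))\<bar> \<le> n i (Suc k) * n j (k - 1)"
        unfolding n_def by (rule Cauchy_Schwarz_ineq2)
      also have "\<dots> \<le> n i (Suc k) * (K * s j * a j)" using b[of j] nn by (intro mult_left_mono)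
      also have "\<dots> = (s i * n i (Suc k)) * (K * q\<^sup>2 * a j)" by (simp add: q(3))
      also have "\<dots> \<le> (K * a i) * (K * q * a j)"
      proof (rule mult_mono[OF b(3)])
        have "q\<^sup>2 \<le> q" using q by (simp add: power2_eq_square mult_left_le)
        then show "K * q\<^sup>2 * a j \<le> K * q * a j" using K a by (intro mult_right_mono mult_left_mono)
      qed (use K a q Kaa in auto)
      finally show ?thesis by (simp add: power2_eq_square mult_ac)
    qed
    \<comment> \<open>7 = 3 + 3 + 1: the two boundary terms and the remaining inner product.\<close>
    ultimately have "\<bar>abs_l2 (d i k) \<bullet> abs_l2 (d j k)\<bar> \<le> 7 * (K\<^sup>2 * q * (a i * a j))"
      using tr[of 0] tr[of 1] by (simp add: mult.assoc) (smt (verit))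
    then show ?thesis by (simp add: q_def mult_ac)
  qed
  show ?thesis
  proof (cases "i \<le> j")
    case True then show ?thesis using main[OF True] by (simp add: max_def min_def)
  next
    case False then show ?thesis using main[of j i] by (simp add: max_def min_def inner_commute mult_ac)
  qed
qed

text \<open>The increment compares two scales. Changing s / 4 into s in the weight of the H^5 norm
  costs 4^(5 - k), which is at most 4^5 = 1024.\<close>

lemma approx_differences:
  assumes Y: "\<And>j. chain 5 (Y j)"
    and err: "\<And>j. norm (u - abs_l2 (Y j 0)) \<le> ((1/4) ^ j) ^ k * \<epsilon> j"
    and high: "\<And>j. ((1/4) ^ j) ^ (5 - k) * chain_norm 5 (Y j) \<le> \<epsilon> j"
    and eps: "\<And>j. 0 \<le> \<epsilon> j" and k: "k \<le> 4"
  defines "d \<equiv> \<lambda>j m x. Y (Suc j) m x - Y j m x"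
  shows "norm (abs_l2 (d j 0)) \<le> ((1/4) ^ j) ^ k * (1024 * (\<epsilon> j + \<epsilon> (Suc j)))"
    "((1/4) ^ j) ^ (5 - k) * norm (abs_l2 (d j 5)) \<le> 1024 * (\<epsilon> j + \<epsilon> (Suc j))"
proof -
  define s where "s = (1/4::real) ^ j"
  have s: "0 < s" by (simp add: s_def)
  have sj: "(1/4::real) ^ Suc j = s / 4" by (simp add: s_def)
  have abs_d: "abs_l2 (d j m) = abs_l2 (Y (Suc j) m) - abs_l2 (Y j m)" if "m \<le> 5" for m
    unfolding d_def by (rule abs_l2_diff) (use chain_sq[OF Y that] in auto)
  have "norm (abs_l2 (d j 0)) \<le> norm (u - abs_l2 (Y (Suc j) 0)) + norm (u - abs_l2 (Y j 0))"
    using norm_triangle_ineq4[of "u - abs_l2 (Y j 0)" "u - abs_l2 (Y (Suc j) 0)"] by (simp add: abs_d add.commute)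
  also have "\<dots> \<le> (s / 4) ^ k * \<epsilon> (Suc j) + s ^ k * \<epsilon> j"
    using err[of "Suc j"] err[of j] by (intro add_mono) (simp_all only: sj s_def)
  also have "\<dots> \<le> s ^ k * \<epsilon> (Suc j) + s ^ k * \<epsilon> j"
    using s eps by (intro add_mono mult_right_mono power_mono) auto
  also have "\<dots> \<le> s ^ k * (1024 * (\<epsilon> j + \<epsilon> (Suc j)))"
    unfolding distrib_left[symmetric] using s eps[of j] eps[of "Suc j"] by (intro mult_left_mono) auto
  finally show "norm (abs_l2 (d j 0)) \<le> ((1/4) ^ j) ^ k * (1024 * (\<epsilon> j + \<epsilon> (Suc j)))" by (simp add: s_def)
  have n5: "norm (abs_l2 (Y i 5)) \<le> chain_norm 5 (Y i)" for i by (rule norm_le_chain_norm) simp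
  have "s ^ (5 - k) * norm (abs_l2 (d j 5)) \<le> s ^ (5 - k) * (chain_norm 5 (Y (Suc j)) + chain_norm 5 (Y j))"
    using s n5[of j] n5[of "Suc j"] norm_triangle_ineq4[of "abs_l2 (Y (Suc j) 5)" "abs_l2 (Y j 5)"]
    by (intro mult_left_mono) (auto simp: abs_d)
  also have "\<dots> = 4 ^ (5 - k) * ((s / 4) ^ (5 - k) * chain_norm 5 (Y (Suc j))) + s ^ (5 - k) * chain_norm 5 (Y j)"
    by (simp add: power_divide distrib_left)
  also have "\<dots> \<le> 4 ^ (5 - k) * \<epsilon> (Suc j) + \<epsilon> j"
    using high[of "Suc j"] high[of j] by (intro add_mono mult_left_mono) (simp_all only: sj s_def, simp)
  also have "\<dots> \<le> 1024 * \<epsilon> (Suc j) + 1024 * \<epsilon> j"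
  proof -
    have "(4::real) ^ (5 - k) \<le> 4 ^ 5" by (intro power_increasing) auto
    then have "4 ^ (5 - k) * \<epsilon> (Suc j) \<le> 1024 * \<epsilon> (Suc j)" using eps[of "Suc j"] by (intro mult_right_mono) auto
    then show ?thesis using eps[of j] by simp
  qed
  finally show "((1/4) ^ j) ^ (5 - k) * norm (abs_l2 (d j 5)) \<le> 1024 * (\<epsilon> j + \<epsilon> (Suc j))" by (simp add: s_def)
qed

lemma boundary_conditions_limit:
  assumes "\<And>n. boundary_conditions \<alpha> k (Y n)" "\<And>m c. m < k \<Longrightarrow> c = 0 \<or> c = 1 \<Longrightarrow> (\<lambda>n. Y n m c) \<longlonglongrightarrow> F m c"
  shows "boundary_conditions \<alpha> k F"
proof -
  have z: "F m c = 0" if "m < k" "c = 0 \<or> c = 1" "\<And>n. Y n m c = 0" for m c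
    using assms(2)[OF that(1,2)] that(3) by (simp add: LIMSEQ_const_iff)
  have "F 2 1 = complex_of_real \<alpha> * F 2 0" if "3 \<le> k"
  proof (rule LIMSEQ_unique)
    show "(\<lambda>n. Y n 2 1) \<longlonglongrightarrow> F 2 1" using assms(2)[of 2 1] that by simp
    have "(\<lambda>n. complex_of_real \<alpha> * Y n 2 0) \<longlonglongrightarrow> complex_of_real \<alpha> * F 2 0"
      using assms(2)[of 2 0] that by (intro tendsto_mult tendsto_const) auto
    then show "(\<lambda>n. Y n 2 1) \<longlonglongrightarrow> complex_of_real \<alpha> * F 2 0"
      using assms(1) that by (simp add: boundary_conditions_def)
  qed
  then show ?thesis
    using assms(1) z unfolding boundary_conditions_def by (simp add: less_eq_Suc_le)
qed

lemma boundary_conditions_le: "boundary_conditions \<alpha> 5 F \<Longrightarrow> boundary_conditions \<alpha> k F"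
  by (simp add: boundary_conditions_def)

text \<open>The errors are only square summable, so the increments of the k-th derivatives need not
  be absolutely summable; almost orthogonality is what makes square summability of \<open>a\<close>
  suffice. The lower derivatives then converge by interpolation and the traces of order below
  \<open>k\<close> by the trace inequality, so the boundary conditions pass to the limit.\<close>

theorem approx_imp_chain:
  assumes k: "1 \<le> k" "k \<le> 4"
  shows "\<exists>C\<ge>0. \<forall>\<alpha> E u. 0 \<le> E \<longrightarrow> approx (boundary_conditions \<alpha> 5) k E u \<longrightarrow>
    (\<exists>F. chain k F \<and> boundary_conditions \<alpha> k F \<and> abs_l2 (F 0) = u \<and> chain_norm k F \<le> C * E)"
proof -
  obtain K5 where K5: "0 \<le> K5" "\<And>F s m. chain 5 F \<Longrightarrow> 0 < s \<Longrightarrow> s \<le> 1 \<Longrightarrow> m < 5 \<Longrightarrow>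
      s ^ m * norm (abs_l2 (F m)) \<le> 1 * (s ^ 5 * norm (abs_l2 (F 5))) + K5 * norm (abs_l2 (F 0))"
    using chain_interpolation[of 1 5] by auto
  obtain L where L: "0 \<le> L" "\<And>F s m. chain k F \<Longrightarrow> 0 < s \<Longrightarrow> s \<le> 1 \<Longrightarrow> m < k \<Longrightarrow>
      s ^ m * norm (abs_l2 (F m)) \<le> 1 * (s ^ k * norm (abs_l2 (F k))) + L * norm (abs_l2 (F 0))"
    using chain_interpolation[of 1 k] by auto
  define K where "K = 1 + K5"
  \<comment> \<open>The squared norm of a sum of increments will be at most 4 * 7 * 4 * 1024^2 times
    (K E)^2, and the numerical factor is below (10^5)^2.\<close>
  define c where "c = 10 ^ 5 * K"
  have c0: "0 \<le> c" "0 \<le> K" using K5(1) by (auto simp: c_def K_def)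
  have interp: "norm (abs_l2 (F m)) \<le> norm (abs_l2 (F k)) + L * norm (abs_l2 (F 0))" if "chain k F" "m \<le> k" for F m
    using L(2)[OF that(1), of 1 m] that(2) L(1) by (cases "m = k") auto
  show ?thesis
  proof (intro exI[of _ "(real k + 1) * (1 + c + 3 * L)"] conjI allI impI)
    show "0 \<le> (real k + 1) * (1 + c + 3 * L)" using c0 L(1) by simp
    fix \<alpha> E :: real and u assume E: "0 \<le> E" and ap: "approx (boundary_conditions \<alpha> 5) k E u"
    obtain Y \<epsilon> where Y: "\<And>j. chain 5 (Y j)" "\<And>j. boundary_conditions \<alpha> 5 (Y j)"
      "\<And>j. norm (u - abs_l2 (Y j 0)) \<le> ((1/4) ^ j) ^ k * \<epsilon> j"
      "\<And>j. ((1/4) ^ j) ^ (5 - k) * chain_norm 5 (Y j) \<le> \<epsilon> j"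
      "\<And>n. (\<Sum>j<n. (\<epsilon> j)\<^sup>2) \<le> E\<^sup>2" "\<And>j. 0 \<le> \<epsilon> j"
      by (rule approxE[OF ap], rule that)
    have Yk: "chain k (Y j)" for j using chain_le[OF Y(1)] k by simp
    define d where "d j m x = Y (Suc j) m x - Y j m x" for j m x
    define a where "a j = 1024 * (\<epsilon> j + \<epsilon> (Suc j))" for j
    have a0: "0 \<le> a j" for j using Y(6)[of j] Y(6)[of "Suc j"] by (simp add: a_def)
    have dch: "chain 5 (d j)" for j unfolding d_def[abs_def] by (intro chain_diff Y)
    have abs_d: "abs_l2 (d j m) = abs_l2 (Y (Suc j) m) - abs_l2 (Y j m)" if "m \<le> 5" for j m
      unfolding d_def[abs_def] by (rule abs_l2_diff) (use chain_sq[OF Y(1) that] in auto)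
    note diff = approx_differences[OF Y(1,3,4,6) k(2), folded d_def a_def, unfolded d_def[abs_def, symmetric]]
    \<comment> \<open>The estimates at the orders 0 and 5 are interpolated at the scale s = (1/4)^j,
      with a constant that does not depend on \<open>j\<close>.\<close>
    have bound: "((1/4) ^ j) ^ m * norm (abs_l2 (d j m)) \<le> K * (((1/4) ^ j) ^ k * a j)" if m: "m \<le> 5" for j m
    proof -
      define s where "s = (1/4::real) ^ j"
      have s: "0 < s" "s \<le> 1" by (auto simp: s_def power_le_one)
      have "s ^ 5 = s ^ k * s ^ (5 - k)" using k by (simp flip: power_add)
      then have top: "s ^ 5 * norm (abs_l2 (d j 5)) \<le> s ^ k * a j"
        using mult_left_mono[OF diff(2)[of j], of "s ^ k"] s by (simp add: s_def[symmetric] mult.assoc)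
      have sa: "0 \<le> s ^ k * a j" using s a0 by simp
      have "s ^ m * norm (abs_l2 (d j m)) \<le> s ^ 5 * norm (abs_l2 (d j 5)) + K5 * norm (abs_l2 (d j 0))"
        using K5(2)[OF dch s, of m j] K5(1) m by (cases "m = 5") auto
      also have "\<dots> \<le> s ^ k * a j + K5 * (s ^ k * a j)"
        using top diff(1)[of j] K5(1) by (intro add_mono mult_left_mono) (auto simp: s_def)
      finally show ?thesis by (simp add: K_def s_def algebra_simps)
    qed
    have orth: "\<bar>abs_l2 (d i k) \<bullet> abs_l2 (d j k)\<bar> \<le> (7 * K\<^sup>2) * (1/2) ^ (max i j - min i j) * (a i * a j)" for i j
      by (rule scale_almost_orthogonal[OF dch k c0(2) bound a0])
    have tel: "(\<Sum>j\<in>{m..<n}. abs_l2 (d j k)) = abs_l2 (Y n k) - abs_l2 (Y m k)" if "m \<le> n" for m n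
      using sum_Suc_diff'[OF that, of "\<lambda>j. abs_l2 (Y j k)"] k by (simp add: abs_d)
    have blk: "(norm (abs_l2 (Y n k) - abs_l2 (Y m k)))\<^sup>2 \<le> 28 * K\<^sup>2 * (\<Sum>j\<in>{m..<n}. (a j)\<^sup>2)" if "m \<le> n" for m n
      using almost_orthogonal_sum[of "{m..<n}" "7 * K\<^sup>2" "\<lambda>j. abs_l2 (d j k)" a] orth tel[OF that] by simp
    have a2: "(\<Sum>j<n. (a j)\<^sup>2) \<le> 4 * 1024\<^sup>2 * E\<^sup>2" for n
    proof -
      have "(\<Sum>j<n. (a j)\<^sup>2) \<le> (\<Sum>j<n. 1024\<^sup>2 * (2 * (\<epsilon> j)\<^sup>2 + 2 * (\<epsilon> (Suc j))\<^sup>2))"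
      proof (rule sum_mono)
        fix j
        have "(\<epsilon> j + \<epsilon> (Suc j))\<^sup>2 \<le> 2 * (\<epsilon> j)\<^sup>2 + 2 * (\<epsilon> (Suc j))\<^sup>2"
          using sum_squares_bound[of "\<epsilon> j" "\<epsilon> (Suc j)"] by (simp add: power2_sum)
        then show "(a j)\<^sup>2 \<le> 1024\<^sup>2 * (2 * (\<epsilon> j)\<^sup>2 + 2 * (\<epsilon> (Suc j))\<^sup>2)"
          unfolding a_def power_mult_distrib by (intro mult_left_mono) auto
      qed
      also have "\<dots> = 1024\<^sup>2 * (2 * (\<Sum>j<n. (\<epsilon> j)\<^sup>2) + 2 * (\<Sum>j<n. (\<epsilon> (Suc j))\<^sup>2))"
        by (simp add: sum.distrib sum_distrib_left)
      also have "(\<Sum>j<n. (\<epsilon> (Suc j))\<^sup>2) \<le> (\<Sum>j<Suc n. (\<epsilon> j)\<^sup>2)"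
        by (subst sum.lessThan_Suc_shift) simp
      finally show ?thesis using Y(5)[of n] Y(5)[of "Suc n"] by simp
    qed
    have summ: "summable (\<lambda>j. (a j)\<^sup>2)"
    proof (rule bounded_imp_summable[where B = "4 * 1024\<^sup>2 * E\<^sup>2"])
      show "(\<Sum>j\<le>n. (a j)\<^sup>2) \<le> 4 * 1024\<^sup>2 * E\<^sup>2" for n
        using a2[of "Suc n"] by (simp only: lessThan_Suc_atMost)
    qed simp
    have "Cauchy (\<lambda>n. abs_l2 (Y n k))"
    proof (rule metric_CauchyI)
      fix b :: real assume b: "0 < b"
      then have e: "0 < b\<^sup>2 / (28 * K\<^sup>2 + 1)" by (intro divide_pos_pos) (auto simp: add_nonneg_pos)
      obtain M where M: "\<And>m n. M \<le> m \<Longrightarrow> norm (\<Sum>j\<in>{m..<n}. (a j)\<^sup>2) < b\<^sup>2 / (28 * K\<^sup>2 + 1)"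
        using summ[unfolded summable_Cauchy] e by blast
      have "norm (abs_l2 (Y n k) - abs_l2 (Y m k)) < b" if "M \<le> m" "m \<le> n" for m n
      proof (rule power2_less_imp_less)
        have "(norm (abs_l2 (Y n k) - abs_l2 (Y m k)))\<^sup>2 \<le> (28 * K\<^sup>2 + 1) * (\<Sum>j\<in>{m..<n}. (a j)\<^sup>2)"
          using blk[OF that(2)] sum_nonneg[of "{m..<n}" "\<lambda>j. (a j)\<^sup>2"] by (simp add: distrib_right)
        also have "\<dots> < (28 * K\<^sup>2 + 1) * (b\<^sup>2 / (28 * K\<^sup>2 + 1))"
          using M[OF that(1), of n] by (intro mult_strict_left_mono) (auto simp: add_nonneg_pos)
        also have "\<dots> = b\<^sup>2"
          using add_nonneg_pos[of "28 * K\<^sup>2" 1] by simp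
        finally show "(norm (abs_l2 (Y n k) - abs_l2 (Y m k)))\<^sup>2 < b\<^sup>2" .
      qed (use b in simp)
      note close = this
      show "\<exists>M. \<forall>m\<ge>M. \<forall>n\<ge>M. dist (abs_l2 (Y m k)) (abs_l2 (Y n k)) < b"
      proof (intro exI[of _ M] allI impI)
        fix m n assume "M \<le> m" "M \<le> n"
        then show "dist (abs_l2 (Y m k)) (abs_l2 (Y n k)) < b"
          using close[of m n] close[of n m] by (cases "m \<le> n") (auto simp: dist_norm norm_minus_commute)
      qed
    qed
    then obtain vk where vk: "(\<lambda>n. abs_l2 (Y n k)) \<longlonglongrightarrow> vk" by (auto simp: Cauchy_convergent_iff convergent_def)
    have lim0: "(\<lambda>n. abs_l2 (Y n 0)) \<longlonglongrightarrow> u"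
    proof (rule LIM_zero_cancel, rule Lim_null_comparison)
      have eE: "\<epsilon> n \<le> E" for n
      proof (rule power2_le_imp_le)
        have "(\<epsilon> n)\<^sup>2 \<le> (\<Sum>j<Suc n. (\<epsilon> j)\<^sup>2)" by (rule member_le_sum) auto
        then show "(\<epsilon> n)\<^sup>2 \<le> E\<^sup>2" using Y(5)[of "Suc n"] by simp
      qed (rule E)
      have "norm (abs_l2 (Y n 0) - u) \<le> (1/4) ^ n * E" for n
      proof -
        have "norm (abs_l2 (Y n 0) - u) \<le> ((1/4) ^ n) ^ k * \<epsilon> n" using Y(3)[of n] by (simp add: norm_minus_commute)
        also have "\<dots> \<le> (1/4) ^ n * E"
        proof (intro mult_mono eE Y(6))
          have "((1/4::real) ^ n) ^ k \<le> ((1/4) ^ n) ^ 1" using k by (intro power_decreasing) (auto simp: power_le_one)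
          then show "((1/4::real) ^ n) ^ k \<le> (1/4) ^ n" by simp
        qed auto
        finally show ?thesis .
      qed
      then show "\<forall>\<^sub>F n in sequentially. norm (abs_l2 (Y n 0) - u) \<le> (1/4) ^ n * E" by simp
      show "(\<lambda>n. (1/4) ^ n * E) \<longlonglongrightarrow> 0" by (intro tendsto_mult_left_zero LIMSEQ_power_zero) simp
    qed
    have W: "has_weak_deriv m (abs_l2 (Y n 0)) (abs_l2 (Y n m))" if "m \<le> k" for n m
      by (rule chain_has_weak_deriv[OF Yk that])
    have Cm: "Cauchy (\<lambda>n. abs_l2 (Y n m))" if m: "m \<le> k" for m
    proof (rule metric_CauchyI)
      fix e :: real assume e: "0 < e"
      then have e2: "0 < e / 2" "0 < e / 2 / (L + 1)" using L(1) by auto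
      obtain M1 where M1: "\<And>i j. M1 \<le> i \<Longrightarrow> M1 \<le> j \<Longrightarrow> dist (abs_l2 (Y i k)) (abs_l2 (Y j k)) < e / 2"
        using metric_CauchyD[OF \<open>Cauchy (\<lambda>n. abs_l2 (Y n k))\<close> e2(1)] by blast
      obtain M2 where M2: "\<And>i j. M2 \<le> i \<Longrightarrow> M2 \<le> j \<Longrightarrow> dist (abs_l2 (Y i 0)) (abs_l2 (Y j 0)) < e / 2 / (L + 1)"
        using metric_CauchyD[OF LIMSEQ_imp_Cauchy[OF lim0] e2(2)] by blast
      have "dist (abs_l2 (Y i m)) (abs_l2 (Y j m)) < e" if ij: "max M1 M2 \<le> i" "max M1 M2 \<le> j" for i j
      proof -
        have ch: "chain k (\<lambda>m x. Y i m x - Y j m x)" by (intro chain_diff Yk)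
        have ab: "abs_l2 (\<lambda>x. Y i m x - Y j m x) = abs_l2 (Y i m) - abs_l2 (Y j m)" if "m \<le> k" for m
          by (rule abs_l2_diff) (use chain_sq[OF Yk that] in auto)
        have "dist (abs_l2 (Y i m)) (abs_l2 (Y j m)) \<le> dist (abs_l2 (Y i k)) (abs_l2 (Y j k)) + L * dist (abs_l2 (Y i 0)) (abs_l2 (Y j 0))"
          using interp[OF ch m] m by (simp add: ab dist_norm)
        also have "\<dots> < e / 2 + e / 2"
        proof (rule add_less_le_mono)
          show "dist (abs_l2 (Y i k)) (abs_l2 (Y j k)) < e / 2" using M1 ij by simp
          have "L * dist (abs_l2 (Y i 0)) (abs_l2 (Y j 0)) \<le> (L + 1) * (e / 2 / (L + 1))"
            using M2[of i j] ij L(1) by (intro mult_mono) auto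
          also have "\<dots> = e / 2" using L(1) nonzero_mult_div_cancel_left[of "L + 1" "e / 2"] by simp
          finally show "L * dist (abs_l2 (Y i 0)) (abs_l2 (Y j 0)) \<le> e / 2" .
        qed
        finally show ?thesis by simp
      qed
      then show "\<exists>M. \<forall>i\<ge>M. \<forall>j\<ge>M. dist (abs_l2 (Y i m)) (abs_l2 (Y j m)) < e" by blast
    qed
    have "\<forall>m. \<exists>v. m \<le> k \<longrightarrow> (\<lambda>n. abs_l2 (Y n m)) \<longlonglongrightarrow> v"
      using Cm by (auto simp: Cauchy_convergent_iff convergent_def)
    then obtain v where v: "\<And>m. m \<le> k \<Longrightarrow> (\<lambda>n. abs_l2 (Y n m)) \<longlonglongrightarrow> v m" by metis
    have Wu: "has_weak_deriv m u (v m)" if "m \<le> k" for m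
      by (rule has_weak_deriv_limit[OF lim0 v[OF that] W[OF that]])
    then have "u \<in> sobolev k" by (auto simp: sobolev_def)
    then obtain F where F: "chain k F" "\<And>m. m \<le> k \<Longrightarrow> abs_l2 (F m) = weak_deriv m u"
      using sobolev_chain by blast
    have Fv: "abs_l2 (F m) = v m" if "m \<le> k" for m using F(2)[OF that] weak_deriv_eq[OF Wu[OF that]] by simp
    have F0: "abs_l2 (F 0) = u" using F(2)[of 0] by (simp add: weak_deriv_0)
    have tr: "(\<lambda>n. Y n m c) \<longlonglongrightarrow> F m c" if m: "m < k" and c: "c = 0 \<or> c = 1" for m c
    proof (rule LIM_zero_cancel, rule Lim_null_comparison)
      have ch: "chain k (\<lambda>m x. Y n m x - F m x)" for n by (intro chain_diff Yk F)
      have ab: "abs_l2 (\<lambda>x. Y n m x - F m x) = abs_l2 (Y n m) - v m" if "m \<le> k" for m n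
        using abs_l2_diff[OF chain_sq[OF Yk that] chain_sq[OF F(1) that]] Fv[OF that] by simp
      show "\<forall>\<^sub>F n in sequentially. norm (Y n m c - F m c) \<le> norm (abs_l2 (Y n m) - v m) + norm (abs_l2 (Y n (Suc m)) - v (Suc m))"
        using chain_trace_le[OF ch m c] m by (simp add: ab)
      have "(\<lambda>n. norm (abs_l2 (Y n m) - v m) + norm (abs_l2 (Y n (Suc m)) - v (Suc m))) \<longlonglongrightarrow> 0 + 0"
        using m by (intro tendsto_add tendsto_norm_zero LIM_zero v) auto
      then show "(\<lambda>n. norm (abs_l2 (Y n m) - v m) + norm (abs_l2 (Y n (Suc m)) - v (Suc m))) \<longlonglongrightarrow> 0" by simp
    qed
    have bcF: "boundary_conditions \<alpha> k F"
      by (rule boundary_conditions_limit[OF boundary_conditions_le[OF Y(2)] tr])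
    have e0: "\<epsilon> 0 \<le> E"
    proof (rule power2_le_imp_le)
      show "(\<epsilon> 0)\<^sup>2 \<le> E\<^sup>2" using Y(5)[of 1] by simp
    qed (rule E)
    have Y0: "chain_norm 5 (Y 0) \<le> E" using Y(4)[of 0] e0 by simp
    have nk: "norm (abs_l2 (Y n k)) \<le> (1 + c) * E" for n
    proof -
      have "(norm (abs_l2 (Y n k) - abs_l2 (Y 0 k)))\<^sup>2 \<le> 28 * K\<^sup>2 * (4 * 1024\<^sup>2 * E\<^sup>2)"
        using order_trans[OF blk[of 0 n, unfolded atLeast0LessThan] mult_left_mono[OF a2[of n], of "28 * K\<^sup>2"]] by simp
      also have "\<dots> \<le> (c * E)\<^sup>2" using zero_le_power2[of "K * E"] by (simp add: c_def power_mult_distrib)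
      finally have "norm (abs_l2 (Y n k) - abs_l2 (Y 0 k)) \<le> c * E"
        by (rule power2_le_imp_le) (use c0 E in simp)
      moreover have "norm (abs_l2 (Y 0 k)) \<le> E" using norm_le_chain_norm[of k 5 "Y 0"] k Y0 by simp
      moreover have "norm (abs_l2 (Y n k)) \<le> norm (abs_l2 (Y n k) - abs_l2 (Y 0 k)) + norm (abs_l2 (Y 0 k))"
        using norm_triangle_ineq[of "abs_l2 (Y n k) - abs_l2 (Y 0 k)" "abs_l2 (Y 0 k)"] by simp
      ultimately show ?thesis by (simp add: algebra_simps)
    qed
    have Fk: "norm (abs_l2 (F k)) \<le> (1 + c) * E"
      using LIMSEQ_le_const2[OF tendsto_norm[OF v[OF order_refl]]] nk Fv[of k] by auto
    have un: "norm u \<le> 3 * E"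
    proof -
      have "norm u \<le> norm (u - abs_l2 (Y 0 0)) + norm (abs_l2 (Y 0 0))"
        using norm_triangle_ineq[of "u - abs_l2 (Y 0 0)" "abs_l2 (Y 0 0)"] by simp
      also have "\<dots> \<le> E + E"
        using Y(3)[of 0] e0 norm_le_chain_norm[of 0 5 "Y 0"] Y0 by (intro add_mono) auto
      finally show ?thesis using E by simp
    qed
    have "norm (abs_l2 (F m)) \<le> (1 + c + 3 * L) * E" if "m \<le> k" for m
    proof -
      have "norm (abs_l2 (F m)) \<le> norm (abs_l2 (F k)) + L * norm (abs_l2 (F 0))" by (rule interp[OF F(1) that])
      also have "\<dots> \<le> (1 + c) * E + L * (3 * E)" using Fk un L(1) F0 by (intro add_mono mult_left_mono) auto
      finally show ?thesis by (simp add: algebra_simps)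
    qed
    then have "chain_norm k F \<le> (\<Sum>m\<le>k. (1 + c + 3 * L) * E)"
      unfolding chain_norm_def by (intro sum_mono) auto
    then have "chain_norm k F \<le> (real k + 1) * (1 + c + 3 * L) * E" by (simp add: add.commute mult.assoc)
    with F(1) bcF F0 show "\<exists>F. chain k F \<and> boundary_conditions \<alpha> k F \<and> abs_l2 (F 0) = u \<and>
        chain_norm k F \<le> (real k + 1) * (1 + c + 3 * L) * E" by blast
  qed
qed

section \<open>Polynomial correction of the free traces\<close>

definition unit_chain :: "nat \<Rightarrow> real \<Rightarrow> complex" where
  "unit_chain m x = (if m = 0 then 1 else 0)"

lemma chain_unit: "chain k unit_chain"
proof -
  have "unit_chain 0 = (\<lambda>x. 1)" "unit_chain (Suc m) = (\<lambda>x. 0)" for m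
    by (auto simp: unit_chain_def)
  then have "ac (unit_chain m) (unit_chain (Suc m))" for m
    using ac_const by (cases m) auto
  moreover have "unit_chain k = (\<lambda>x. if k = 0 then 1 else 0)" by (auto simp: unit_chain_def)
  ultimately show ?thesis by (simp add: chain_def square_integrable_const)
qed

text \<open>The polynomials \<open>x\<^sup>2 (1 - x)\<^sup>3 + \<alpha> (1 - x)\<^sup>2 x\<^sup>3\<close>, \<open>(1 - x)\<^sup>3 x\<^sup>4\<close> and \<open>x\<^sup>3 (1 - x)\<^sup>4\<close>, which correct
  the second and third traces without leaving \<open>D(A)\<close>.\<close>

definition second_trace_chain :: "real \<Rightarrow> nat \<Rightarrow> real \<Rightarrow> complex" where
  "second_trace_chain \<alpha> m x =
     mul_affine 0 1 (mul_affine 0 1 (mul_affine 1 (-1) (mul_affine 1 (-1) (mul_affine 1 (-1) unit_chain)))) m x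
   + complex_of_real \<alpha> *
     mul_affine 1 (-1) (mul_affine 1 (-1) (mul_affine 0 1 (mul_affine 0 1 (mul_affine 0 1 unit_chain)))) m x"

definition third_trace_chain :: "bool \<Rightarrow> nat \<Rightarrow> real \<Rightarrow> complex" where
  "third_trace_chain right = (if right
     then mul_affine 1 (-1) (mul_affine 1 (-1) (mul_affine 1 (-1) (mul_affine 0 1 (mul_affine 0 1 (mul_affine 0 1 (mul_affine 0 1 unit_chain))))))
     else mul_affine 0 1 (mul_affine 0 1 (mul_affine 0 1 (mul_affine 1 (-1) (mul_affine 1 (-1) (mul_affine 1 (-1) (mul_affine 1 (-1) unit_chain)))))))"

lemma chain_trace_chains:
  "chain k (second_trace_chain \<alpha>)" "chain k (third_trace_chain b)"
  unfolding second_trace_chain_def[abs_def] third_trace_chain_def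
  by (auto intro!: chain_add chain_scale chain_mul_affine chain_unit)

lemma second_trace_chain_traces:
  "second_trace_chain \<alpha> 0 0 = 0" "second_trace_chain \<alpha> 0 1 = 0"
  "second_trace_chain \<alpha> (Suc 0) 0 = 0" "second_trace_chain \<alpha> (Suc 0) 1 = 0"
  "second_trace_chain \<alpha> 2 0 = 2" "second_trace_chain \<alpha> 2 1 = 2 * complex_of_real \<alpha>"
  by (simp_all add: second_trace_chain_def mul_affine_def unit_chain_def)

lemma third_trace_chain_traces:
  assumes "c = 0 \<or> c = 1"
  shows "third_trace_chain b 0 c = 0" "third_trace_chain b (Suc 0) c = 0" "third_trace_chain b 2 c = 0"
  using assms by (auto simp: third_trace_chain_def mul_affine_def unit_chain_def)

lemma third_trace_chain_third_traces:
  "third_trace_chain True 3 0 = 0" "third_trace_chain True 3 1 = -6"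
  "third_trace_chain False 3 0 = 6" "third_trace_chain False 3 1 = 0"
  by (simp_all add: third_trace_chain_def mul_affine_def unit_chain_def)

lemma boundary_conditions_trace_chains:
  "boundary_conditions \<alpha> k (second_trace_chain \<alpha>)" "boundary_conditions \<alpha> k (third_trace_chain b)"
  using third_trace_chain_traces[of 0 b] third_trace_chain_traces[of 1 b] second_trace_chain_traces[of \<alpha>]
  by (simp_all add: boundary_conditions_def)

lemma boundary_conditions_add:
  "boundary_conditions \<alpha> k F \<Longrightarrow> boundary_conditions \<alpha> k G \<Longrightarrow> boundary_conditions \<alpha> k (\<lambda>m x. F m x + G m x)"
  by (simp add: boundary_conditions_def distrib_left)

lemma boundary_conditions_scale:
  "boundary_conditions \<alpha> k F \<Longrightarrow> boundary_conditions \<alpha> k (\<lambda>m x. c * F m x)"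
  by (simp add: boundary_conditions_def)

lemma zero_traces_boundary: "zero_traces Y \<Longrightarrow> boundary_conditions \<alpha> 5 Y"
  by (simp add: zero_traces_def zero_trace_def boundary_conditions_def)

text \<open>The condition \<open>Q\<close> is a parameter so that it can be weakened step by step,
  from the vanishing of all traces to the boundary conditions of order \<open>k\<close>.\<close>

definition approximable :: "real \<Rightarrow> nat \<Rightarrow> ((nat \<Rightarrow> real \<Rightarrow> complex) \<Rightarrow> bool) \<Rightarrow> bool" where
  "approximable \<alpha> k Q \<longleftrightarrow> (\<exists>C\<ge>0. \<forall>F. chain k F \<longrightarrow> Q F \<longrightarrow>
     approx (boundary_conditions \<alpha> 5) k (C * chain_norm k F) (abs_l2 (F 0)))"

lemma approximable_zero_traces:
  assumes "1 \<le> k" "k \<le> 4"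
  shows "approximable \<alpha> k (\<lambda>F. zero_trace 0 k F \<and> zero_trace 1 k F)"
  unfolding approximable_def
proof (intro exI[of _ "4 * 10 ^ 30"] conjI allI impI)
  fix F assume F: "chain k F" "zero_trace 0 k F \<and> zero_trace 1 k F"
  show "approx (boundary_conditions \<alpha> 5) k (4 * 10 ^ 30 * chain_norm k F) (abs_l2 (F 0))"
    by (rule approx_mono[OF approx_zero_traces[OF F(1)]])
      (use F assms zero_traces_boundary chain_norm_nonneg in auto)
qed simp

lemma chain_trace_le_norm:
  assumes "chain k F" "m < k" "c = 0 \<or> c = 1"
  shows "cmod (F m c) \<le> chain_norm k F"
proof -
  have "norm (abs_l2 (F m)) + norm (abs_l2 (F (Suc m))) = (\<Sum>i\<in>{m, Suc m}. norm (abs_l2 (F i)))" by simp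
  also have "\<dots> \<le> chain_norm k F"
    unfolding chain_norm_def by (rule sum_mono2) (use assms(2) in auto)
  finally show ?thesis using chain_trace_le[OF assms] by linarith
qed

text \<open>Adding r F^(m)(c) H leads from \<open>Q'\<close> to \<open>Q\<close>. The multiple of
  \<open>H\<close> is subtracted again afterwards; lying in the domain, it is its own approximant at
  every scale. The trace inequality bounds the coefficient by the H^k norm, so the constant stays
  uniform in \<open>F\<close>.\<close>

lemma approximable_correct:
  assumes Q: "approximable \<alpha> k Q" and k: "k \<le> 4"
    and H: "chain 5 H" "boundary_conditions \<alpha> 5 H" and m: "m < k" "c = 0 \<or> c = 1" "cmod r \<le> 1"
    and QH: "\<And>F. chain k F \<Longrightarrow> Q' F \<Longrightarrow> Q (\<lambda>i x. F i x + (r * F m c) * H i x)"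
  shows "approximable \<alpha> k Q'"
proof -
  obtain C where C: "0 \<le> C" "\<And>F. chain k F \<Longrightarrow> Q F \<Longrightarrow>
      approx (boundary_conditions \<alpha> 5) k (C * chain_norm k F) (abs_l2 (F 0))"
    using Q by (auto simp: approximable_def)
  define h where "h = chain_norm 5 H"
  have h: "0 \<le> h" by (simp add: h_def chain_norm_nonneg)
  have Hk: "chain k H" "chain_norm k H \<le> h"
    using chain_le[OF H(1), of k] k by (auto simp: h_def chain_norm_def intro!: sum_mono2)
  show ?thesis
    unfolding approximable_def
  proof (intro exI[of _ "2 * (C * (1 + h) + 2 * h)"] conjI allI impI)
    fix F assume F: "chain k F" "Q' F"
    define p where "p = r * F m c"
    define n where "n = chain_norm k F"
    have n0: "0 \<le> n" by (simp add: n_def chain_norm_nonneg)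
    have "cmod p \<le> 1 * cmod (F m c)" unfolding p_def norm_mult using m(3) by (intro mult_right_mono) auto
    then have p: "cmod p \<le> n" using chain_trace_le_norm[OF F(1) m(1,2)] by (simp add: n_def)
    have sc: "chain_norm k (\<lambda>i x. p * H i x) \<le> n * h" "chain_norm 5 (\<lambda>i x. (- p) * H i x) \<le> n * h"
      using chain_norm_scale[OF Hk(1), of p] chain_norm_scale[OF H(1), of "- p"] p Hk(2) n0 h chain_norm_nonneg
      by (auto simp: h_def[symmetric] intro!: mult_mono)
    define G where "G i x = F i x + p * H i x" for i x
    have G: "chain k G" unfolding G_def[abs_def] by (intro chain_add chain_scale F Hk)
    have Gn: "chain_norm k G \<le> n * (1 + h)"
      using chain_norm_add[OF F(1) chain_scale[OF Hk(1)], of p] sc(1) by (simp add: G_def[abs_def] n_def distrib_left)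
    have "approx (boundary_conditions \<alpha> 5) k (C * chain_norm k G) (abs_l2 (G 0))"
      using C(2)[OF G] QH[OF F] by (simp add: G_def[abs_def] p_def)
    then have 1: "approx (boundary_conditions \<alpha> 5) k (C * (n * (1 + h))) (abs_l2 (G 0))"
      by (rule approx_mono) (use C(1) Gn chain_norm_nonneg in \<open>auto intro: mult_left_mono\<close>)
    have "approx (boundary_conditions \<alpha> 5) k (2 * chain_norm 5 (\<lambda>i x. (- p) * H i x)) (abs_l2 (\<lambda>x. (- p) * H 0 x))"
      by (rule approx_single[where Y = "\<lambda>i x. (- p) * H i x"])
        (intro chain_scale H boundary_conditions_scale k)+
    then have 2: "approx (boundary_conditions \<alpha> 5) k (2 * (n * h)) (abs_l2 (\<lambda>x. (- p) * H 0 x))"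
      by (rule approx_mono) (use sc(2) chain_norm_nonneg in auto)
    have "approx (boundary_conditions \<alpha> 5) k (2 * (C * (n * (1 + h)) + 2 * (n * h))) (abs_l2 (G 0) + abs_l2 (\<lambda>x. (- p) * H 0 x))"
      by (rule approx_add[OF 1 2]) (use C(1) h n0 boundary_conditions_add in auto)
    moreover have "abs_l2 (G 0) + abs_l2 (\<lambda>x. (- p) * H 0 x) = abs_l2 (F 0)"
    proof -
      have "abs_l2 (\<lambda>x. G 0 x + (- p) * H 0 x) = abs_l2 (G 0) + abs_l2 (\<lambda>x. (- p) * H 0 x)"
        by (rule abs_l2_add) (use chain_sq[OF G] chain_sq[OF H(1)] square_integrable_scale square_integrable_minus in auto)
      then show ?thesis by (simp add: G_def)
    qed
    ultimately show "approx (boundary_conditions \<alpha> 5) k (2 * (C * (1 + h) + 2 * h) * chain_norm k F) (abs_l2 (F 0))"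
      by (simp add: n_def algebra_simps)
  qed (use C(1) h in auto)
qed

text \<open>For k = 1 and k = 2 the boundary conditions already make all traces of order below
  \<open>k\<close> vanish. For k = 3 one direction remains, that of the coupled second traces, and
  for k = 4 the two third traces are added to it.\<close>

lemma boundary_conditions_approximable:
  assumes k: "1 \<le> k" "k \<le> 4"
  shows "approximable \<alpha> k (boundary_conditions \<alpha> k)"
proof -
  note base = approximable_zero_traces[OF k, of \<alpha>]
  have all_lt: "(\<forall>m<Suc n. P m) \<longleftrightarrow> (\<forall>m<n. P m) \<and> P n" for P and n :: nat
    using less_Suc_eq by auto
  consider "k = 1" | "k = 2" | "k = 3" | "k = 4" using k by linarith
  then show ?thesis
  proof cases
    case 1
    then show ?thesis using base
      by (simp add: approximable_def zero_trace_def boundary_conditions_def)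
  next
    case 2
    then show ?thesis using base
      by (simp add: approximable_def zero_trace_def boundary_conditions_def all_lt eval_nat_numeral)
        (metis One_nat_def)
  next
    case 3
    \<comment> \<open>\<open>second_trace_chain\<close> has second traces 2 at 0 and 2 \<alpha> at
      1, so r = - 1/2 removes the trace at 0 and, by the coupling, also the one at 1.\<close>
    show ?thesis
    proof (rule approximable_correct[OF base k(2) chain_trace_chains(1) boundary_conditions_trace_chains(1), where m = 2 and c = 0 and r = "- 1/2"])
      fix F assume "chain k F" and bc: "boundary_conditions \<alpha> k F"
      then show "zero_trace 0 k (\<lambda>i x. F i x + (- 1/2) * F 2 0 * second_trace_chain \<alpha> i x) \<and>
          zero_trace 1 k (\<lambda>i x. F i x + (- 1/2) * F 2 0 * second_trace_chain \<alpha> i x)"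
        using second_trace_chain_traces[of \<alpha>] 3
        by (auto simp: zero_trace_def boundary_conditions_def less_Suc_eq numeral_3_eq_3 numeral_2_eq_2)
    qed (use 3 in auto)
  next
    case 4
    \<comment> \<open>From the vanishing of all traces, the third trace at 0 is released to reach
      \<open>Q1\<close>, the third trace at 1 to reach \<open>Q\<close>, and finally the second
      traces. The order matters: correcting the second traces may change the third ones, whereas the
      correctors of third traces have vanishing lower traces.\<close>
    define Q where "Q F \<longleftrightarrow> (\<forall>m<3. F m 0 = 0 \<and> F m 1 = (0::complex))" for F :: "nat \<Rightarrow> real \<Rightarrow> complex"
    define Q1 where "Q1 F \<longleftrightarrow> Q F \<and> F 3 1 = 0" for F :: "nat \<Rightarrow> real \<Rightarrow> complex"
    have m3: "m < 3 \<longleftrightarrow> m = 0 \<or> m = Suc 0 \<or> m = 2" for m :: nat by auto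
    have m4: "m < 4 \<longleftrightarrow> m = 0 \<or> m = Suc 0 \<or> m = 2 \<or> m = 3" for m :: nat by auto
    \<comment> \<open>\<open>third_trace_chain False\<close> has third traces 6 at 0 and 0 at 1, its
      counterpart 0 and -6; hence the factors -1/6 here and 1/6 below.\<close>
    have "approximable \<alpha> k Q1"
    proof (rule approximable_correct[OF base k(2) chain_trace_chains(2) boundary_conditions_trace_chains(2)[of _ _ False], where m = 3 and c = 0 and r = "- 1/6"])
      fix F assume "chain k F" "Q1 F"
      then show "zero_trace 0 k (\<lambda>i x. F i x + (- 1/6) * F 3 0 * third_trace_chain False i x) \<and>
          zero_trace 1 k (\<lambda>i x. F i x + (- 1/6) * F 3 0 * third_trace_chain False i x)"
        using third_trace_chain_traces[of 0 False] third_trace_chain_traces[of 1 False] third_trace_chain_third_traces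
        by (auto simp: zero_trace_def Q1_def Q_def 4 m3 m4)
    qed (use 4 in auto)
    then have "approximable \<alpha> k Q"
    proof (rule approximable_correct[OF _ k(2) chain_trace_chains(2) boundary_conditions_trace_chains(2)[of _ _ True], where m = 3 and c = 1 and r = "1/6"])
      fix F assume "chain k F" "Q F"
      then show "Q1 (\<lambda>i x. F i x + 1/6 * F 3 1 * third_trace_chain True i x)"
        using third_trace_chain_traces[of 0 True] third_trace_chain_traces[of 1 True] third_trace_chain_third_traces
        by (auto simp: Q1_def Q_def m3)
    qed (use 4 in auto)
    then show ?thesis
    proof (rule approximable_correct[OF _ k(2) chain_trace_chains(1) boundary_conditions_trace_chains(1), where m = 2 and c = 0 and r = "- 1/2"])
      fix F assume "chain k F" and bc: "boundary_conditions \<alpha> k F"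
      then show "Q (\<lambda>i x. F i x + (- 1/2) * F 2 0 * second_trace_chain \<alpha> i x)"
        using second_trace_chain_traces[of \<alpha>]
        by (auto simp: Q_def boundary_conditions_def 4 m3)
    qed (use 4 in auto)
  qed
qed

theorem theorem1p1:
  fixes \<alpha> :: real and S :: "real \<Rightarrow> l2 \<Rightarrow> l2"
  assumes "\<bar>\<alpha>\<bar> < 1"
    and "C0_semigroup S"
    and "is_generator S (kawahara_domain \<alpha>) kawahara_op"
  shows "\<exists>\<omega>>0. \<forall>k\<in>{0..5::nat}. \<exists>C>0. \<forall>t>0. \<forall>u0\<in>sobolev_bc \<alpha> k.
           S t u0 \<in> sobolev_bc \<alpha> k \<and>
           sobolev_norm k (S t u0) \<le> C * exp (- \<omega> * t) * sobolev_norm k u0"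
proof -
  interpret c0_semigroup S by unfold_locales (rule assms(2))
  obtain \<omega> C0 where om: "0 < \<omega>" and C0: "1 \<le> C0"
    and dec0: "\<And>t u. 0 \<le> t \<Longrightarrow> norm (S t u) \<le> C0 * exp (- \<omega> * t) * norm u"
    using kawahara_l2_decay[OF assms] by blast
  obtain C5 where C5: "C0 \<le> C5" and dec5: "\<And>t Y. 0 \<le> t \<Longrightarrow> chain 5 Y \<Longrightarrow> boundary_conditions \<alpha> 5 Y \<Longrightarrow>
      \<exists>Z. chain 5 Z \<and> boundary_conditions \<alpha> 5 Z \<and> abs_l2 (Z 0) = S t (abs_l2 (Y 0)) \<and>
        chain_norm 5 Z \<le> C5 * exp (- \<omega> * t) * chain_norm 5 Y"
    using kawahara_domain_decay[OF assms(2,3) dec0 C0] by blast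
  have C50: "0 \<le> C5" using C0 C5 by simp
  have main: "\<exists>C\<ge>0. \<forall>t>0. \<forall>F. chain k F \<longrightarrow> boundary_conditions \<alpha> k F \<longrightarrow>
      (\<exists>G. chain k G \<and> boundary_conditions \<alpha> k G \<and> abs_l2 (G 0) = S t (abs_l2 (F 0)) \<and>
        chain_norm k G \<le> C * exp (- \<omega> * t) * chain_norm k F)" if k5: "k \<le> 5" for k
  proof -
    consider "k = 0" | "1 \<le> k" "k \<le> 4" | "k = 5" using k5 by linarith
    then show ?thesis
    proof cases
      case 1
      show ?thesis
      proof (intro exI[of _ C0] conjI allI impI)
        fix t :: real and F assume t: "0 < t" and F: "chain k F"
        \<comment> \<open>For k = 0 only the entry of index 0 of a chain matters, so a constant
          family of representatives is a witness.\<close>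
        show "\<exists>G. chain k G \<and> boundary_conditions \<alpha> k G \<and> abs_l2 (G 0) = S t (abs_l2 (F 0)) \<and>
            chain_norm k G \<le> C0 * exp (- \<omega> * t) * chain_norm k F"
          using dec0[of t "abs_l2 (F 0)"] t 1
          by (intro exI[of _ "\<lambda>_. rep_l2 (S t (abs_l2 (F 0)))"])
            (simp add: chain_def boundary_conditions_def chain_norm_def abs_rep_l2 square_integrable_rep)
      qed (use C0 in auto)
    next
      case 2
      \<comment> \<open>\<open>Ca\<close> and \<open>Cb\<close> pass from the H^k norm to the
        interpolation norm and back; in between, \<open>S t\<close> acts with the single factor
        \<open>E\<close> at both end points.\<close>
      obtain Ca where Ca: "0 \<le> Ca" "\<And>F. chain k F \<Longrightarrow> boundary_conditions \<alpha> k F \<Longrightarrow>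
          approx (boundary_conditions \<alpha> 5) k (Ca * chain_norm k F) (abs_l2 (F 0))"
        using boundary_conditions_approximable[OF 2, of \<alpha>] by (auto simp: approximable_def)
      obtain Cb where Cb: "0 \<le> Cb" "\<And>E u. 0 \<le> E \<Longrightarrow> approx (boundary_conditions \<alpha> 5) k E u \<Longrightarrow>
          \<exists>F. chain k F \<and> boundary_conditions \<alpha> k F \<and> abs_l2 (F 0) = u \<and> chain_norm k F \<le> Cb * E"
        using approx_imp_chain[OF 2] by blast
      show ?thesis
      proof (intro exI[of _ "Cb * C5 * Ca"] conjI allI impI)
        fix t :: real and F assume t: "0 < t" and F: "chain k F" "boundary_conditions \<alpha> k F"
        define E where "E = C5 * exp (- \<omega> * t)"
        have E: "0 \<le> E" using C50 by (simp add: E_def)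
        have "approx (boundary_conditions \<alpha> 5) k (E * (Ca * chain_norm k F)) (S t (abs_l2 (F 0)))"
        proof (rule approx_transform[OF Ca(2)[OF F]])
          show "S t (x - y) = S t x - S t y" for x y using Sdiff[of t x y] t by simp
          have "C0 * exp (- \<omega> * t) * norm x \<le> E * norm x" for x :: l2
            unfolding E_def using C5 by (intro mult_right_mono) auto
          then show "norm (S t x) \<le> E * norm x" for x using dec0[of t x] t order_trans by fastforce
          show "\<exists>Z. chain 5 Z \<and> boundary_conditions \<alpha> 5 Z \<and> abs_l2 (Z 0) = S t (abs_l2 (Y 0)) \<and> chain_norm 5 Z \<le> E * chain_norm 5 Y"
            if "chain 5 Y" "boundary_conditions \<alpha> 5 Y" for Y
            using dec5[OF _ that, of t] t by (simp add: E_def)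
        qed (rule E)
        moreover have "0 \<le> E * (Ca * chain_norm k F)" using E Ca(1) chain_norm_nonneg by simp
        ultimately obtain G where "chain k G" "boundary_conditions \<alpha> k G" "abs_l2 (G 0) = S t (abs_l2 (F 0))"
          "chain_norm k G \<le> Cb * (E * (Ca * chain_norm k F))" using Cb(2) by blast
        then show "\<exists>G. chain k G \<and> boundary_conditions \<alpha> k G \<and> abs_l2 (G 0) = S t (abs_l2 (F 0)) \<and>
            chain_norm k G \<le> Cb * C5 * Ca * exp (- \<omega> * t) * chain_norm k F"
          by (intro exI[of _ G]) (simp add: E_def mult_ac)
      qed (use Ca Cb C50 in auto)
    next
      case 3
      then show ?thesis using dec5 C50 by (intro exI[of _ C5]) auto
    qed
  qed
  have "\<exists>C>0. \<forall>t>0. \<forall>u0\<in>sobolev_bc \<alpha> k. S t u0 \<in> sobolev_bc \<alpha> k \<and>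
      sobolev_norm k (S t u0) \<le> C * exp (- \<omega> * t) * sobolev_norm k u0" if k5: "k \<le> 5" for k
  proof -
    obtain C where C: "0 \<le> C" "\<And>t F. 0 < t \<Longrightarrow> chain k F \<Longrightarrow> boundary_conditions \<alpha> k F \<Longrightarrow>
      \<exists>G. chain k G \<and> boundary_conditions \<alpha> k G \<and> abs_l2 (G 0) = S t (abs_l2 (F 0)) \<and>
        chain_norm k G \<le> C * exp (- \<omega> * t) * chain_norm k F"
      using main[OF k5] by blast
    \<comment> \<open>The summand 1 in C + 1 makes the constant positive, and k + 1 compares
      \<open>chain_norm\<close> with \<open>sobolev_norm\<close>.\<close>
    show ?thesis
    proof (intro exI[of _ "(C + 1) * (real k + 1)"] conjI allI impI ballI)
      fix t :: real and u0 assume t: "0 < t" and u0: "u0 \<in> sobolev_bc \<alpha> k"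
      obtain F where F: "chain k F" "boundary_conditions \<alpha> k F" "abs_l2 (F 0) = u0"
        by (rule sobolev_bc_chain[OF u0], rule that)
      obtain G where G: "chain k G" "boundary_conditions \<alpha> k G" "abs_l2 (G 0) = S t u0"
        "chain_norm k G \<le> C * exp (- \<omega> * t) * chain_norm k F"
        using C(2)[OF t F(1,2)] F(3) by blast
      show "S t u0 \<in> sobolev_bc \<alpha> k" using sobolev_bc_iff[OF G(1)] G by simp
      have "sobolev_norm k (S t u0) \<le> chain_norm k G" using sobolev_norm_chain(1)[OF G(1)] G(3) by simp
      also have "\<dots> \<le> C * exp (- \<omega> * t) * chain_norm k F" by (rule G(4))
      also have "\<dots> \<le> (C + 1) * exp (- \<omega> * t) * chain_norm k F"
        using chain_norm_nonneg by (intro mult_right_mono) auto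
      also have "\<dots> \<le> (C + 1) * exp (- \<omega> * t) * ((real k + 1) * sobolev_norm k u0)"
        using sobolev_norm_chain(2)[OF F(1)] F(3) C(1) by (intro mult_left_mono) auto
      finally show "sobolev_norm k (S t u0) \<le> (C + 1) * (real k + 1) * exp (- \<omega> * t) * sobolev_norm k u0"
        by (simp add: mult_ac)
    qed (use C(1) in simp)
  qed
  then show ?thesis using om by (intro exI[of _ \<omega>]) auto
qed

end
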